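(* Let $d\ge 1$ and let $G\subset\operatorname{Diff}[[\mathbb C^d,0]]$ be a commutative finitely generated subgroup of formal self-maps (finitely generated in the sense given in the context, i.e. both discrete and infinitesimal generators are allowed). Then for any two formal subvarieties $X,Y$ the intersection multiplicity function $\mu:G\to\mathbb N\cup\{+\infty\}$, $\mu(g)=\mu(g^{-1}(X),Y)$, has bounded finite values: there exists a finite constant $m\in\mathbb N$, depending on $G$, $X$ and $Y$, such that for all $g\in G$, $$\mu(g)<+\infty\implies \mu(g)\le m.$$
   Context: $\mathbb C[[x]]=\mathbb C[[x_1,\dots,x_d]]$ is the algebra of formal power series, $\mathfrak m$ its maximal ideal (series without free term). A formal self-map $F$ is a $d$-tuple of elements of $\mathfrak m$; it acts by $F^*:\mathbb C[[x]]\to\mathbb C[[x]]$, $f\mapsto f\circ F$. It is invertible if its matrix of linear terms has nonzero determinant. Invertible formal self-maps form a group under composition, denoted $\operatorname{Diff}[[\mathbb C^d,0]]$. A formal vector field $v=(v_1,\dots,v_d)$ is a $d$-tuple of elements of $\mathfrak m$; it acts on $\mathbb C[[x]]$ as the derivation $Vf=\sum_{j}\frac{\partial f}{\partial x_j}v_j$. Its formal flow is the one-parameter subgroup $\{\mathrm e^{tv}:t\in\mathbb C\}\subset\operatorname{Diff}[[\mathbb C^d,0]]$ determined by $(\mathrm e^{tv})^*=\sum_{k\ge0}\frac{t^k}{k!}V^k$ (the series converges termwise). A subgroup $G\subset\operatorname{Diff}[[\mathbb C^d,0]]$ is finitely generated if there are finitely many invertible formal self-maps $F_1,\dots,F_p$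 and formal vector fields $v_1,\dots,v_q$ ($p=0$ or $q=0$ allowed) such that $G$ consists of all finite compositions of the maps $F_i^{\pm1}$ and the flow maps $\mathrm e^{t v_j}$, $t\in\mathbb C$. A formal subvariety $X$ is identified with a radical ideal $I_X\subset\mathbb C[[x]]$. The preimage $g^{-1}(X)$ under $g\in\operatorname{Diff}[[\mathbb C^d,0]]$ is the formal subvariety associated with the ideal $g^*I_X$. The intersection multiplicity of formal subvarieties is $\mu(X,Y)=\operatorname{codim}_{\mathbb C}\langle I_X,I_Y\rangle=\dim_{\mathbb C}\mathbb C[[x]]/\langle I_X,I_Y\rangle\in\mathbb N\cup\{+\infty\}$, where $\langle I_X,I_Y\rangle$ is the ideal generated jointly by $I_X$ and $I_Y$. No assumption is made on the dimensions of $X,Y$. *)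

theory Defs
  imports
    "HOL-Analysis.Determinants"
    "HOL-Library.Extended_Nat"
    "HOL-Algebra.Embedded_Algebras"
    "HOL-Algebra.QuotRing"
    "HOL-Decision_Procs.Algebra_Aux"
begin

section \<open>The algebra of formal power series in several variables\<close>

text \<open>
  The number of variables is \<open>CARD('n)\<close>; a series is the family of its coefficients, indexed by
  multi-indices \<open>\<alpha> :: nat ^ 'n\<close>.
\<close>

typedef 'n mfps = "UNIV :: (nat ^ ('n::finite) \<Rightarrow> complex) set"
  morphisms mcoeff Abs_mfps ..

lemma mcoeff_Abs_mfps [simp]: "mcoeff (Abs_mfps f) = f"
  by (simp add: Abs_mfps_inverse)

lemma mfps_eqI: "(\<And>\<gamma>. mcoeff f \<gamma> = mcoeff g \<gamma>) \<Longrightarrow> f = g"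
  by (metis mcoeff_inject ext)

lemma finite_vec_le: "finite {\<alpha> :: nat ^ 'n::finite. \<forall>i. \<alpha> $ i \<le> b i}"
proof -
  have "{\<alpha> :: nat ^ 'n. \<forall>i. \<alpha> $ i \<le> b i} \<subseteq> vec_lambda ` Pi\<^sub>E UNIV (\<lambda>i. {..b i})"
  proof
    fix \<alpha> :: "nat ^ 'n"
    assume "\<alpha> \<in> {\<alpha>. \<forall>i. \<alpha> $ i \<le> b i}"
    then have "vec_nth \<alpha> \<in> Pi\<^sub>E UNIV (\<lambda>i. {..b i})" by auto
    moreover have "\<alpha> = vec_lambda (vec_nth \<alpha>)" by simp
    ultimately show "\<alpha> \<in> vec_lambda ` Pi\<^sub>E UNIV (\<lambda>i. {..b i})" by blast
  qed
  then show ?thesis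
    by (rule finite_subset) (intro finite_imageI finite_PiE, auto)
qed

lemma finite_msplit [simp]: "finite {(\<alpha>, \<beta>). \<alpha> + \<beta> = (\<gamma> :: nat ^ 'n::finite)}"
proof (rule finite_subset)
  show "{(\<alpha>, \<beta>). \<alpha> + \<beta> = \<gamma>} \<subseteq> {\<alpha>. \<forall>i. \<alpha> $ i \<le> \<gamma> $ i} \<times> {\<alpha>. \<forall>i. \<alpha> $ i \<le> \<gamma> $ i}"
    by auto
  show "finite ({\<alpha>. \<forall>i. \<alpha> $ i \<le> \<gamma> $ i} \<times> {\<alpha>. \<forall>i. \<alpha> $ i \<le> \<gamma> $ i})"
    by (intro finite_cartesian_product finite_vec_le)
qed

instantiation mfps :: (finite) comm_ring_1
begin

definition "0 = Abs_mfps (\<lambda>_. 0)"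
definition "1 = Abs_mfps (\<lambda>\<gamma>. if \<gamma> = 0 then 1 else 0)"
definition "f + g = Abs_mfps (\<lambda>\<gamma>. mcoeff f \<gamma> + mcoeff g \<gamma>)"
definition "f - g = Abs_mfps (\<lambda>\<gamma>. mcoeff f \<gamma> - mcoeff g \<gamma>)"
definition "- f = Abs_mfps (\<lambda>\<gamma>. - mcoeff f \<gamma>)"
definition "f * g = Abs_mfps (\<lambda>\<gamma>. \<Sum>(\<alpha>, \<beta>) | \<alpha> + \<beta> = \<gamma>. mcoeff f \<alpha> * mcoeff g \<beta>)"

instance
proof
  fix f g h :: "'a mfps"
  show "f + g + h = f + (g + h)" "f + g = g + f" "0 + f = f" "- f + f = 0" "f - g = f + - g"
    by (auto intro!: mfps_eqI simp: plus_mfps_def zero_mfps_def uminus_mfps_def minus_mfps_def)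
  show "(0 :: 'a mfps) \<noteq> 1"
  proof
    assume "(0 :: 'a mfps) = 1"
    then have "mcoeff (0 :: 'a mfps) 0 = mcoeff 1 0" by simp
    then show False by (simp add: zero_mfps_def one_mfps_def)
  qed
  show "(f + g) * h = f * h + g * h"
    by (auto intro!: mfps_eqI sum.cong
        simp: plus_mfps_def times_mfps_def distrib_right sum.distrib[symmetric])
  show "f * g = g * f"
  proof (rule mfps_eqI)
    fix \<gamma>
    have "(\<Sum>(\<alpha>, \<beta>) | \<alpha> + \<beta> = \<gamma>. mcoeff f \<alpha> * mcoeff g \<beta>) =
          (\<Sum>(\<alpha>, \<beta>) | \<alpha> + \<beta> = \<gamma>. mcoeff g \<alpha> * mcoeff f \<beta>)"
      by (rule sum.reindex_bij_witness[of _ prod.swap prod.swap]) (auto simp: add.commute)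
    then show "mcoeff (f * g) \<gamma> = mcoeff (g * f) \<gamma>" by (simp add: times_mfps_def)
  qed
  show "1 * f = f"
  proof (rule mfps_eqI)
    fix \<gamma>
    have "(\<Sum>(\<alpha>, \<beta>) | \<alpha> + \<beta> = \<gamma>. (if \<alpha> = 0 then 1 else 0) * mcoeff f \<beta>) =
          (\<Sum>(\<alpha>, \<beta>) \<in> {(0 :: nat ^ 'a, \<gamma>)}. (if \<alpha> = 0 then 1 else 0) * mcoeff f \<beta>)"
      by (rule sum.mono_neutral_right) (auto split: if_splits)
    then show "mcoeff (1 * f) \<gamma> = mcoeff f \<gamma>" by (simp add: times_mfps_def one_mfps_def)
  qed
  show "f * g * h = f * (g * h)"
  proof (rule mfps_eqI)
    fix \<gamma>
    have "mcoeff (f * g * h) \<gamma> =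
        (\<Sum>(\<delta>, \<epsilon>) | \<delta> + \<epsilon> = \<gamma>. \<Sum>(\<alpha>, \<beta>) | \<alpha> + \<beta> = \<delta>. mcoeff f \<alpha> * mcoeff g \<beta> * mcoeff h \<epsilon>)"
      by (simp add: times_mfps_def sum_distrib_right case_prod_unfold)
    also have "\<dots> = (\<Sum>(p, q) \<in> Sigma {(\<delta>, \<epsilon>). \<delta> + \<epsilon> = \<gamma>} (\<lambda>p. {(\<alpha>, \<beta>). \<alpha> + \<beta> = fst p}).
        mcoeff f (fst q) * mcoeff g (snd q) * mcoeff h (snd p))"
      by (subst sum.Sigma[symmetric]) (auto simp: case_prod_unfold finite_msplit[unfolded case_prod_unfold])
    also have "\<dots> = (\<Sum>(p, q) \<in> Sigma {(\<delta>, \<epsilon>). \<delta> + \<epsilon> = \<gamma>} (\<lambda>p. {(\<alpha>, \<beta>). \<alpha> + \<beta> = snd p}).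
        mcoeff f (fst p) * (mcoeff g (fst q) * mcoeff h (snd q)))"
      by (rule sum.reindex_bij_witness
          [of _ "\<lambda>(p, q). ((fst p + fst q, snd q), (fst p, fst q))"
                "\<lambda>(p, q). ((fst q, snd q + snd p), (snd q, snd p))"])
        (auto simp: add.assoc mult.assoc)
    also have "\<dots> = (\<Sum>(\<delta>, \<epsilon>) | \<delta> + \<epsilon> = \<gamma>. \<Sum>(\<alpha>, \<beta>) | \<alpha> + \<beta> = \<epsilon>.
        mcoeff f \<delta> * (mcoeff g \<alpha> * mcoeff h \<beta>))"
      by (subst sum.Sigma[symmetric]) (auto simp: case_prod_unfold finite_msplit[unfolded case_prod_unfold])
    also have "\<dots> = mcoeff (f * (g * h)) \<gamma>"
      by (simp add: times_mfps_def sum_distrib_left case_prod_unfold)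
    finally show "mcoeff (f * g * h) \<gamma> = mcoeff (f * (g * h)) \<gamma>" .
  qed
qed

end

definition mdeg :: "nat ^ 'n::finite \<Rightarrow> nat"
  where "mdeg \<alpha> = (\<Sum>i\<in>UNIV. \<alpha> $ i)"

definition mfps_const :: "complex \<Rightarrow> 'n::finite mfps"
  where "mfps_const c = Abs_mfps (\<lambda>\<gamma>. if \<gamma> = 0 then c else 0)"

definition mfps_var :: "'n::finite \<Rightarrow> 'n mfps"
  where "mfps_var j = Abs_mfps (\<lambda>\<gamma>. if \<gamma> = axis j 1 then 1 else 0)"

definition mfps_pderiv :: "'n::finite \<Rightarrow> 'n mfps \<Rightarrow> 'n mfps"
  where "mfps_pderiv j f = Abs_mfps (\<lambda>\<gamma>. of_nat (\<gamma> $ j + 1) * mcoeff f (\<gamma> + axis j 1))"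

definition mfps_max :: "'n::finite mfps set"
  where "mfps_max = {f. mcoeff f 0 = 0}"


section \<open>Formal self-maps and formal vector fields\<close>

text \<open>
  Both are \<open>d\<close>-tuples of elements of the maximal ideal.
\<close>

definition max_tuples :: "('n::finite mfps ^ 'n) set"
  where "max_tuples = {F. \<forall>j. F $ j \<in> mfps_max}"

text \<open>
  The pullback \<open>f \<circ> F = (\<Sum>\<alpha>. f\<^sub>\<alpha> F\<^sup>\<alpha>)\<close>. For \<open>F \<in> max_tuples\<close> the power product \<open>F\<^sup>\<alpha>\<close> has no
  coefficients in degrees below \<open>mdeg \<alpha>\<close>, so that only the multi-indices with
  \<open>mdeg \<alpha> \<le> mdeg \<gamma>\<close> contribute to the coefficient at \<open>\<gamma>\<close>.
\<close>

definition pullback :: "'n::finite mfps ^ 'n \<Rightarrow> 'n mfps \<Rightarrow> 'n mfps"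
  where "pullback F f = Abs_mfps (\<lambda>\<gamma>.
    \<Sum>\<alpha> | mdeg \<alpha> \<le> mdeg \<gamma>. mcoeff f \<alpha> * mcoeff (\<Prod>i\<in>UNIV. (F $ i) ^ (\<alpha> $ i)) \<gamma>)"

definition linear_part :: "'n::finite mfps ^ 'n \<Rightarrow> complex ^ 'n ^ 'n"
  where "linear_part F = (\<chi> i j. mcoeff (F $ i) (axis j 1))"

definition formal_Diff :: "('n::finite mfps ^ 'n) monoid"
  where "formal_Diff =
    \<lparr>carrier = {F \<in> max_tuples. det (linear_part F) \<noteq> 0},
     monoid.mult = (\<lambda>F G. \<chi> j. pullback G (F $ j)),
     one = (\<chi> j. mfps_var j)\<rparr>"

definition vf_deriv :: "'n::finite mfps ^ 'n \<Rightarrow> 'n mfps \<Rightarrow> 'n mfps"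
  where "vf_deriv v f = (\<Sum>j\<in>UNIV. mfps_pderiv j f * v $ j)"

text \<open>
  \<open>is_flow_map v t F\<close> says that \<open>F\<close> is the flow map \<open>e\<^bsup>tv\<^esup>\<close>: the element of \<open>formal_Diff\<close> with
  \<open>F\<^sup>* = (\<Sum>k. t\<^sup>k / k! V\<^sup>k)\<close>, the series converging coefficientwise. It is uniquely determined,
  since its components are the pullbacks of the coordinate functions.
\<close>

definition is_flow_map :: "'n::finite mfps ^ 'n \<Rightarrow> complex \<Rightarrow> 'n mfps ^ 'n \<Rightarrow> bool"
  where "is_flow_map v t F \<longleftrightarrow> F \<in> carrier formal_Diff \<and>
    (\<forall>f \<gamma>. (\<lambda>k. t ^ k / fact k * mcoeff ((vf_deriv v ^^ k) f) \<gamma>) sums mcoeff (pullback F f) \<gamma>)"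

definition finitely_generated :: "('n::finite mfps ^ 'n) set \<Rightarrow> bool"
  where "finitely_generated G \<longleftrightarrow>
    (\<exists>Fs vs. finite Fs \<and> Fs \<subseteq> carrier formal_Diff \<and> finite vs \<and> vs \<subseteq> max_tuples \<and>
       G = generate formal_Diff (Fs \<union> {F. \<exists>v\<in>vs. \<exists>t. is_flow_map v t F}))"


section \<open>Formal subvarieties and intersection multiplicity\<close>

abbreviation mfps_ring :: "'n::finite mfps ring"
  where "mfps_ring \<equiv> cring_class_ops"

text \<open>
  A formal subvariety is represented by its radical ideal; the unit ideal (the empty
  subvariety) is allowed.
\<close>

definition formal_subvariety :: "'n::finite mfps set \<Rightarrow> bool"
  where "formal_subvariety I \<longleftrightarrow>
    ideal I mfps_ring \<and> (\<forall>f k. k > 0 \<and> f ^ k \<in> I \<longrightarrow> f \<in> I)"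

definition preimage :: "'n::finite mfps ^ 'n \<Rightarrow> 'n mfps set \<Rightarrow> 'n mfps set"
  where "preimage g I = pullback g ` I"

text \<open>
  The dimension of the quotient ring over the image of the constants; the latter is a
  copy of the complex numbers, unless \<open>I\<close> is the unit ideal and the quotient is zero.
\<close>

definition quot_dim :: "'n::finite mfps set \<Rightarrow> nat \<Rightarrow> bool"
  where "quot_dim I k \<longleftrightarrow>
    ring.dimension (mfps_ring Quot I) k
      (range (\<lambda>c. I +>\<^bsub>mfps_ring\<^esub> mfps_const c)) (carrier (mfps_ring Quot I))"

definition codim :: "'n::finite mfps set \<Rightarrow> enat"
  where "codim I = (if \<exists>k. quot_dim I k then enat (THE k. quot_dim I k) else \<infinity>)"

definition intersection_mult :: "'n::finite mfps set \<Rightarrow> 'n mfps set \<Rightarrow> enat"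
  where "intersection_mult I J = codim (Idl\<^bsub>mfps_ring\<^esub> (I \<union> J))"

end

theory Submission
  imports
    Defs
    "HOL-Analysis.Derivative"
    "HOL-Computational_Algebra.Fundamental_Theorem_Algebra"
    "HOL-Library.Function_Algebras"
begin

text \<open>
  By commutativity every \<open>g \<in> G\<close> is a composition of powers \<open>F\<^sup>n\<close> and flow maps, one for each
  generator (for discrete generators also their inverses). The coefficients of such a composition
  are polynomials in finitely many functions of the exponents and flow times: in degree \<open>k\<close> the
  coefficients of \<open>F\<^sup>n\<close> solve a linear recurrence whose matrix is the linear part of \<open>F\<close>, with an
  inhomogeneity that only involves lower degrees, so they are polynomials in \<open>n\<close> and the powers
  \<open>\<lambda>\<^sup>n\<close> of the eigenvalues of the linear part; flow maps lead in the same way to \<open>t\<close> and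
  \<open>exp (\<lambda> t)\<close>. By Hilbert's basis theorem the zero sets of functions in such a finitely generated
  algebra satisfy the descending chain condition. The set of parameters with \<open>\<mu>(g) > k\<close> is such a
  zero set, because \<open>\<mu>(g) \<le> k\<close> is a rank condition modulo the power \<open>k + 1\<close> of the maximal ideal.
  Hence these sets are stationary from some \<open>k = m\<close> on, which means that finite values of
  \<open>\<mu>\<close> do not exceed \<open>m\<close>.
\<close>

section \<open>Coefficients and the order filtration\<close>

text \<open>The matrix of the recurrence is the same in every degree because \<open>F\<close> is
  composed on the outside: at one fixed multi-index the coefficients of the components of F o g form
  a vector in \<complex>^d, on which the linear terms of \<open>F\<close> act by
  \<open>linear_part F\<close>. Hence one finite set of eigenvalues serves all coefficients;
  composition on the inside would bring in the symmetric powers of the linear part. Resonances only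
  raise the power of n or t, and all these powers are generated by n or t alone. The algebra
  consists of actual functions on the parameter space, with possible relations among its generators.
  The basis theorem is therefore proved for a ring generated by one more element, not for polynomial
  rings. The ideals are not given by finite lists of generators, so the rank condition is not
  expressed by minors of a matrix. Instead an element of the ideal at one parameter is extended to a
  section over all parameters, and surjectivity onto a finite-dimensional space is spread from one
  parameter to all those where a single function of the algebra is nonzero. Elimination yields that
  function.\<close>

lemma mcoeff_zero [simp]: "mcoeff 0 \<gamma> = 0"
  by (simp add: zero_mfps_def)

lemma mcoeff_one: "mcoeff 1 \<gamma> = (if \<gamma> = 0 then 1 else 0)"
  by (simp add: one_mfps_def)

lemma mcoeff_add [simp]: "mcoeff (f + g) \<gamma> = mcoeff f \<gamma> + mcoeff g \<gamma>"
  by (simp add: plus_mfps_def)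

lemma mcoeff_diff [simp]: "mcoeff (f - g) \<gamma> = mcoeff f \<gamma> - mcoeff g \<gamma>"
  by (simp add: minus_mfps_def)

lemma mcoeff_uminus [simp]: "mcoeff (- f) \<gamma> = - mcoeff f \<gamma>"
  by (simp add: uminus_mfps_def)

lemma mcoeff_mult: "mcoeff (f * g) \<gamma> = (\<Sum>(\<alpha>, \<beta>) | \<alpha> + \<beta> = \<gamma>. mcoeff f \<alpha> * mcoeff g \<beta>)"
  by (simp add: times_mfps_def)

lemma mcoeff_sum [simp]: "mcoeff (sum f S) \<gamma> = (\<Sum>x\<in>S. mcoeff (f x) \<gamma>)"
  by (induction S rule: infinite_finite_induct) auto

lemma mcoeff_const: "mcoeff (mfps_const c) \<gamma> = (if \<gamma> = 0 then c else 0)"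
  by (simp add: mfps_const_def)

lemma mcoeff_const_mult [simp]:
  fixes f :: "'a::finite mfps"
  shows "mcoeff (mfps_const c * f) \<gamma> = c * mcoeff f \<gamma>"
proof -
  have "(\<Sum>(\<alpha>, \<beta>) | \<alpha> + \<beta> = \<gamma>. mcoeff (mfps_const c) \<alpha> * mcoeff f \<beta>) =
        (\<Sum>(\<alpha>, \<beta>) \<in> {(0 :: nat ^ 'a, \<gamma>)}. mcoeff (mfps_const c) \<alpha> * mcoeff f \<beta>)"
    by (rule sum.mono_neutral_right) (auto split: if_splits simp: mcoeff_const)
  then show ?thesis by (simp add: mcoeff_mult mcoeff_const)
qed

lemma mfps_const_0 [simp]: "mfps_const 0 = 0"
  by (rule mfps_eqI) (simp add: mcoeff_const)

lemma mfps_const_1 [simp]: "mfps_const 1 = 1"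
  by (rule mfps_eqI) (simp add: mcoeff_const mcoeff_one)

lemma mfps_const_add: "mfps_const (a + b) = mfps_const a + mfps_const b"
  by (rule mfps_eqI) (simp add: mcoeff_const)

lemma mfps_const_mult: "mfps_const (a * b) = mfps_const a * mfps_const b"
  by (rule mfps_eqI) (simp, simp add: mcoeff_const)

lemma mdeg_0 [simp]: "mdeg 0 = 0"
  by (simp add: mdeg_def)

lemma mdeg_add [simp]: "mdeg (\<alpha> + \<beta>) = mdeg \<alpha> + mdeg \<beta>"
  by (simp add: mdeg_def sum.distrib)

lemma mdeg_axis [simp]: "mdeg (axis j k) = k"
  by (simp add: mdeg_def axis_def)

lemma mdeg_eq_0_iff [simp]: "mdeg \<alpha> = 0 \<longleftrightarrow> \<alpha> = 0"
  by (auto simp: mdeg_def vec_eq_iff)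

lemma nth_le_mdeg: "\<alpha> $ i \<le> mdeg \<alpha>"
  unfolding mdeg_def by (rule member_le_sum) auto

lemma finite_mdeg_le [simp]: "finite {\<alpha> :: nat ^ 'n::finite. mdeg \<alpha> \<le> k}"
proof (rule finite_subset)
  show "{\<alpha> :: nat ^ 'n. mdeg \<alpha> \<le> k} \<subseteq> {\<alpha>. \<forall>i. \<alpha> $ i \<le> k}"
    using nth_le_mdeg order_trans by blast
qed (rule finite_vec_le)

lemma finite_mdeg_less [simp]: "finite {\<alpha> :: nat ^ 'n::finite. mdeg \<alpha> < k}"
  by (rule finite_subset[OF _ finite_mdeg_le[of k]]) auto

lemma finite_mdeg_eq [simp]: "finite {\<alpha> :: nat ^ 'n::finite. mdeg \<alpha> = k}"
  by (rule finite_subset[OF _ finite_mdeg_le[of k]]) auto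

lemma mdeg_axis_split:
  assumes "\<alpha> \<noteq> (0 :: nat ^ 'n::finite)"
  obtains i \<beta> where "\<alpha> = \<beta> + axis i 1"
proof -
  obtain i where i: "\<alpha> $ i \<noteq> 0" using assms by (auto simp: vec_eq_iff)
  have "\<alpha> = (\<chi> j. if j = i then \<alpha> $ i - 1 else \<alpha> $ j) + axis i 1"
    using i by (auto simp: vec_eq_iff axis_def)
  then show ?thesis by (rule that)
qed

lemma mdeg_eq_1_iff: "mdeg \<alpha> = 1 \<longleftrightarrow> (\<exists>j. \<alpha> = axis j 1)"
proof
  assume *: "mdeg \<alpha> = 1"
  then have "\<alpha> \<noteq> 0" by auto
  then obtain i \<beta> where "\<alpha> = \<beta> + axis i 1" by (rule mdeg_axis_split)
  with * show "\<exists>j. \<alpha> = axis j 1" by auto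
qed auto

section \<open>Powers of the maximal ideal, described by order\<close>

definition mfps_ge :: "nat \<Rightarrow> 'n::finite mfps set"
  where "mfps_ge k = {f. \<forall>\<gamma>. mdeg \<gamma> < k \<longrightarrow> mcoeff f \<gamma> = 0}"

lemma mfps_geD: "f \<in> mfps_ge k \<Longrightarrow> mdeg \<gamma> < k \<Longrightarrow> mcoeff f \<gamma> = 0"
  by (simp add: mfps_ge_def)

lemma mfps_ge_0 [simp]: "mfps_ge 0 = UNIV"
  by (simp add: mfps_ge_def)

lemma mfps_max_eq: "mfps_max = mfps_ge 1"
  by (auto simp: mfps_max_def mfps_ge_def)

lemma mfps_ge_antimono: "k \<le> l \<Longrightarrow> f \<in> mfps_ge l \<Longrightarrow> f \<in> mfps_ge k"
  by (auto simp: mfps_ge_def)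

lemma zero_in_mfps_ge [simp]: "0 \<in> mfps_ge k"
  by (simp add: mfps_ge_def)

lemma mfps_ge_add: "f \<in> mfps_ge k \<Longrightarrow> g \<in> mfps_ge k \<Longrightarrow> f + g \<in> mfps_ge k"
  by (simp add: mfps_ge_def)

lemma mfps_ge_diff: "f \<in> mfps_ge k \<Longrightarrow> g \<in> mfps_ge k \<Longrightarrow> f - g \<in> mfps_ge k"
  by (simp add: mfps_ge_def)

lemma mfps_ge_sum: "(\<And>x. x \<in> S \<Longrightarrow> f x \<in> mfps_ge k) \<Longrightarrow> sum f S \<in> mfps_ge k"
  by (auto simp: mfps_ge_def intro!: sum.neutral)

lemma mfps_ge_mult:
  assumes "f \<in> mfps_ge k" "g \<in> mfps_ge l"
  shows "f * g \<in> mfps_ge (k + l)"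
  unfolding mfps_ge_def
proof (safe)
  fix \<gamma> :: "nat ^ 'a" assume \<gamma>: "mdeg \<gamma> < k + l"
  have "mcoeff f \<alpha> * mcoeff g \<beta> = 0" if "\<alpha> + \<beta> = \<gamma>" for \<alpha> \<beta>
  proof -
    have "mdeg \<alpha> + mdeg \<beta> < k + l" using \<gamma> that[symmetric] by simp
    then have "mdeg \<alpha> < k \<or> mdeg \<beta> < l" by auto
    then show ?thesis using assms by (auto simp: mfps_ge_def)
  qed
  then show "mcoeff (f * g) \<gamma> = 0"
    unfolding mcoeff_mult by (intro sum.neutral) auto
qed

lemma mfps_ge_mult_left: "g \<in> mfps_ge k \<Longrightarrow> f * g \<in> mfps_ge k"
  using mfps_ge_mult[of f 0 g k] by simp

lemma mfps_ge_mult_right: "f \<in> mfps_ge k \<Longrightarrow> f * g \<in> mfps_ge k"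
  using mfps_ge_mult[of f k g 0] by simp

lemma mfps_ge_power: "f \<in> mfps_ge k \<Longrightarrow> f ^ m \<in> mfps_ge (m * k)"
  by (induction m) (use mfps_ge_mult in auto)

lemma mfps_ge_prod:
  "finite S \<Longrightarrow> (\<And>x. x \<in> S \<Longrightarrow> f x \<in> mfps_ge (k x)) \<Longrightarrow> prod f S \<in> mfps_ge (sum k S)"
  by (induction S rule: finite_induct) (auto intro!: mfps_ge_mult)

lemma mfps_eq_mod_ge: "f - g \<in> mfps_ge k \<Longrightarrow> mdeg \<gamma> < k \<Longrightarrow> mcoeff f \<gamma> = mcoeff g \<gamma>"
  by (auto simp: mfps_ge_def)

text \<open>The filtration is separated. Identities between infinite series are checked modulo each
  of its members, where finite sums suffice.\<close>

lemma mfps_eqI_ge: "(\<And>k. f - g \<in> mfps_ge k) \<Longrightarrow> f = g"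
  by (rule mfps_eqI) (metis lessI mfps_eq_mod_ge)

lemma mfps_cong_mult:
  assumes "f - f' \<in> mfps_ge k" "g - g' \<in> mfps_ge k"
  shows "f * g - f' * g' \<in> mfps_ge k"
proof -
  have "f * g - f' * g' = (f - f') * g + f' * (g - g')" by (simp add: algebra_simps)
  then show ?thesis using assms by (simp add: mfps_ge_add mfps_ge_mult_left mfps_ge_mult_right)
qed

lemma mfps_cong_power: "f - f' \<in> mfps_ge k \<Longrightarrow> f ^ m - f' ^ m \<in> mfps_ge k"
  by (induction m) (auto intro: mfps_cong_mult)

lemma mfps_cong_prod:
  "(\<And>x. x \<in> S \<Longrightarrow> f x - f' x \<in> mfps_ge k) \<Longrightarrow> prod f S - prod f' S \<in> mfps_ge k"
  by (induction S rule: infinite_finite_induct) (auto intro: mfps_cong_mult)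


section \<open>Pullbacks\<close>

definition mpow :: "'n::finite mfps ^ 'n \<Rightarrow> nat ^ 'n \<Rightarrow> 'n mfps"
  where "mpow F \<alpha> = (\<Prod>i\<in>UNIV. (F $ i) ^ (\<alpha> $ i))"

lemma mpow_0 [simp]: "mpow F 0 = 1"
  by (simp add: mpow_def)

lemma mpow_add: "mpow F (\<alpha> + \<beta>) = mpow F \<alpha> * mpow F \<beta>"
  by (simp add: mpow_def power_add prod.distrib)

lemma mpow_axis [simp]: "mpow F (axis i (Suc 0)) = F $ i"
proof -
  have "mpow F (axis i (Suc 0)) = (\<Prod>j\<in>UNIV. if i = j then F $ i else 1)"
    unfolding mpow_def by (rule prod.cong) (auto simp: axis_def)
  then show ?thesis by simp
qed

lemma mpow_in_ge:
  assumes "F \<in> max_tuples" shows "mpow F \<alpha> \<in> mfps_ge (mdeg \<alpha>)"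
  unfolding mpow_def mdeg_def
  by (rule mfps_ge_prod) (use assms mfps_ge_power[of _ 1] in \<open>auto simp: max_tuples_def mfps_max_eq\<close>)

lemma mcoeff_pullback:
  "mcoeff (pullback F f) \<gamma> = (\<Sum>\<alpha> | mdeg \<alpha> \<le> mdeg \<gamma>. mcoeff f \<alpha> * mcoeff (mpow F \<alpha>) \<gamma>)"
  by (simp add: pullback_def mpow_def)

definition mvars :: "'n::finite mfps ^ 'n"
  where "mvars = (\<chi> j. mfps_var j)"

lemma mvars_nth [simp]: "mvars $ j = mfps_var j"
  by (simp add: mvars_def)

lemma mvars_in_max_tuples [simp]: "mvars \<in> max_tuples"
  by (auto simp: max_tuples_def mfps_max_def mfps_var_def axis_def vec_eq_iff)

lemma mcoeff_var: "mcoeff (mfps_var j) \<gamma> = (if \<gamma> = axis j 1 then 1 else 0)"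
  by (simp add: mfps_var_def)

lemma mcoeff_mult_var: "mcoeff (f * mfps_var j) (\<gamma> + axis j 1) = mcoeff f \<gamma>"
proof -
  have "(\<Sum>(\<alpha>, \<beta>) | \<alpha> + \<beta> = \<gamma> + axis j 1. mcoeff f \<alpha> * mcoeff (mfps_var j) \<beta>) =
        (\<Sum>(\<alpha>, \<beta>) \<in> {(\<gamma>, axis j 1)}. mcoeff f \<alpha> * mcoeff (mfps_var j) \<beta>)"
    by (rule sum.mono_neutral_right) (auto split: if_splits simp: mcoeff_var)
  then show ?thesis by (simp add: mcoeff_mult mcoeff_var)
qed

lemma mcoeff_mult_var_0: "\<gamma> $ j = 0 \<Longrightarrow> mcoeff (f * mfps_var j) \<gamma> = 0"
  unfolding mcoeff_mult by (rule sum.neutral) (auto simp: mcoeff_var)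

lemma mcoeff_mpow_mvars: "mcoeff (mpow mvars \<alpha>) \<gamma> = (if \<gamma> = \<alpha> then 1 else 0)"
proof (induction "mdeg \<alpha>" arbitrary: \<alpha> \<gamma>)
  case 0
  then show ?case by (simp add: mcoeff_one)
next
  case (Suc n)
  then have "\<alpha> \<noteq> 0" by auto
  then obtain i \<beta> where \<alpha>: "\<alpha> = \<beta> + axis i 1" by (rule mdeg_axis_split)
  have eq: "mpow mvars \<alpha> = mpow mvars \<beta> * mfps_var i" by (simp add: \<alpha> mpow_add)
  show ?case
  proof (cases "\<gamma> $ i = 0")
    case True
    then have "\<gamma> \<noteq> \<alpha>" by (auto simp: \<alpha>)
    with True show ?thesis by (simp add: eq mcoeff_mult_var_0)
  next
    case False
    then have "\<gamma> = (\<chi> j. if j = i then \<gamma> $ i - 1 else \<gamma> $ j) + axis i 1"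
      by (auto simp: vec_eq_iff axis_def)
    then obtain \<delta> where \<gamma>: "\<gamma> = \<delta> + axis i 1" by blast
    have "mcoeff (mpow mvars \<alpha>) \<gamma> = mcoeff (mpow mvars \<beta>) \<delta>"
      unfolding eq \<gamma> by (rule mcoeff_mult_var)
    also have "\<dots> = (if \<delta> = \<beta> then 1 else 0)" using Suc \<alpha> by auto
    finally show ?thesis by (simp add: \<gamma> \<alpha>)
  qed
qed

lemma taylor_mod_ge:
  "f - (\<Sum>\<alpha> | mdeg \<alpha> < k. mfps_const (mcoeff f \<alpha>) * mpow mvars \<alpha>) \<in> mfps_ge k"
  by (auto simp: mfps_ge_def mcoeff_mpow_mvars if_distrib cong: if_cong)

text \<open>The power product \<open>mpow F \<alpha>\<close> has order at least
  \<open>mdeg \<alpha>\<close>, so the dropped terms do not reach the coefficients below degree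
  \<open>k\<close>.\<close>

lemma pullback_mod_ge:
  assumes "F \<in> max_tuples"
  shows "pullback F f - (\<Sum>\<alpha> | mdeg \<alpha> < k. mfps_const (mcoeff f \<alpha>) * mpow F \<alpha>) \<in> mfps_ge k"
proof -
  have "(\<Sum>\<alpha> | mdeg \<alpha> \<le> mdeg \<gamma>. mcoeff f \<alpha> * mcoeff (mpow F \<alpha>) \<gamma>) =
        (\<Sum>\<alpha> | mdeg \<alpha> < k. mcoeff f \<alpha> * mcoeff (mpow F \<alpha>) \<gamma>)" if "mdeg \<gamma> < k" for \<gamma>
    using that mpow_in_ge[OF assms]
    by (intro sum.mono_neutral_left) (auto simp: mfps_ge_def not_le)
  then show ?thesis by (auto simp: mfps_ge_def mcoeff_pullback)
qed

text \<open>Condition \<open>hom_ge\<close> is continuity in the topology of the powers of the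
  maximal ideal: such a homomorphism is determined by its values on polynomials, hence on the
  variables.\<close>

locale mfps_hom =
  fixes \<Phi> :: "'n::finite mfps \<Rightarrow> 'n mfps"
  assumes hom_add: "\<Phi> (f + g) = \<Phi> f + \<Phi> g"
    and hom_mult: "\<Phi> (f * g) = \<Phi> f * \<Phi> g"
    and hom_const: "\<Phi> (mfps_const c) = mfps_const c"
    and hom_ge: "f \<in> mfps_ge k \<Longrightarrow> \<Phi> f \<in> mfps_ge k"
begin

lemma hom_0: "\<Phi> 0 = 0"
  using hom_const[of 0] by simp

lemma hom_1: "\<Phi> 1 = 1"
  using hom_const[of 1] by simp

lemma hom_diff: "\<Phi> (f - g) = \<Phi> f - \<Phi> g"
  by (metis hom_add diff_add_cancel add_diff_cancel)

lemma hom_sum: "\<Phi> (sum f S) = (\<Sum>x\<in>S. \<Phi> (f x))"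
  by (induction S rule: infinite_finite_induct) (auto simp: hom_add hom_0)

lemma hom_prod: "\<Phi> (prod f S) = (\<Prod>x\<in>S. \<Phi> (f x))"
  by (induction S rule: infinite_finite_induct) (auto simp: hom_mult hom_1)

lemma hom_power: "\<Phi> (f ^ m) = \<Phi> f ^ m"
  by (induction m) (auto simp: hom_mult hom_1)

lemma hom_mpow: "\<Phi> (mpow F \<alpha>) = mpow (\<chi> j. \<Phi> (F $ j)) \<alpha>"
  by (simp add: mpow_def hom_prod hom_power)

lemma hom_max_tuples: "F \<in> max_tuples \<Longrightarrow> (\<chi> j. \<Phi> (F $ j)) \<in> max_tuples"
  by (simp add: max_tuples_def mfps_max_eq hom_ge)

text \<open>Both sides take the same value on a Taylor polynomial, and continuity controls the
  remainder. Composites of pullbacks and exponentials of derivations are recognised as pullbacks in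
  this way, without coefficient computations.\<close>

lemma hom_eq_pullback: "\<Phi> f = pullback (\<chi> j. \<Phi> (mfps_var j)) f"
proof (rule mfps_eqI_ge)
  fix k
  let ?F = "\<chi> j. \<Phi> (mfps_var j)"
  let ?T = "\<Sum>\<alpha> | mdeg \<alpha> < k. mfps_const (mcoeff f \<alpha>) * mpow mvars \<alpha>"
  let ?S = "\<Sum>\<alpha> | mdeg \<alpha> < k. mfps_const (mcoeff f \<alpha>) * mpow ?F \<alpha>"
  have "?F \<in> max_tuples"
    using hom_max_tuples[OF mvars_in_max_tuples] by simp
  then have "pullback ?F f - ?S \<in> mfps_ge k"
    by (rule pullback_mod_ge)
  moreover have "\<Phi> (f - ?T) \<in> mfps_ge k"
    by (rule hom_ge[OF taylor_mod_ge])
  then have "\<Phi> f - ?S \<in> mfps_ge k"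
    by (simp add: hom_diff hom_sum hom_mult hom_const hom_mpow)
  ultimately have "(\<Phi> f - ?S) - (pullback ?F f - ?S) \<in> mfps_ge k"
    by (rule mfps_ge_diff[rotated])
  then show "\<Phi> f - pullback ?F f \<in> mfps_ge k" by simp
qed

end

lemma pullback_add: "pullback F (f + g) = pullback F f + pullback F g"
  by (rule mfps_eqI) (simp add: mcoeff_pullback distrib_right sum.distrib)

lemma pullback_ge:
  assumes "F \<in> max_tuples" "f \<in> mfps_ge k"
  shows "pullback F f \<in> mfps_ge k"
  unfolding mfps_ge_def
proof safe
  fix \<gamma> :: "nat ^ 'a" assume "mdeg \<gamma> < k"
  then show "mcoeff (pullback F f) \<gamma> = 0"
    unfolding mcoeff_pullback using mfps_geD[OF assms(2)]
    by (intro sum.neutral) auto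
qed

lemma pullback_const: "pullback F (mfps_const c) = mfps_const c"
proof (rule mfps_eqI)
  fix \<gamma>
  have "(\<Sum>\<alpha> | mdeg \<alpha> \<le> mdeg \<gamma>. mcoeff (mfps_const c) \<alpha> * mcoeff (mpow F \<alpha>) \<gamma>) =
        (\<Sum>\<alpha>\<in>{0}. mcoeff (mfps_const c) \<alpha> * mcoeff (mpow F \<alpha>) \<gamma>)"
    by (rule sum.mono_neutral_right) (auto simp: mcoeff_const)
  then show "mcoeff (pullback F (mfps_const c)) \<gamma> = mcoeff (mfps_const c) \<gamma>"
    by (simp add: mcoeff_pullback mcoeff_const mcoeff_one)
qed

lemma pullback_var: 
  assumes "F \<in> max_tuples"
  shows "pullback F (mfps_var j) = F $ j"
proof (rule mfps_eqI_ge)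
  fix k
  \<comment> \<open>The truncation at \<open>k + 2\<close> keeps the index \<open>axis j 1\<close>,
    of degree 1, in the sum even for \<open>k = 0\<close>.\<close>
  have "pullback F (mfps_var j) -
      (\<Sum>\<alpha> | mdeg \<alpha> < k + 2. mfps_const (mcoeff (mfps_var j) \<alpha>) * mpow F \<alpha>) \<in> mfps_ge (k + 2)"
    by (rule pullback_mod_ge[OF assms])
  moreover have "(\<Sum>\<alpha> | mdeg \<alpha> < k + 2. mfps_const (mcoeff (mfps_var j) \<alpha>) * mpow F \<alpha>) =
      (\<Sum>\<alpha>\<in>{axis j 1}. mfps_const (mcoeff (mfps_var j) \<alpha>) * mpow F \<alpha>)"
    by (rule sum.mono_neutral_right) (auto simp: mcoeff_var)
  ultimately show "pullback F (mfps_var j) - F $ j \<in> mfps_ge k"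
    by (auto simp: mcoeff_var intro: mfps_ge_antimono[of k "k + 2"])
qed

text \<open>In the product of two truncations, the pairs of indices whose sum has degree below
  \<open>k\<close> make up the truncation for \<open>f * g\<close>; all other pairs have order at
  least \<open>k\<close>.\<close>

lemma pullback_mult:
  assumes "F \<in> max_tuples"
  shows "pullback F (f * g) = pullback F f * pullback F g"
proof (rule mfps_eqI_ge)
  fix k
  let ?N = "{\<alpha> :: nat ^ 'a. mdeg \<alpha> < k}"
  let ?c = mfps_const
  define P where "P h = (\<Sum>\<alpha>\<in>?N. ?c (mcoeff h \<alpha>) * mpow F \<alpha>)" for h
  define t where "t p = ?c (mcoeff f (fst p) * mcoeff g (snd p)) * mpow F (fst p + snd p)" for p
  let ?S = "{p \<in> ?N \<times> ?N. fst p + snd p \<in> ?N}"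
  have "P f * P g = sum t (?N \<times> ?N)"
    by (simp add: P_def sum_product sum.cartesian_product t_def mfps_const_mult mpow_add
        case_prod_unfold mult.assoc mult.left_commute)
  also have "\<dots> = sum t ?S + sum t (?N \<times> ?N - ?S)"
    by (subst sum.subset_diff[of ?S]) (auto simp: add.commute)
  also have "sum t ?S = P (f * g)"
  proof -
    have "P (f * g) = (\<Sum>\<gamma>\<in>?N. \<Sum>p | fst p + snd p = \<gamma>. t p)"
    proof -
      have c_sum: "?c (sum q A) = (\<Sum>x\<in>A. ?c (q x))" for q and A :: "((nat^'a) \<times> (nat^'a)) set"
        by (induction A rule: infinite_finite_induct) (auto simp: mfps_const_add)
      show ?thesis
        unfolding P_def t_def mcoeff_mult case_prod_unfold c_sum sum_distrib_right
        by (intro sum.cong) auto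
    qed
    also have "\<dots> = sum t (\<Union>\<gamma>\<in>?N. {p. fst p + snd p = \<gamma>})"
      by (rule sum.UNION_disjoint[symmetric]) (auto simp: finite_msplit[unfolded case_prod_unfold])
    also have "(\<Union>\<gamma>\<in>?N. {p. fst p + snd p = \<gamma>}) = ?S" by auto
    finally show ?thesis by simp
  qed
  finally have eq: "P f * P g - P (f * g) = sum t (?N \<times> ?N - ?S)" by simp
  have "sum t (?N \<times> ?N - ?S) \<in> mfps_ge k"
  proof (rule mfps_ge_sum)
    fix p assume "p \<in> ?N \<times> ?N - ?S"
    then have "k \<le> mdeg (fst p + snd p)" by auto
    then show "t p \<in> mfps_ge k"
      unfolding t_def by (intro mfps_ge_mult_left mfps_ge_antimono[OF _ mpow_in_ge[OF assms]])
  qed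
  then have 1: "P f * P g - P (f * g) \<in> mfps_ge k" by (simp add: eq)
  have P: "pullback F h - P h \<in> mfps_ge k" for h
    unfolding P_def by (rule pullback_mod_ge[OF assms])
  have "pullback F (f * g) - pullback F f * pullback F g =
    (pullback F (f * g) - P (f * g)) - (P f * P g - P (f * g)) - (pullback F f * pullback F g - P f * P g)"
    by simp
  also have "\<dots> \<in> mfps_ge k"
    by (intro mfps_ge_diff 1 P mfps_cong_mult)
  finally show "pullback F (f * g) - pullback F f * pullback F g \<in> mfps_ge k" .
qed

lemma mfps_hom_pullback: "F \<in> max_tuples \<Longrightarrow> mfps_hom (pullback F)"
  by unfold_locales (simp_all add: pullback_add pullback_mult pullback_const pullback_ge)

lemma pullback_mvars: "pullback mvars f = f"
proof -
  interpret mfps_hom "\<lambda>f. f" by unfold_locales auto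
  show ?thesis using hom_eq_pullback[of f] by (simp add: mvars_def)
qed

section \<open>Composition of formal self-maps\<close>

definition mcomp :: "'n::finite mfps ^ 'n \<Rightarrow> 'n mfps ^ 'n \<Rightarrow> 'n mfps ^ 'n"
  where "mcomp F G = (\<chi> j. pullback G (F $ j))"

lemma mcomp_nth [simp]: "mcomp F G $ j = pullback G (F $ j)"
  by (simp add: mcomp_def)

lemma mcomp_max_tuples: "F \<in> max_tuples \<Longrightarrow> G \<in> max_tuples \<Longrightarrow> mcomp F G \<in> max_tuples"
  unfolding mcomp_def by (rule mfps_hom.hom_max_tuples[OF mfps_hom_pullback])

text \<open>The composite of the two pullbacks is again a continuous homomorphism, and it sends the
  variables to the components of \<open>mcomp F G\<close>.\<close>

lemma pullback_mcomp:
  assumes "F \<in> max_tuples" "G \<in> max_tuples"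
  shows "pullback (mcomp F G) f = pullback G (pullback F f)"
proof -
  interpret F: mfps_hom "pullback F" by (rule mfps_hom_pullback) fact
  interpret G: mfps_hom "pullback G" by (rule mfps_hom_pullback) fact
  interpret mfps_hom "\<lambda>f. pullback G (pullback F f)"
    by unfold_locales (simp_all add: F.hom_add G.hom_add F.hom_mult G.hom_mult F.hom_const
        G.hom_const F.hom_ge G.hom_ge)
  show ?thesis
    using hom_eq_pullback[of f] by (simp add: mcomp_def pullback_var assms)
qed

lemma mcomp_assoc:
  "G \<in> max_tuples \<Longrightarrow> H \<in> max_tuples \<Longrightarrow> mcomp (mcomp F G) H = mcomp F (mcomp G H)"
  by (simp add: vec_eq_iff pullback_mcomp)

lemma mcomp_mvars_left: "G \<in> max_tuples \<Longrightarrow> mcomp mvars G = G"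
  by (simp add: vec_eq_iff pullback_var)

lemma mcomp_mvars_right: "mcomp F mvars = F"
  by (simp add: vec_eq_iff pullback_mvars)

lemma linear_part_mcomp:
  assumes "F \<in> max_tuples" "G \<in> max_tuples"
  shows "linear_part (mcomp F G) = linear_part F ** linear_part G"
proof -
  have "mcoeff (pullback G (F $ i)) (axis j 1) =
     (\<Sum>k\<in>UNIV. mcoeff (F $ i) (axis k 1) * mcoeff (G $ k) (axis j 1))" for i j
  proof -
    have "mcoeff (pullback G (F $ i)) (axis j 1) =
      (\<Sum>\<alpha> | mdeg \<alpha> \<le> 1. mcoeff (F $ i) \<alpha> * mcoeff (mpow G \<alpha>) (axis j 1))"
      by (simp add: mcoeff_pullback)
    also have "\<dots> = (\<Sum>\<alpha>\<in>range (\<lambda>k. axis k 1). mcoeff (F $ i) \<alpha> * mcoeff (mpow G \<alpha>) (axis j 1))"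
    proof (rule sum.mono_neutral_right)
      show "\<forall>\<alpha>\<in>{\<alpha>. mdeg \<alpha> \<le> 1} - range (\<lambda>k. axis k 1).
        mcoeff (F $ i) \<alpha> * mcoeff (mpow G \<alpha>) (axis j 1) = 0"
      proof
        fix \<alpha> :: "nat ^ 'a" assume "\<alpha> \<in> {\<alpha>. mdeg \<alpha> \<le> 1} - range (\<lambda>k. axis k 1)"
        then have "mdeg \<alpha> \<le> 1" "mdeg \<alpha> \<noteq> 1" using mdeg_eq_1_iff[of \<alpha>] by auto
        then have "mdeg \<alpha> = 0" by linarith
        then have "\<alpha> = 0" by simp
        then show "mcoeff (F $ i) \<alpha> * mcoeff (mpow G \<alpha>) (axis j 1) = 0"
          using assms by (auto simp: max_tuples_def mfps_max_def)
      qed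
    qed auto
    also have "\<dots> = (\<Sum>k\<in>UNIV. mcoeff (F $ i) (axis k 1) * mcoeff (G $ k) (axis j 1))"
      by (subst sum.reindex) (auto simp: inj_on_def axis_eq_axis)
    finally show ?thesis .
  qed
  then show ?thesis by (simp add: linear_part_def matrix_matrix_mult_def vec_eq_iff)
qed

lemma linear_part_mvars: "linear_part mvars = mat 1"
  by (simp add: linear_part_def mcoeff_var mat_def vec_eq_iff[of "\<chi> i j. _ i j"] axis_eq_axis) auto

lemma formal_Diff_simps:
  "carrier formal_Diff = {F \<in> max_tuples. det (linear_part F) \<noteq> 0}"
  "F \<otimes>\<^bsub>formal_Diff\<^esub> G = mcomp F G"
  "\<one>\<^bsub>formal_Diff\<^esub> = mvars"
  by (simp_all add: formal_Diff_def mcomp_def mvars_def)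

lemma monoid_formal_Diff: "monoid (formal_Diff :: ('n::finite mfps ^ 'n) monoid)"
  by unfold_locales
    (auto simp: formal_Diff_simps mcomp_max_tuples linear_part_mcomp det_mul mcomp_assoc
      mcomp_mvars_left mcomp_mvars_right linear_part_mvars)


section \<open>Formal flows\<close>

lemma mcoeff_pderiv: "mcoeff (mfps_pderiv j f) \<gamma> = of_nat (\<gamma> $ j + 1) * mcoeff f (\<gamma> + axis j 1)"
  by (simp add: mfps_pderiv_def)

text \<open>Summing over splittings of \<gamma> + e_j reduces the Leibniz rule to
  \<open>\<alpha> $ j + \<beta> $ j = \<gamma> $ j + 1\<close>. The splittings with
  \<open>\<alpha> $ j = 0\<close>, which do not come from the product on the left, have weight
  zero.\<close>

lemma mcoeff_pderiv_mult:
  fixes f g :: "'n::finite mfps"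
  shows "mcoeff (mfps_pderiv j f * g) \<gamma> =
    (\<Sum>(\<alpha>, \<beta>) | \<alpha> + \<beta> = \<gamma> + axis j 1. of_nat (\<alpha> $ j) * mcoeff f \<alpha> * mcoeff g \<beta>)"
proof -
  let ?e = "axis j 1 :: nat ^ 'n"
  let ?s = "\<lambda>p :: (nat ^ 'n) \<times> (nat ^ 'n). (fst p + ?e, snd p)"
  let ?h = "\<lambda>(\<alpha>, \<beta>). of_nat (\<alpha> $ j) * mcoeff f \<alpha> * mcoeff g \<beta>"
  have "(\<Sum>p | fst p + snd p = \<gamma>. ?h (?s p)) = sum ?h (?s ` {p. fst p + snd p = \<gamma>})"
    by (subst sum.reindex) (auto simp: inj_on_def prod_eq_iff)
  also have "\<dots> = sum ?h {p. fst p + snd p = \<gamma> + ?e}"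
  proof (rule sum.mono_neutral_left)
    show "finite {p. fst p + snd p = \<gamma> + ?e}"
      using finite_msplit[of "\<gamma> + ?e"] by (simp only: case_prod_unfold)
    show "?s ` {p. fst p + snd p = \<gamma>} \<subseteq> {p. fst p + snd p = \<gamma> + ?e}"
      by (auto simp: algebra_simps)
    show "\<forall>p\<in>{p. fst p + snd p = \<gamma> + ?e} - ?s ` {p. fst p + snd p = \<gamma>}. ?h p = 0"
    proof
      fix p assume p: "p \<in> {p. fst p + snd p = \<gamma> + ?e} - ?s ` {p. fst p + snd p = \<gamma>}"
      obtain \<alpha> \<beta> where [simp]: "p = (\<alpha>, \<beta>)" by fastforce
      have "\<alpha> $ j = 0"
      proof (rule ccontr)
        assume nz: "\<alpha> $ j \<noteq> 0"
        define \<delta> where "\<delta> = (\<chi> i. if i = j then \<alpha> $ j - 1 else \<alpha> $ i)"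
        have \<alpha>: "\<alpha> = \<delta> + ?e" using nz by (auto simp: \<delta>_def vec_eq_iff axis_def)
        with p have "(\<delta> + \<beta>) + ?e = \<gamma> + ?e" by (simp add: algebra_simps)
        then have "\<delta> + \<beta> = \<gamma>" by (simp only: add_right_cancel)
        then have "p \<in> ?s ` {p. fst p + snd p = \<gamma>}"
          by (intro image_eqI[of _ _ "(\<delta>, \<beta>)"]) (auto simp: \<alpha>)
        with p show False by blast
      qed
      then show "?h p = 0" by simp
    qed
  qed
  finally show ?thesis
    by (simp add: mcoeff_mult mcoeff_pderiv case_prod_unfold)
qed

lemma mfps_pderiv_mult: "mfps_pderiv j (f * g) = mfps_pderiv j f * g + f * mfps_pderiv j g"
proof (rule mfps_eqI)
  fix \<gamma>
  let ?e = "axis j 1"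
  have "mcoeff (mfps_pderiv j (f * g)) \<gamma> =
      (\<Sum>(\<alpha>, \<beta>) | \<alpha> + \<beta> = \<gamma> + ?e. of_nat ((\<gamma> + ?e) $ j) * (mcoeff f \<alpha> * mcoeff g \<beta>))"
    by (simp add: mcoeff_pderiv mcoeff_mult sum_distrib_left case_prod_unfold axis_def)
  also have "\<dots> = (\<Sum>(\<alpha>, \<beta>) | \<alpha> + \<beta> = \<gamma> + ?e. of_nat (\<alpha> $ j) * mcoeff f \<alpha> * mcoeff g \<beta>
      + of_nat (\<beta> $ j) * mcoeff g \<beta> * mcoeff f \<alpha>)"
  proof (rule sum.cong, simp, safe)
    fix \<alpha> \<beta> assume "\<alpha> + \<beta> = \<gamma> + ?e"
    then have "(\<gamma> + ?e) $ j = \<alpha> $ j + \<beta> $ j" by (metis vector_add_component)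
    then show "of_nat ((\<gamma> + ?e) $ j) * (mcoeff f \<alpha> * mcoeff g \<beta>) = of_nat (\<alpha> $ j) * mcoeff f \<alpha> * mcoeff g \<beta>
      + of_nat (\<beta> $ j) * mcoeff g \<beta> * mcoeff f \<alpha>"
      by (simp only: of_nat_add) (simp add: algebra_simps)
  qed
  also have "\<dots> = (\<Sum>(\<alpha>, \<beta>) | \<alpha> + \<beta> = \<gamma> + ?e. of_nat (\<alpha> $ j) * mcoeff f \<alpha> * mcoeff g \<beta>)
      + (\<Sum>(\<alpha>, \<beta>) | \<alpha> + \<beta> = \<gamma> + ?e. of_nat (\<beta> $ j) * mcoeff g \<beta> * mcoeff f \<alpha>)"
    by (simp add: case_prod_unfold sum.distrib)
  also have "(\<Sum>(\<alpha>, \<beta>) | \<alpha> + \<beta> = \<gamma> + ?e. of_nat (\<beta> $ j) * mcoeff g \<beta> * mcoeff f \<alpha>) =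
      (\<Sum>(\<alpha>, \<beta>) | \<alpha> + \<beta> = \<gamma> + ?e. of_nat (\<alpha> $ j) * mcoeff g \<alpha> * mcoeff f \<beta>)"
    by (rule sum.reindex_bij_witness[of _ prod.swap prod.swap]) (auto simp: add.commute)
  finally show "mcoeff (mfps_pderiv j (f * g)) \<gamma> = mcoeff (mfps_pderiv j f * g + f * mfps_pderiv j g) \<gamma>"
    by (simp add: mcoeff_pderiv_mult mult.commute[of f])
qed

lemma mfps_pderiv_add: "mfps_pderiv j (f + g) = mfps_pderiv j f + mfps_pderiv j g"
  by (rule mfps_eqI) (simp add: mcoeff_pderiv algebra_simps)

lemma mfps_pderiv_const: "mfps_pderiv j (mfps_const c) = 0"
  by (rule mfps_eqI) (auto simp: mcoeff_pderiv mcoeff_const vec_eq_iff axis_def)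

lemma mfps_pderiv_var: "mfps_pderiv j (mfps_var i) = (if i = j then 1 else 0)"
proof (rule mfps_eqI)
  fix \<gamma>
  have "\<gamma> = 0 \<and> i = j" if "\<gamma> + axis j (Suc 0) = axis i (Suc 0)"
  proof -
    have "mdeg \<gamma> + 1 = 1" using arg_cong[OF that, of mdeg] by simp
    then show ?thesis using that by (auto simp: axis_eq_axis)
  qed
  then show "mcoeff (mfps_pderiv j (mfps_var i)) \<gamma> = mcoeff (if i = j then 1 else 0) \<gamma>"
    by (auto simp: mcoeff_pderiv mcoeff_var mcoeff_one axis_eq_axis)
qed

lemma mfps_pderiv_ge: "f \<in> mfps_ge k \<Longrightarrow> mfps_pderiv j f \<in> mfps_ge (k - 1)"
  by (auto simp: mfps_ge_def mcoeff_pderiv)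

locale mfps_linear =
  fixes \<Phi> :: "'n::finite mfps \<Rightarrow> 'n mfps"
  assumes lin_add: "\<Phi> (f + g) = \<Phi> f + \<Phi> g"
    and lin_scale: "\<Phi> (mfps_const c * f) = mfps_const c * \<Phi> f"
    and lin_ge: "f \<in> mfps_ge k \<Longrightarrow> \<Phi> f \<in> mfps_ge k"
begin

lemma lin_0: "\<Phi> 0 = 0"
  using lin_scale[of 0] by simp

lemma lin_diff: "\<Phi> (f - g) = \<Phi> f - \<Phi> g"
  by (metis lin_add diff_add_cancel add_diff_cancel)

lemma lin_sum: "\<Phi> (sum f S) = (\<Sum>x\<in>S. \<Phi> (f x))"
  by (induction S rule: infinite_finite_induct) (auto simp: lin_add lin_0)

text \<open>Below degree \<open>k\<close> the map acts by a finite matrix. All limits, sums and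
  derivatives in the flow parameter are interchanged with linear maps through this formula.\<close>

lemma mcoeff_lin:
  assumes "mdeg \<gamma> < k"
  shows "mcoeff (\<Phi> f) \<gamma> = (\<Sum>\<alpha> | mdeg \<alpha> < k. mcoeff f \<alpha> * mcoeff (\<Phi> (mpow mvars \<alpha>)) \<gamma>)"
  using mfps_geD[OF lin_ge[OF taylor_mod_ge[of f k]] assms]
  by (simp add: lin_diff lin_sum lin_scale)

end

lemma mfps_linear_comp: "mfps_linear \<Phi> \<Longrightarrow> mfps_linear \<Psi> \<Longrightarrow> mfps_linear (\<lambda>f. \<Phi> (\<Psi> f))"
  by (simp add: mfps_linear_def)

locale formal_vector_field =
  fixes v :: "'n::finite mfps ^ 'n"
  assumes v: "v \<in> max_tuples"
begin

abbreviation V :: "'n mfps \<Rightarrow> 'n mfps"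
  where "V \<equiv> vf_deriv v"

lemma V_mult: "V (f * g) = V f * g + f * V g"
  by (simp add: vf_deriv_def mfps_pderiv_mult sum.distrib distrib_right sum_distrib_left
      sum_distrib_right algebra_simps)

lemma V_const: "V (mfps_const c) = 0"
  by (simp add: vf_deriv_def mfps_pderiv_const)

lemma V_var: "V (mfps_var i) = v $ i"
  by (simp add: vf_deriv_def mfps_pderiv_var if_distrib[of "\<lambda>x. x * _"] cong: if_cong)

text \<open>Differentiation lowers the order by one, and the factor \<open>v $ j\<close>, having no
  free term, restores it.\<close>

lemma V_ge:
  assumes "f \<in> mfps_ge k" shows "V f \<in> mfps_ge k"
proof (cases k)
  case (Suc l)
  have "mfps_pderiv j f * v $ j \<in> mfps_ge (l + 1)" for j
    using mfps_pderiv_ge[OF assms, of j] v Suc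
    by (intro mfps_ge_mult) (auto simp: max_tuples_def mfps_max_eq)
  then show ?thesis unfolding vf_deriv_def Suc by (intro mfps_ge_sum) simp
qed simp

sublocale V: mfps_linear V
proof
  fix f g :: "'n mfps" and c k
  show "V (f + g) = V f + V g"
    by (simp add: vf_deriv_def mfps_pderiv_add distrib_right sum.distrib)
  show "V (mfps_const c * f) = mfps_const c * V f"
    by (simp add: V_mult V_const)
qed (rule V_ge)

lemma V_iter_linear: "mfps_linear (V ^^ m)"
proof (induction m)
  case (Suc m)
  then show ?case
    using mfps_linear_comp[OF V.mfps_linear_axioms Suc] by (simp add: comp_def)
qed (simp add: mfps_linear_def)

text \<open>Below degree \<open>N\<close> the derivation is a finite matrix. Here \<open>nm\<close>
  is the l1 norm, and \<open>B\<close>, the sum of the norms of the columns, bounds the operator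
  norm, so the exponential series is dominated by a numerical one.\<close>

lemma V_iter_growth:
  obtains B where "\<And>m f \<gamma>. mdeg \<gamma> < N \<Longrightarrow>
    norm (mcoeff ((V ^^ m) f) \<gamma>) \<le> B ^ m * (\<Sum>\<alpha> | mdeg \<alpha> < N. norm (mcoeff f \<alpha>))"
proof -
  let ?N = "{\<alpha> :: nat ^ 'n. mdeg \<alpha> < N}"
  define nm :: "'n mfps \<Rightarrow> real" where "nm f = (\<Sum>\<alpha>\<in>?N. norm (mcoeff f \<alpha>))" for f
  define B where "B = (\<Sum>\<alpha>\<in>?N. nm (V (mpow mvars \<alpha>)))"
  have nm0: "nm f \<ge> 0" for f by (simp add: nm_def sum_nonneg)
  have B0: "B \<ge> 0" by (simp add: B_def nm0 sum_nonneg)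
  have step: "nm (V f) \<le> B * nm f" for f
  proof -
    have "nm (V f) = (\<Sum>\<gamma>\<in>?N. norm (\<Sum>\<alpha>\<in>?N. mcoeff f \<alpha> * mcoeff (V (mpow mvars \<alpha>)) \<gamma>))"
      unfolding nm_def by (rule sum.cong) (auto simp: V.mcoeff_lin[of _ N])
    also have "\<dots> \<le> (\<Sum>\<gamma>\<in>?N. \<Sum>\<alpha>\<in>?N. norm (mcoeff f \<alpha>) * norm (mcoeff (V (mpow mvars \<alpha>)) \<gamma>))"
      by (intro sum_mono order_trans[OF norm_sum]) (simp add: norm_mult)
    also have "\<dots> = (\<Sum>\<alpha>\<in>?N. norm (mcoeff f \<alpha>) * nm (V (mpow mvars \<alpha>)))"
      by (subst sum.swap) (simp add: nm_def sum_distrib_left)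
    also have "\<dots> \<le> (\<Sum>\<alpha>\<in>?N. norm (mcoeff f \<alpha>) * B)"
    proof (intro sum_mono mult_left_mono)
      fix \<alpha> assume "\<alpha> \<in> ?N"
      then show "nm (V (mpow mvars \<alpha>)) \<le> B"
        unfolding B_def by (intro member_le_sum) (auto simp: nm0)
    qed simp
    also have "\<dots> = B * nm f" by (simp add: nm_def sum_distrib_left mult.commute)
    finally show ?thesis .
  qed
  have iter: "nm ((V ^^ m) f) \<le> B ^ m * nm f" for m f
  proof (induction m)
    case (Suc m)
    have "nm ((V ^^ Suc m) f) \<le> B * nm ((V ^^ m) f)" using step by simp
    also have "\<dots> \<le> B * (B ^ m * nm f)" using Suc B0 by (rule mult_left_mono)
    finally show ?case by (simp add: mult.assoc)
  qed simp
  show ?thesis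
  proof (rule that)
    fix m f and \<gamma> :: "nat ^ 'n" assume "mdeg \<gamma> < N"
    then have "norm (mcoeff ((V ^^ m) f) \<gamma>) \<le> nm ((V ^^ m) f)"
      unfolding nm_def by (intro member_le_sum) auto
    with iter[of m f] show "norm (mcoeff ((V ^^ m) f) \<gamma>) \<le> B ^ m * (\<Sum>\<alpha>\<in>?N. norm (mcoeff f \<alpha>))"
      by (simp add: nm_def)
  qed
qed

lemma summable_exp_coeff:
  fixes \<gamma> :: "nat ^ 'n"
  shows "summable (\<lambda>m. t ^ m / fact m * mcoeff ((V ^^ m) f) \<gamma>)"
proof -
  define N where "N = Suc (mdeg \<gamma>)"
  obtain B where B: "\<And>m f \<gamma>. mdeg \<gamma> < N \<Longrightarrow>
    norm (mcoeff ((V ^^ m) f) \<gamma>) \<le> B ^ m * (\<Sum>\<alpha> | mdeg \<alpha> < N. norm (mcoeff f \<alpha>))"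
    using V_iter_growth by blast
  let ?C = "\<Sum>\<alpha> | mdeg \<alpha> < N. norm (mcoeff f \<alpha>)"
  show ?thesis
  proof (rule summable_comparison_test')
    show "summable (\<lambda>m. inverse (fact m) * (norm t * B) ^ m * ?C)"
      by (intro summable_mult2 summable_exp)
    fix m
    have "norm (t ^ m / fact m * mcoeff ((V ^^ m) f) \<gamma>) \<le> norm t ^ m / fact m * (B ^ m * ?C)"
      unfolding norm_mult norm_divide norm_power norm_fact
      by (intro mult_left_mono B) (simp_all add: N_def)
    then show "norm (t ^ m / fact m * mcoeff ((V ^^ m) f) \<gamma>) \<le> inverse (fact m) * (norm t * B) ^ m * ?C"
      by (simp add: power_mult_distrib field_simps)
  qed
qed

section \<open>The exponential of the derivation and its flow\<close>

definition E :: "complex \<Rightarrow> 'n mfps \<Rightarrow> 'n mfps"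
  where "E t f = Abs_mfps (\<lambda>\<gamma>. \<Sum>m. t ^ m / fact m * mcoeff ((V ^^ m) f) \<gamma>)"

lemma E_sums: "(\<lambda>m. t ^ m / fact m * mcoeff ((V ^^ m) f) \<gamma>) sums mcoeff (E t f) \<gamma>"
  unfolding E_def mcoeff_Abs_mfps by (rule summable_sums[OF summable_exp_coeff])

lemma E_eqI:
  "(\<And>\<gamma>. (\<lambda>m. t ^ m / fact m * mcoeff ((V ^^ m) f) \<gamma>) sums mcoeff g \<gamma>) \<Longrightarrow> E t f = g"
  using E_sums sums_unique2 by (blast intro: mfps_eqI)

lemma E_0: "E 0 f = f"
proof (rule E_eqI)
  fix \<gamma> :: "nat ^ 'n"
  have "(\<lambda>m. 0 ^ m / fact m * mcoeff ((V ^^ m) f) \<gamma>) = (\<lambda>m. if m = 0 then mcoeff f \<gamma> else 0)"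
    by (auto simp: fun_eq_iff)
  then show "(\<lambda>m. 0 ^ m / fact m * mcoeff ((V ^^ m) f) \<gamma>) sums mcoeff f \<gamma>"
    using sums_single[of 0 "\<lambda>_. mcoeff f \<gamma>"] by simp
qed

sublocale E: mfps_linear "E t" for t
proof
  fix f g :: "'n mfps" and c k
  interpret I: mfps_linear "V ^^ m" for m by (rule V_iter_linear)
  show "E t (f + g) = E t f + E t g"
    by (rule E_eqI) (use sums_add[OF E_sums[of t f] E_sums[of t g]] in
        \<open>simp add: I.lin_add distrib_left\<close>)
  show "E t (mfps_const c * f) = mfps_const c * E t f"
    by (rule E_eqI) (use sums_mult[OF E_sums[of t f], of c] in
        \<open>simp add: I.lin_scale mult.left_commute\<close>)
  show "E t f \<in> mfps_ge k" if "f \<in> mfps_ge k"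
    unfolding mfps_ge_def E_def by (auto simp: I.lin_ge[OF that, THEN mfps_geD])
qed

lemma E_V_commute: "E t (V f) = V (E t f)"
proof (rule E_eqI)
  fix \<gamma> :: "nat ^ 'n"
  let ?N = "{\<alpha> :: nat ^ 'n. mdeg \<alpha> < Suc (mdeg \<gamma>)}"
  have lin: "mcoeff (V g) \<gamma> = (\<Sum>\<alpha>\<in>?N. mcoeff g \<alpha> * mcoeff (V (mpow mvars \<alpha>)) \<gamma>)" for g
    by (rule V.mcoeff_lin) simp
  have "(\<lambda>m. \<Sum>\<alpha>\<in>?N. t ^ m / fact m * mcoeff ((V ^^ m) f) \<alpha> * mcoeff (V (mpow mvars \<alpha>)) \<gamma>)
      sums (\<Sum>\<alpha>\<in>?N. mcoeff (E t f) \<alpha> * mcoeff (V (mpow mvars \<alpha>)) \<gamma>)"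
    by (intro sums_sum sums_mult2 E_sums)
  moreover have "(\<Sum>\<alpha>\<in>?N. t ^ m / fact m * mcoeff ((V ^^ m) f) \<alpha> * mcoeff (V (mpow mvars \<alpha>)) \<gamma>) =
      t ^ m / fact m * mcoeff ((V ^^ m) (V f)) \<gamma>" for m
  proof -
    have "(V ^^ m) (V f) = V ((V ^^ m) f)" by (simp add: funpow_swap1)
    then show ?thesis by (simp add: lin[of "(V ^^ m) f"] sum_distrib_left mult.assoc)
  qed
  ultimately show "(\<lambda>m. t ^ m / fact m * mcoeff ((V ^^ m) (V f)) \<gamma>) sums mcoeff (V (E t f)) \<gamma>"
    by (simp add: lin[of "E t f"])
qed

lemma E_has_derivative:
  "((\<lambda>t. mcoeff (E t f) \<gamma>) has_field_derivative mcoeff (E t (V f)) \<gamma>) (at t)"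
proof -
  define c where "c m = mcoeff ((V ^^ m) f) \<gamma> / fact m" for m
  have "(\<lambda>m. t ^ m / fact m * mcoeff ((V ^^ m) f) \<gamma>) = (\<lambda>m. c m * t ^ m)" for t
    by (simp add: c_def mult.commute)
  then have c: "summable (\<lambda>m. c m * t ^ m)" "mcoeff (E t f) \<gamma> = (\<Sum>m. c m * t ^ m)" for t
    using summable_exp_coeff[of t f \<gamma>] by (simp_all add: E_def)
  have "diffs c m * t ^ m = t ^ m / fact m * mcoeff ((V ^^ m) (V f)) \<gamma>" for m
  proof -
    have "(V ^^ Suc m) f = (V ^^ m) (V f)" by (simp add: funpow_swap1)
    moreover have "of_nat (Suc m) * (x / fact (Suc m)) = x / fact m" for x :: complex
      using of_nat_neq_0[of m, where ?'a = complex] by (simp add: fact_Suc del: of_nat_Suc)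
    ultimately show ?thesis
      unfolding diffs_def c_def by (simp del: funpow.simps fact_Suc of_nat_Suc)
  qed
  then have "mcoeff (E t (V f)) \<gamma> = (\<Sum>m. diffs c m * t ^ m)" by (simp add: E_def)
  then show ?thesis
    unfolding c(2) using termdiffs_strong_converges_everywhere[OF c(1)] by simp
qed

text \<open>Solutions of \<open>u' = V u\<close> are unique; the semigroup law and the multiplicativity of \<open>E\<close>
  are both instances.\<close>

lemma E_minus_solution:
  assumes "\<And>s \<gamma>. ((\<lambda>s. mcoeff (u s) \<gamma>) has_field_derivative mcoeff (V (u s)) \<gamma>) (at s)"
  shows "E (- s) (u s) = u 0"
proof (rule mfps_eqI)
  fix \<gamma> :: "nat ^ 'n"
  let ?N = "{\<alpha> :: nat ^ 'n. mdeg \<alpha> < Suc (mdeg \<gamma>)}"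
  interpret EV: mfps_linear "\<lambda>f. E t (V f)" for t
    by (rule mfps_linear_comp) unfold_locales
  have lin: "mcoeff (E t g) \<gamma> = (\<Sum>\<alpha>\<in>?N. mcoeff g \<alpha> * mcoeff (E t (mpow mvars \<alpha>)) \<gamma>)" for t g
    by (rule E.mcoeff_lin) simp
  have linV: "mcoeff (E t (V g)) \<gamma> = (\<Sum>\<alpha>\<in>?N. mcoeff g \<alpha> * mcoeff (E t (V (mpow mvars \<alpha>))) \<gamma>)" for t g
    by (rule EV.mcoeff_lin) simp
  have E': "((\<lambda>s. mcoeff (E (- s) f) \<gamma>) has_field_derivative - mcoeff (E (- s) (V f)) \<gamma>) (at s)" for s f
    using DERIV_chain2[of "\<lambda>t. mcoeff (E t f) \<gamma>" _ uminus s "- 1" UNIV, OF E_has_derivative DERIV_minus[OF DERIV_ident]]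
    by simp
  \<comment> \<open>The product rule, applied to the finite sum \<open>lin\<close>, gives two terms
    that both equal E(-s)(V(u s)) up to sign: one from the equation for \<open>u\<close>, one from
    the derivative of \<open>E\<close>.\<close>
  have "((\<lambda>s. mcoeff (E (- s) (u s)) \<gamma>) has_field_derivative 0) (at s)" for s
  proof -
    have "((\<lambda>s. \<Sum>\<alpha>\<in>?N. mcoeff (u s) \<alpha> * mcoeff (E (- s) (mpow mvars \<alpha>)) \<gamma>) has_field_derivative
      (\<Sum>\<alpha>\<in>?N. mcoeff (V (u s)) \<alpha> * mcoeff (E (- s) (mpow mvars \<alpha>)) \<gamma> +
        - mcoeff (E (- s) (V (mpow mvars \<alpha>))) \<gamma> * mcoeff (u s) \<alpha>)) (at s)"
      by (intro DERIV_sum DERIV_mult assms E')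
    also have "(\<Sum>\<alpha>\<in>?N. mcoeff (V (u s)) \<alpha> * mcoeff (E (- s) (mpow mvars \<alpha>)) \<gamma> +
        - mcoeff (E (- s) (V (mpow mvars \<alpha>))) \<gamma> * mcoeff (u s) \<alpha>) =
        mcoeff (E (- s) (V (u s))) \<gamma> - mcoeff (E (- s) (V (u s))) \<gamma>"
      by (subst lin, subst linV) (simp add: sum_subtractf mult.commute)
    finally show ?thesis by (simp flip: lin)
  qed
  then obtain c where "\<And>s. mcoeff (E (- s) (u s)) \<gamma> = c"
    using has_field_derivative_zero_constant[of UNIV "\<lambda>s. mcoeff (E (- s) (u s)) \<gamma>"] by auto
  then have "mcoeff (E (- s) (u s)) \<gamma> = mcoeff (E (- 0) (u 0)) \<gamma>" by metis
  then show "mcoeff (E (- s) (u s)) \<gamma> = mcoeff (u 0) \<gamma>" by (simp add: E_0)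
qed

lemma E_minus_E: "E (- s) (E s f) = f"
proof -
  have "E (- s) (E s f) = E 0 f"
    by (rule E_minus_solution) (unfold E_V_commute[symmetric], rule E_has_derivative)
  then show ?thesis by (simp add: E_0)
qed

lemma solution_eq_E:
  assumes "\<And>s \<gamma>. ((\<lambda>s. mcoeff (u s) \<gamma>) has_field_derivative mcoeff (V (u s)) \<gamma>) (at s)"
  shows "u s = E s (u 0)"
proof -
  have *: "E (- s) (u s) = u 0"
    by (rule E_minus_solution[of u]) (rule assms)
  have "E (- (- s)) (E (- s) (u s)) = u s"
    by (rule E_minus_E)
  then show ?thesis unfolding * by simp
qed

lemma E_add: "E (s + t) f = E s (E t f)"
proof -
  have "E (s + t) f = E s (E (0 + t) f)"
  proof (rule solution_eq_E[of "\<lambda>s. E (s + t) f"])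
    fix s and \<gamma> :: "nat ^ 'n"
    show "((\<lambda>s. mcoeff (E (s + t) f) \<gamma>) has_field_derivative mcoeff (V (E (s + t) f)) \<gamma>) (at s)"
      using DERIV_chain2[of "\<lambda>t. mcoeff (E t f) \<gamma>" _ "\<lambda>s. s + t" s "1 + 0" UNIV,
          OF E_has_derivative DERIV_add[OF DERIV_ident DERIV_const]]
      by (simp add: E_V_commute)
  qed
  then show ?thesis by simp
qed

lemma E_mult: "E s (f * g) = E s f * E s g"
proof -
  have "E s f * E s g = E s (E 0 f * E 0 g)"
  proof (rule solution_eq_E[of "\<lambda>s. E s f * E s g"])
    fix s and \<gamma> :: "nat ^ 'n"
    have "((\<lambda>s. \<Sum>p | fst p + snd p = \<gamma>. mcoeff (E s f) (fst p) * mcoeff (E s g) (snd p))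
      has_field_derivative (\<Sum>p | fst p + snd p = \<gamma>. mcoeff (E s f) (fst p) * mcoeff (V (E s g)) (snd p)
        + mcoeff (V (E s f)) (fst p) * mcoeff (E s g) (snd p))) (at s)"
      unfolding E_V_commute[symmetric] by (intro DERIV_sum DERIV_mult' E_has_derivative)
    then show "((\<lambda>s. mcoeff (E s f * E s g) \<gamma>) has_field_derivative mcoeff (V (E s f * E s g)) \<gamma>) (at s)"
      by (simp add: V_mult mcoeff_mult case_prod_unfold sum.distrib add.commute)
  qed
  then show ?thesis by (simp add: E_0)
qed

lemma E_const: "E t (mfps_const c) = mfps_const c"
proof -
  have "mfps_const c = E t (mfps_const c)"
    by (rule solution_eq_E[of "\<lambda>_. mfps_const c"]) (simp add: V_const)
  then show ?thesis by simp
qed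

sublocale E: mfps_hom "E t" for t
  by unfold_locales (simp_all add: E.lin_add E_mult E_const E.lin_ge)

definition flow :: "complex \<Rightarrow> 'n mfps ^ 'n"
  where "flow t = (\<chi> j. E t (mfps_var j))"

lemma flow_nth [simp]: "flow t $ j = E t (mfps_var j)"
  by (simp add: flow_def)

lemma pullback_flow: "pullback (flow t) f = E t f"
  unfolding flow_def by (rule E.hom_eq_pullback[symmetric])

lemma flow_max_tuples: "flow t \<in> max_tuples"
  using E.hom_max_tuples[OF mvars_in_max_tuples] by (simp add: flow_def)

lemma flow_add: "mcomp (flow s) (flow t) = flow (s + t)"
  by (simp add: vec_eq_iff pullback_flow add.commute[of s] E_add)

lemma flow_0: "flow 0 = mvars"
  by (simp add: vec_eq_iff E_0)

lemma flow_carrier: "flow t \<in> carrier formal_Diff"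
proof -
  have "linear_part (flow t) ** linear_part (flow (- t)) = linear_part (mcomp (flow t) (flow (- t)))"
    by (rule linear_part_mcomp[symmetric]) (rule flow_max_tuples)+
  also have "\<dots> = mat 1" by (simp only: flow_add right_minus flow_0 linear_part_mvars)
  finally have "linear_part (flow t) ** linear_part (flow (- t)) = mat 1" .
  then have "det (linear_part (flow t)) * det (linear_part (flow (- t))) = 1"
    by (metis det_I det_mul)
  then show ?thesis by (auto simp: formal_Diff_simps flow_max_tuples)
qed

lemma is_flow_map_iff: "is_flow_map v t F \<longleftrightarrow> F = flow t"
proof
  assume F: "is_flow_map v t F"
  then have "F \<in> max_tuples" by (simp add: is_flow_map_def formal_Diff_simps)
  moreover have "E t f = pullback F f" for f
    by (rule E_eqI) (use F in \<open>simp add: is_flow_map_def\<close>)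
  ultimately show "F = flow t" by (simp add: vec_eq_iff pullback_var)
next
  assume "F = flow t"
  then show "is_flow_map v t F"
    by (simp only: is_flow_map_def flow_carrier pullback_flow E_sums simp_thms)
qed

text \<open>The equation of the flow in the form that \<open>orbit_coeffs_in\<close> expects: the
  derivative is \<open>v\<close> composed with the flow, just as the next iterate of
  \<open>F\<close> is \<open>F\<close> composed with the present one.\<close>

lemma flow_has_derivative:
  "((\<lambda>t. mcoeff (flow t $ i) \<gamma>) has_field_derivative mcoeff (pullback (flow t) (v $ i)) \<gamma>) (at t)"
  using E_has_derivative[of "mfps_var i" \<gamma> t] by (simp add: V_var pullback_flow)

end


section \<open>Algebras of functions\<close>

locale function_algebra =
  fixes A :: "('s \<Rightarrow> complex) set"
  assumes const_in: "(\<lambda>_. c) \<in> A"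
    and add_in: "f \<in> A \<Longrightarrow> g \<in> A \<Longrightarrow> (\<lambda>s. f s + g s) \<in> A"
    and mult_in: "f \<in> A \<Longrightarrow> g \<in> A \<Longrightarrow> (\<lambda>s. f s * g s) \<in> A"
begin

lemma diff_in: "f \<in> A \<Longrightarrow> g \<in> A \<Longrightarrow> (\<lambda>s. f s - g s) \<in> A"
  using add_in[OF _ mult_in[OF const_in[of "- 1"]], of f g] by simp

lemma sum_in: "(\<And>x. x \<in> S \<Longrightarrow> (\<lambda>s. f x s) \<in> A) \<Longrightarrow> (\<lambda>s. \<Sum>x\<in>S. f x s) \<in> A"
  by (induction S rule: infinite_finite_induct) (auto intro: const_in add_in)

definition series_in :: "('s \<Rightarrow> 'n::finite mfps) \<Rightarrow> bool"
  where "series_in w \<longleftrightarrow> (\<forall>\<gamma>. (\<lambda>s. mcoeff (w s) \<gamma>) \<in> A)"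

lemma series_inD: "series_in w \<Longrightarrow> (\<lambda>s. mcoeff (w s) \<gamma>) \<in> A"
  by (simp add: series_in_def)

lemma series_in_const: "series_in (\<lambda>_. f)"
  by (simp add: series_in_def const_in)

lemma series_in_add: "series_in w \<Longrightarrow> series_in z \<Longrightarrow> series_in (\<lambda>s. w s + z s)"
  by (simp add: series_in_def add_in)

lemma series_in_mult: "series_in w \<Longrightarrow> series_in z \<Longrightarrow> series_in (\<lambda>s. w s * z s)"
  by (auto simp: series_in_def mcoeff_mult case_prod_unfold intro!: sum_in mult_in)

lemma series_in_power: "series_in w \<Longrightarrow> series_in (\<lambda>s. w s ^ m)"
  by (induction m) (simp_all add: series_in_const series_in_mult)

lemma series_in_prod: "(\<And>x. x \<in> S \<Longrightarrow> series_in (w x)) \<Longrightarrow> series_in (\<lambda>s. \<Prod>x\<in>S. w x s)"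
  by (induction S rule: infinite_finite_induct) (simp_all add: series_in_const series_in_mult)

lemma series_in_mpow: "(\<And>i. series_in (\<lambda>s. g s $ i)) \<Longrightarrow> series_in (\<lambda>s. mpow (g s) \<alpha>)"
  unfolding mpow_def by (intro series_in_prod series_in_power)

lemma series_in_pullback:
  "(\<And>i. series_in (\<lambda>s. g s $ i)) \<Longrightarrow> series_in w \<Longrightarrow> series_in (\<lambda>s. pullback (g s) (w s))"
  using series_inD[OF series_in_mpow, of g] series_inD[of w]
  by (auto simp: series_in_def mcoeff_pullback intro!: sum_in mult_in)

lemma series_in_scale: "f \<in> A \<Longrightarrow> series_in w \<Longrightarrow> series_in (\<lambda>s. mfps_const (f s) * w s)"
  by (auto simp: series_in_def intro: mult_in)

end

text \<open>Polynomial expressions in the functions of \<open>B\<close>, encoded by closure rules so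
  that no formal polynomials in several unknowns occur.\<close>

inductive_set falg :: "('s \<Rightarrow> complex) set \<Rightarrow> ('s \<Rightarrow> complex) set" for B
  where
    base: "b \<in> B \<Longrightarrow> b \<in> falg B"
  | const: "(\<lambda>_. c) \<in> falg B"
  | add: "f \<in> falg B \<Longrightarrow> g \<in> falg B \<Longrightarrow> (\<lambda>s. f s + g s) \<in> falg B"
  | mult: "f \<in> falg B \<Longrightarrow> g \<in> falg B \<Longrightarrow> (\<lambda>s. f s * g s) \<in> falg B"

lemma function_algebra_falg: "function_algebra (falg B)"
  by unfold_locales (auto intro: falg.intros)

text \<open>Transports the algebra belonging to one generator, with its own exponent or time, to the
  common parameter space.\<close>

lemma (in function_algebra) falg_reparam:
  assumes "f \<in> falg B" "\<And>b. b \<in> B \<Longrightarrow> (\<lambda>s. b (p s)) \<in> A"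
  shows "(\<lambda>s. f (p s)) \<in> A"
  using assms(1) by induction (auto intro: assms(2) const_in add_in mult_in)


section \<open>Linear systems with quasi-polynomial right-hand side\<close>

text \<open>\<open>step c c'\<close> is either the shift of sequences or differentiation.\<close>

locale linear_step =
  fixes step :: "('s \<Rightarrow> complex) \<Rightarrow> ('s \<Rightarrow> complex) \<Rightarrow> bool"
  assumes step_add: "step c c' \<Longrightarrow> step d d' \<Longrightarrow> step (\<lambda>s. c s + d s) (\<lambda>s. c' s + d' s)"
    and step_scale: "step c c' \<Longrightarrow> step (\<lambda>s. a * c s) (\<lambda>s. a * c' s)"
begin

lemma step_diff: "step c c' \<Longrightarrow> step d d' \<Longrightarrow> step (\<lambda>s. c s - d s) (\<lambda>s. c' s - d' s)"
  using step_add[OF _ step_scale[of d d' "- 1"], of c c'] by simp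

lemma step_sum:
  assumes "\<And>x. step (c x) (c' x)"
  shows "step (\<lambda>s. \<Sum>x\<in>S. c x s) (\<lambda>s. \<Sum>x\<in>S. c' x s)"
proof (induction S rule: infinite_finite_induct)
  case (insert x S)
  then show ?case using step_add[OF assms[of x]] by simp
qed (use step_scale[OF assms, of 0] in auto)

text \<open>The factors L - l are removed one by one. The vector u' = (L - l) u solves the same
  system with right-hand side (L - l) b and one factor fewer, so it has entries in \<open>Q\<close>;
  each entry of \<open>u\<close> then solves a scalar equation with right-hand side u' + b, to which
  \<open>solve\<close> applies.\<close>

lemma linear_system_in:
  fixes L :: "complex ^ 'n::finite ^ 'n" and u b :: "'s \<Rightarrow> complex ^ 'n"
  assumes Q: "function_algebra Q"
    and solve: "\<And>l c c'. l \<in> set ls \<Longrightarrow> step c c' \<Longrightarrow> (\<lambda>s. c' s - l * c s) \<in> Q \<Longrightarrow> c \<in> Q"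
    and "\<And>i. (\<lambda>s. fold (\<lambda>l w. L *v w - l *s w) ls (u s) $ i) \<in> Q"
    and "\<And>i. step (\<lambda>s. u s $ i) (\<lambda>s. (L *v u s + b s) $ i)"
    and "\<And>i. (\<lambda>s. b s $ i) \<in> Q"
  shows "(\<lambda>s. u s $ i) \<in> Q"
  using assms(2-)
proof (induction ls arbitrary: u b i)
  case Nil
  then show ?case by simp
next
  case (Cons l ls)
  interpret function_algebra Q by fact
  define u' where "u' s = L *v u s - l *s u s" for s
  define b' where "b' s = L *v b s - l *s b s" for s
  have u'_in: "(\<lambda>s. u' s $ i) \<in> Q" for i
  proof (rule Cons.IH)
    show "c \<in> Q" if "m \<in> set ls" "step c c'" "(\<lambda>s. c' s - m * c s) \<in> Q" for m c c'
      using Cons.prems(1)[of m c c'] that by simp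
    show "(\<lambda>s. fold (\<lambda>l w. L *v w - l *s w) ls (u' s) $ i) \<in> Q" for i
      using Cons.prems(2)[of i] by (simp add: u'_def)
    show "step (\<lambda>s. u' s $ i) (\<lambda>s. (L *v u' s + b' s) $ i)" for i
    proof -
      have "step (\<lambda>s. (\<Sum>j\<in>UNIV. L $ i $ j * u s $ j) - l * u s $ i)
        (\<lambda>s. (\<Sum>j\<in>UNIV. L $ i $ j * (L *v u s + b s) $ j) - l * (L *v u s + b s) $ i)"
        by (intro step_diff step_sum step_scale Cons.prems(3))
      moreover have "(\<Sum>j\<in>UNIV. L $ i $ j * u s $ j) - l * u s $ i = u' s $ i" for s
        by (simp add: u'_def matrix_vector_mult_def)
      moreover have "(\<Sum>j\<in>UNIV. L $ i $ j * (L *v u s + b s) $ j) - l * (L *v u s + b s) $ i =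
          (L *v u' s + b' s) $ i" for s
      proof -
        have "(\<Sum>j\<in>UNIV. L $ i $ j * (L *v u s + b s) $ j) = (L *v (L *v u s + b s)) $ i"
          by (simp add: matrix_vector_mult_def)
        then show ?thesis
          by (simp add: u'_def b'_def matrix_vector_right_distrib matrix_vector_mult_diff_distrib
              vector_scalar_commute algebra_simps)
      qed
      ultimately show ?thesis by simp
    qed
    show "(\<lambda>s. b' s $ i) \<in> Q" for i
      unfolding b'_def matrix_vector_mult_def
      by (simp, intro diff_in sum_in mult_in const_in Cons.prems(4))
  qed
  show ?case
  proof (rule Cons.prems(1)[OF _ Cons.prems(3)])
    have "(\<lambda>s. (L *v u s + b s) $ i - l * u s $ i) = (\<lambda>s. u' s $ i + b s $ i)"
      by (simp add: u'_def algebra_simps)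
    then show "(\<lambda>s. (L *v u s + b s) $ i - l * u s $ i) \<in> Q"
      by (simp only: add_in[OF u'_in Cons.prems(4)])
  qed simp
qed

end

text \<open>An index of degree at least two is one variable times a nonconstant monomial. In the
  telescoped difference every difference of order \<open>k\<close> is multiplied by a factor of
  order at least one.\<close>

lemma mpow_cong_order_2:
  assumes F: "F \<in> max_tuples" and F': "F' \<in> max_tuples"
    and diff: "\<And>i. F $ i - F' $ i \<in> mfps_ge k" and \<alpha>: "mdeg \<alpha> \<ge> 2"
  shows "mpow F \<alpha> - mpow F' \<alpha> \<in> mfps_ge (Suc k)"
proof -
  have "\<alpha> \<noteq> 0" using \<alpha> by auto
  then obtain i \<beta> where eq: "\<alpha> = \<beta> + axis i 1" by (rule mdeg_axis_split)
  have "mdeg \<beta> \<ge> 1" using \<alpha> by (simp add: eq)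
  then have \<beta>: "mpow F' \<beta> \<in> mfps_ge 1"
    using mfps_ge_antimono mpow_in_ge[OF F'] by blast
  have "mpow F \<beta> - mpow F' \<beta> \<in> mfps_ge k"
    unfolding mpow_def by (intro mfps_cong_prod mfps_cong_power diff)
  then have "(mpow F \<beta> - mpow F' \<beta>) * F $ i \<in> mfps_ge (k + 1)"
    using F by (intro mfps_ge_mult) (auto simp: max_tuples_def mfps_max_eq)
  moreover have "mpow F' \<beta> * (F $ i - F' $ i) \<in> mfps_ge (1 + k)"
    by (intro mfps_ge_mult \<beta> diff)
  ultimately have "(mpow F \<beta> - mpow F' \<beta>) * F $ i + mpow F' \<beta> * (F $ i - F' $ i) \<in> mfps_ge (Suc k)"
    by (simp add: mfps_ge_add)
  then show ?thesis by (simp add: eq mpow_add algebra_simps)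
qed

text \<open>The terms of degree at least two of \<open>F $ i\<close> only involve coefficients of \<open>g\<close> of lower degree,
  so the coefficients of \<open>g\<close> of a given degree solve a linear system.\<close>

lemma (in linear_step) orbit_coeffs_in:
  fixes F :: "'n::finite mfps ^ 'n" and g :: "'s \<Rightarrow> 'n mfps ^ 'n"
  assumes Q: "function_algebra Q"
    and solve: "\<And>l c c'. l \<in> set ls \<Longrightarrow> step c c' \<Longrightarrow> (\<lambda>s. c' s - l * c s) \<in> Q \<Longrightarrow> c \<in> Q"
    and ls: "\<And>w. fold (\<lambda>l w. linear_part F *v w - l *s w) ls w = 0"
    and F: "F \<in> max_tuples" and g: "\<And>s. g s \<in> max_tuples"
    and step: "\<And>i \<gamma>. step (\<lambda>s. mcoeff (g s $ i) \<gamma>) (\<lambda>s. mcoeff (pullback (g s) (F $ i)) \<gamma>)"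
  shows "(\<lambda>s. mcoeff (g s $ i) \<gamma>) \<in> Q"
proof (induction "mdeg \<gamma>" arbitrary: \<gamma> i rule: less_induct)
  case less
  interpret function_algebra Q by fact
  show ?case
  proof (cases "\<gamma> = 0")
    case True
    then have "(\<lambda>s. mcoeff (g s $ i) \<gamma>) = (\<lambda>_. 0)"
      using g by (auto simp: max_tuples_def mfps_max_def)
    then show ?thesis by (simp add: const_in)
  next
    case False
    let ?k = "mdeg \<gamma>"
    have k: "?k \<ge> 1" using False mdeg_eq_0_iff[of \<gamma>] by linarith
    define T where "T = {\<alpha> :: nat ^ 'n. 2 \<le> mdeg \<alpha> \<and> mdeg \<alpha> \<le> ?k}"
    have finT: "finite T" unfolding T_def by (rule finite_subset[OF _ finite_mdeg_le[of ?k]]) auto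
    define u :: "'s \<Rightarrow> complex ^ 'n" where "u s = (\<chi> i. mcoeff (g s $ i) \<gamma>)" for s
    define b :: "'s \<Rightarrow> complex ^ 'n"
      where "b s = (\<chi> i. \<Sum>\<alpha>\<in>T. mcoeff (F $ i) \<alpha> * mcoeff (mpow (g s) \<alpha>) \<gamma>)" for s
    \<comment> \<open>The truncation of \<open>g s\<close> below the present degree: its
      coefficients are zero or lie in \<open>Q\<close> by induction, and the power products of
      degree at least two cannot tell it from \<open>g s\<close> at \<gamma>.\<close>
    define g' :: "'s \<Rightarrow> 'n mfps ^ 'n"
      where "g' s = (\<chi> i. Abs_mfps (\<lambda>\<delta>. if mdeg \<delta> < ?k then mcoeff (g s $ i) \<delta> else 0))" for s
    have g': "g' s \<in> max_tuples" for s
      using g[of s] by (auto simp: max_tuples_def mfps_max_def g'_def)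
    have g'_in: "series_in (\<lambda>s. g' s $ i)" for i
      unfolding series_in_def
    proof
      fix \<delta>
      show "(\<lambda>s. mcoeff (g' s $ i) \<delta>) \<in> Q"
        using less[of \<delta> i] by (cases "mdeg \<delta> < ?k") (simp_all add: g'_def const_in)
    qed
    have cong: "mcoeff (mpow (g s) \<alpha>) \<gamma> = mcoeff (mpow (g' s) \<alpha>) \<gamma>" if "\<alpha> \<in> T" for s \<alpha>
    proof (rule mfps_eq_mod_ge[OF mpow_cong_order_2[OF g g', where k = ?k]])
      show "g s $ i - g' s $ i \<in> mfps_ge ?k" for i
        by (auto simp: mfps_ge_def g'_def)
    qed (use that in \<open>auto simp: T_def\<close>)
    have b_in: "(\<lambda>s. b s $ i) \<in> Q" for i
      using series_inD[OF series_in_mpow, OF g'_in]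
      by (auto simp: b_def cong intro!: sum_in mult_in const_in)
    \<comment> \<open>Terms of degree one act on the vector of coefficients at the fixed \<gamma> by
      the linear part, the higher ones form \<open>b\<close>, and the free term of
      \<open>F $ i\<close> is zero.\<close>
    have split: "mcoeff (pullback (g s) (F $ i)) \<gamma> = (linear_part F *v u s + b s) $ i" for s i
    proof -
      let ?t = "\<lambda>\<alpha>. mcoeff (F $ i) \<alpha> * mcoeff (mpow (g s) \<alpha>) \<gamma>"
      let ?A = "range (\<lambda>j. axis j 1) :: (nat ^ 'n) set"
      have "mcoeff (pullback (g s) (F $ i)) \<gamma> = sum ?t {\<alpha>. mdeg \<alpha> \<le> ?k}"
        by (rule mcoeff_pullback)
      also have "\<dots> = sum ?t (?A \<union> T)"
      proof (rule sum.mono_neutral_right)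
        show "?A \<union> T \<subseteq> {\<alpha>. mdeg \<alpha> \<le> ?k}" using k by (auto simp: T_def)
        show "\<forall>\<alpha>\<in>{\<alpha>. mdeg \<alpha> \<le> ?k} - (?A \<union> T). ?t \<alpha> = 0"
        proof
          fix \<alpha> assume "\<alpha> \<in> {\<alpha>. mdeg \<alpha> \<le> ?k} - (?A \<union> T)"
          then have "mdeg \<alpha> \<noteq> 1" "\<not> 2 \<le> mdeg \<alpha>"
            using mdeg_eq_1_iff[of \<alpha>] by (auto simp: T_def)
          then have "mdeg \<alpha> = 0" by linarith
          then have "\<alpha> = 0" by simp
          then show "?t \<alpha> = 0" using F by (auto simp: max_tuples_def mfps_max_def)
        qed
      qed simp
      also have "\<dots> = sum ?t ?A + sum ?t T"
        by (rule sum.union_disjoint) (use finT in \<open>auto simp: T_def\<close>)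
      also have "sum ?t ?A = (linear_part F *v u s) $ i"
        by (subst sum.reindex)
          (auto simp: inj_on_def axis_eq_axis matrix_vector_mult_def linear_part_def u_def)
      finally show ?thesis by (simp add: b_def)
    qed
    have "(\<lambda>s. u s $ i) \<in> Q"
    proof (rule linear_system_in[OF Q solve])
      show "step (\<lambda>s. u s $ i) (\<lambda>s. (linear_part F *v u s + b s) $ i)" for i
        using step[of i \<gamma>] unfolding split by (simp add: u_def)
      show "(\<lambda>s. fold (\<lambda>l w. linear_part F *v w - l *s w) ls (u s) $ i) \<in> Q" for i
        unfolding ls by (simp add: const_in)
    qed (auto intro: b_in)
    then show ?thesis by (simp add: u_def)
  qed
qed

text \<open>Elimination: the equation \<tau> is solved for an unknown \<open>j0\<close> with nonzero
  coefficient, leaving one equation and one unknown fewer. It yields both the annihilating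
  polynomial of a matrix and the bound on the order of truncation.\<close>

lemma underdetermined_system:
  fixes a :: "'j \<Rightarrow> 't \<Rightarrow> 'k::field"
  assumes "finite T" "finite J" "card T < card J"
  shows "\<exists>c. (\<exists>j\<in>J. c j \<noteq> 0) \<and> (\<forall>\<tau>\<in>T. (\<Sum>j\<in>J. c j * a j \<tau>) = 0)"
  using assms
proof (induction T arbitrary: J a rule: finite_induct)
  case empty
  then have "J \<noteq> {}" by auto
  then show ?case by (intro exI[of _ "\<lambda>_. 1"]) auto
next
  case (insert \<tau> T)
  show ?case
  proof (cases "\<forall>j\<in>J. a j \<tau> = 0")
    case True
    have "card T < card J" using insert by simp
    from insert.IH[OF insert.prems(1) this, of a] True show ?thesis by auto
  next
    case False
    then obtain j0 where j0: "j0 \<in> J" "a j0 \<tau> \<noteq> 0" by blast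
    have "card T < card (J - {j0})" using insert j0 by simp
    then obtain c where c: "\<exists>j\<in>J - {j0}. c j \<noteq> 0"
      "\<And>\<sigma>. \<sigma> \<in> T \<Longrightarrow> (\<Sum>j\<in>J - {j0}. c j * (a j \<sigma> - a j \<tau> / a j0 \<tau> * a j0 \<sigma>)) = 0"
      using insert.IH[of "J - {j0}" "\<lambda>j \<sigma>. a j \<sigma> - a j \<tau> / a j0 \<tau> * a j0 \<sigma>"] insert.prems by auto
    define c' where "c' = c(j0 := - (\<Sum>j\<in>J - {j0}. c j * a j \<tau>) / a j0 \<tau>)"
    have eq: "(\<Sum>j\<in>J. c' j * a j \<sigma>) = (\<Sum>j\<in>J - {j0}. c j * (a j \<sigma> - a j \<tau> / a j0 \<tau> * a j0 \<sigma>))" for \<sigma>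
    proof -
      have "(\<Sum>j\<in>J. c' j * a j \<sigma>) = c' j0 * a j0 \<sigma> + (\<Sum>j\<in>J - {j0}. c' j * a j \<sigma>)"
        using insert.prems(1) j0(1) by (rule sum.remove)
      also have "(\<Sum>j\<in>J - {j0}. c' j * a j \<sigma>) = (\<Sum>j\<in>J - {j0}. c j * a j \<sigma>)"
        by (rule sum.cong) (auto simp: c'_def)
      also have "c' j0 * a j0 \<sigma> = - (\<Sum>j\<in>J - {j0}. c j * (a j \<tau> / a j0 \<tau> * a j0 \<sigma>))"
        by (simp add: c'_def sum_distrib_left sum_distrib_right sum_divide_distrib mult.assoc)
      finally show ?thesis by (simp add: right_diff_distrib sum_subtractf)
    qed
    have "(\<Sum>j\<in>J. c' j * a j \<sigma>) = 0" if "\<sigma> \<in> insert \<tau> T" for \<sigma>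
      using that c(2) j0(2) by (auto simp: eq)
    moreover have "\<exists>j\<in>J. c' j \<noteq> 0" using c(1) by (auto simp: c'_def)
    ultimately show ?thesis by blast
  qed
qed


section \<open>An annihilating product of linear factors\<close>

text \<open>The vector p(L) w, evaluated by Horner's scheme.\<close>

definition poly_act :: "'a::field ^ 'n::finite ^ 'n \<Rightarrow> 'a poly \<Rightarrow> 'a ^ 'n \<Rightarrow> 'a ^ 'n"
  where "poly_act L p w = fold_coeffs (\<lambda>a v. a *s w + L *v v) p 0"

lemma poly_act_0 [simp]: "poly_act L 0 w = 0"
  by (simp add: poly_act_def)

lemma poly_act_pCons [simp]: "poly_act L (pCons a p) w = a *s w + L *v poly_act L p w"
  by (cases "p = 0 \<and> a = 0") (auto simp: poly_act_def)

lemma poly_act_add: "poly_act L (p + q) w = poly_act L p w + poly_act L q w"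
  by (induction p q rule: poly_induct2)
    (simp_all add: vector_sadd_rdistrib matrix_vector_right_distrib add_ac)

lemma poly_act_smult: "poly_act L (smult c p) w = c *s poly_act L p w"
  by (induction p) (simp_all add: vector_add_ldistrib vector_smult_assoc vector_scalar_commute)

lemma poly_act_diff: "poly_act L (p - q) w = poly_act L p w - poly_act L q w"
  using poly_act_add[of L "p - q" q w] by simp

lemma poly_act_sum: "poly_act L (sum p S) w = (\<Sum>x\<in>S. poly_act L (p x) w)"
  by (induction S rule: infinite_finite_induct) (auto simp: poly_act_add)

lemma poly_act_monom: "poly_act L (monom c k) w = c *s ((*v) L ^^ k) w"
  by (induction k) (simp_all add: monom_0 monom_Suc vector_scalar_commute)

lemma poly_act_prod_linear:
  "poly_act L (\<Prod>l\<leftarrow>ls. [:- l, 1:]) w = foldr (\<lambda>l w. L *v w - l *s w) ls w"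
  by (induction ls) (simp_all add: poly_act_diff poly_act_smult one_pCons)

text \<open>The d^2 + 1 powers of \<open>L\<close> from exponent 0 to d^2 are linearly dependent in
  the space of matrices, which has dimension d^2.\<close>

lemma annihilating_poly:
  fixes L :: "'a::field ^ 'n::finite ^ 'n"
  obtains p where "p \<noteq> 0" "\<And>w. poly_act L p w = 0"
proof -
  define M where "M k = ((**) L ^^ k) (mat 1)" for k
  let ?T = "UNIV :: ('n \<times> 'n) set" and ?J = "{..card (UNIV :: ('n \<times> 'n) set)}"
  obtain c where c: "\<exists>k\<in>?J. c k \<noteq> 0" "\<And>i j. (\<Sum>k\<in>?J. c k * M k $ i $ j) = 0"
    using underdetermined_system[of ?T ?J "\<lambda>k (i, j). M k $ i $ j"] by auto
  have M: "((*v) L ^^ k) w = M k *v w" for k w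
    by (induction k) (simp_all add: M_def matrix_vector_mul_assoc)
  let ?p = "\<Sum>k\<in>?J. monom (c k) k"
  have "coeff ?p k = c k" if "k \<in> ?J" for k
    using that by (simp add: coeff_sum)
  then have "?p \<noteq> 0" using c(1) by (metis coeff_0)
  moreover have "poly_act L ?p w = 0" for w
  proof -
    have "poly_act L ?p w $ i = (\<Sum>j\<in>UNIV. (\<Sum>k\<in>?J. c k * M k $ i $ j) * w $ j)" for i
      by (simp add: poly_act_sum poly_act_monom M matrix_vector_mult_def sum_distrib_left
          sum_distrib_right mult.assoc sum.swap[of _ UNIV])
    then show ?thesis unfolding c(2) by (simp add: vec_eq_iff)
  qed
  ultimately show ?thesis by (rule that)
qed

lemma annihilating_roots:
  fixes L :: "complex ^ 'n::finite ^ 'n"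
  obtains ls where "\<And>w. fold (\<lambda>l w. L *v w - l *s w) ls w = 0"
proof -
  obtain p where p: "p \<noteq> 0" "\<And>w. poly_act L p w = 0" using annihilating_poly[of L] by blast
  obtain A where "p = smult (lead_coeff p) (\<Prod>x\<in>#A. [:- x, 1:])"
    using alg_closed_imp_factorization[OF p(1)] by blast
  moreover obtain ls where "A = mset ls" by (metis ex_mset)
  ultimately obtain c where c: "p = smult c (\<Prod>l\<leftarrow>ls. [:- l, 1:])"
    by (metis prod_mset_prod_list mset_map)
  have "c \<noteq> 0" using p(1) c by auto
  moreover have "c *s foldr (\<lambda>l w. L *v w - l *s w) ls w = 0" for w
    using p(2)[of w] by (simp only: c poly_act_smult poly_act_prod_linear)
  ultimately have "foldr (\<lambda>l w. L *v w - l *s w) ls w = 0" for w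
    by (simp add: vector_mul_eq_0)
  then have "fold (\<lambda>l w. L *v w - l *s w) (rev ls) w = 0" for w
    by (simp add: foldr_conv_fold)
  then show ?thesis by (rule that)
qed

lemma fold_linear_factors_commute:
  fixes L :: "complex ^ 'n::finite ^ 'n"
  shows "fold (\<lambda>l w. L *v w - l *s w) ls (L *v w) = L *v fold (\<lambda>l w. L *v w - l *s w) ls w"
proof (induction ls arbitrary: w)
  case (Cons l ls)
  have "L *v (L *v w) - l *s (L *v w) = L *v (L *v w - l *s w)"
    by (simp add: matrix_vector_mult_diff_distrib vector_scalar_commute)
  then show ?case by (simp add: Cons.IH)
qed simp

text \<open>A factor with root 0 is \<open>L\<close> itself; it commutes with the others and is
  injective, so it can be cancelled. The root 0 must go because for \<mu> = 0 the resonance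
  coefficients of the shift vanish.\<close>

lemma annihilating_roots_nonzero:
  fixes L :: "complex ^ 'n::finite ^ 'n"
  assumes "det L \<noteq> 0"
  obtains ls where "0 \<notin> set ls" "\<And>w. fold (\<lambda>l w. L *v w - l *s w) ls w = 0"
proof -
  let ?f = "fold (\<lambda>l w. L *v w - l *s w)"
  obtain ls where "\<And>w. ?f ls w = 0" by (rule annihilating_roots) blast
  then have "\<exists>ls. 0 \<notin> set ls \<and> (\<forall>w. ?f ls w = 0)"
  proof (induction "length ls" arbitrary: ls rule: less_induct)
    case less
    show ?case
    proof (cases "0 \<in> set ls")
      case True
      then obtain xs ys where ls: "ls = xs @ 0 # ys" by (metis split_list)
      have "L *v ?f (xs @ ys) w = 0" for w
        using less.prems[of w] by (simp add: ls fold_linear_factors_commute)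
      moreover have "w = 0" if "L *v w = 0" for w
        using that assms invertible_det_nz[of L] by (simp add: invertible_left_inverse matrix_left_invertible_ker)
      ultimately have "?f (xs @ ys) w = 0" for w by blast
      then show ?thesis by (rule less.hyps[rotated]) (simp add: ls)
    qed (use less in blast)
  qed
  then show ?thesis using that by blast
qed


section \<open>Quasi-polynomials\<close>

text \<open>\<open>e i \<mu>\<close> is \<open>n\<^sup>i \<mu>\<^sup>n\<close> for the shift and \<open>t\<^sup>i exp (\<mu> t)\<close> for differentiation.\<close>

locale quasi_polynomials = linear_step step
  for step :: "('s \<Rightarrow> complex) \<Rightarrow> ('s \<Rightarrow> complex) \<Rightarrow> bool" +
  fixes e :: "nat \<Rightarrow> complex \<Rightarrow> 's \<Rightarrow> complex"
    and op :: "complex \<Rightarrow> complex \<Rightarrow> complex" and un :: complex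
    and P :: "complex \<Rightarrow> bool" and a :: "nat \<Rightarrow> nat \<Rightarrow> complex \<Rightarrow> complex"
  assumes e_mult: "e i \<mu> s * e j \<nu> s = e (i + j) (op \<mu> \<nu>) s"
    and e_one: "e 0 un s = 1"
    and op_un: "op un \<mu> = \<mu>"
    and P_un: "P un" and P_op: "P \<mu> \<Longrightarrow> P \<nu> \<Longrightarrow> P (op \<mu> \<nu>)"
    and step_e: "P \<mu> \<Longrightarrow> step (e i \<mu>) (\<lambda>s. \<mu> * e i \<mu> s + (\<Sum>j<i. a i j \<mu> * e j \<mu> s))"
    and a_nz: "P \<mu> \<Longrightarrow> a (Suc i) i \<mu> \<noteq> 0"
    and step_eigen: "P l \<Longrightarrow> step c (\<lambda>s. l * c s) \<Longrightarrow> \<exists>k. \<forall>s. c s = k * e 0 l s"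
begin

text \<open>The generator \<open>e 1 un\<close> is n or t, as \<open>un\<close> is the neutral base
  or exponent; its powers provide every \<open>e i un\<close>. The generating set stays finite
  however often resonances raise the power.\<close>

definition Q :: "complex set \<Rightarrow> ('s \<Rightarrow> complex) set"
  where "Q \<Lambda> = falg (insert (e 1 un) (e 0 ` \<Lambda>))"

sublocale Q: function_algebra "Q \<Lambda>" for \<Lambda>
  unfolding Q_def by (rule function_algebra_falg)

lemma e_in_Q: "e 0 \<mu> \<in> Q \<Lambda> \<Longrightarrow> e i \<mu> \<in> Q \<Lambda>"
proof (induction i)
  case (Suc i)
  have "e 1 un \<in> Q \<Lambda>" unfolding Q_def by (rule falg.base) simp
  from Q.mult_in[OF this Suc.IH[OF Suc.prems]] show ?case
    by (simp add: e_mult op_un)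
qed

text \<open>Solvability of the scalar equation is linear, but not multiplicative, in the right-hand
  side. The algebra \<open>Q\<close> is therefore exhibited as a linear span of single
  terms.\<close>

inductive_set qspan :: "complex set \<Rightarrow> ('s \<Rightarrow> complex) set" for \<Lambda>
  where
    qterm: "P \<mu> \<Longrightarrow> e 0 \<mu> \<in> Q \<Lambda> \<Longrightarrow> (\<lambda>s. c * e i \<mu> s) \<in> qspan \<Lambda>"
  | qadd: "f \<in> qspan \<Lambda> \<Longrightarrow> g \<in> qspan \<Lambda> \<Longrightarrow> (\<lambda>s. f s + g s) \<in> qspan \<Lambda>"

lemma qspan_mult_term:
  assumes "f \<in> qspan \<Lambda>" "P \<nu>" "e 0 \<nu> \<in> Q \<Lambda>"
  shows "(\<lambda>s. d * e j \<nu> s * f s) \<in> qspan \<Lambda>"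
  using assms(1)
proof induction
  case (qterm \<mu> c i)
  have "e 0 (op \<nu> \<mu>) \<in> Q \<Lambda>"
    using Q.mult_in[OF assms(3) qterm(2)] by (simp add: e_mult)
  then have "(\<lambda>s. (d * c) * e (j + i) (op \<nu> \<mu>) s) \<in> qspan \<Lambda>"
    by (intro qspan.qterm P_op qterm assms)
  then show ?case by (simp add: mult_ac flip: e_mult)
next
  case (qadd f g)
  then show ?case using qspan.qadd by (simp add: distrib_left)
qed

lemma qspan_mult:
  assumes "f \<in> qspan \<Lambda>" "g \<in> qspan \<Lambda>"
  shows "(\<lambda>s. f s * g s) \<in> qspan \<Lambda>"
  using assms(1)
proof induction
  case (qterm \<mu> c i)
  then show ?case using qspan_mult_term[OF assms(2)] by simp
next
  case (qadd f h)
  then show ?case using qspan.qadd by (simp add: distrib_right)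
qed

lemma Q_subset_qspan:
  assumes \<Lambda>: "\<And>l. l \<in> \<Lambda> \<Longrightarrow> P l" and f: "f \<in> Q \<Lambda>"
  shows "f \<in> qspan \<Lambda>"
  using f unfolding Q_def
proof induction
  case (base b)
  have un: "e 0 un \<in> Q \<Lambda>" using Q.const_in[of 1] e_one by (metis ext)
  have "(\<lambda>s. 1 * e 1 un s) \<in> qspan \<Lambda>" by (intro qterm P_un un)
  moreover have "(\<lambda>s. 1 * e 0 l s) \<in> qspan \<Lambda>" if "l \<in> \<Lambda>" for l
    by (rule qterm) (use that \<Lambda> in \<open>auto simp: Q_def intro: falg.base\<close>)
  ultimately show ?case using base by auto
next
  case (const c)
  have "e 0 un \<in> Q \<Lambda>" using Q.const_in[of 1] e_one by (metis ext)
  then have "(\<lambda>s. c * e 0 un s) \<in> qspan \<Lambda>" by (intro qterm P_un)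
  then show ?case by (simp add: e_one)
qed (auto intro: qadd qspan_mult)

definition solvable :: "complex set \<Rightarrow> complex \<Rightarrow> ('s \<Rightarrow> complex) \<Rightarrow> bool"
  where "solvable \<Lambda> l f \<longleftrightarrow> (\<exists>c c'. c \<in> Q \<Lambda> \<and> step c c' \<and> (\<forall>s. c' s - l * c s = f s))"

lemma solvableI: "c \<in> Q \<Lambda> \<Longrightarrow> step c c' \<Longrightarrow> (\<And>s. c' s - l * c s = f s) \<Longrightarrow> solvable \<Lambda> l f"
  by (auto simp: solvable_def)

lemma solvable_add:
  assumes "solvable \<Lambda> l f" "solvable \<Lambda> l g"
  shows "solvable \<Lambda> l (\<lambda>s. f s + g s)"
proof -
  obtain c c' d d' where *: "c \<in> Q \<Lambda>" "step c c'" "\<And>s. c' s - l * c s = f s"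
    "d \<in> Q \<Lambda>" "step d d'" "\<And>s. d' s - l * d s = g s"
    using assms by (auto simp: solvable_def)
  show ?thesis
    by (rule solvableI[OF Q.add_in[OF *(1,4)] step_add[OF *(2,5)]])
      (simp add: algebra_simps flip: *(3,6))
qed

lemma solvable_scale:
  assumes "solvable \<Lambda> l f" shows "solvable \<Lambda> l (\<lambda>s. k * f s)"
proof -
  obtain c c' where *: "c \<in> Q \<Lambda>" "step c c'" "\<And>s. c' s - l * c s = f s"
    using assms by (auto simp: solvable_def)
  show ?thesis
    by (rule solvableI[OF Q.mult_in[OF Q.const_in *(1)] step_scale[OF *(2), of k]])
      (simp add: algebra_simps flip: *(3))
qed

lemma solvable_sum:
  assumes "\<And>x. x \<in> S \<Longrightarrow> solvable \<Lambda> l (f x)"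
  shows "solvable \<Lambda> l (\<lambda>s. \<Sum>x\<in>S. f x s)"
  using assms
proof (induction S rule: infinite_finite_induct)
  case (insert x S)
  then show ?case by (simp add: solvable_add)
next
  case empty
  show ?case
    by (rule solvableI[OF Q.const_in[of 0]]) (use step_scale[OF step_e[OF P_un], of 0] in auto)
next
  case (infinite S)
  show ?case
    by (rule solvableI[OF Q.const_in[of 0]])
      (use step_scale[OF step_e[OF P_un], of 0] infinite in auto)
qed

text \<open>For \<mu> different from \<open>l\<close>, the function \<open>e i \<mu>\<close> itself
  solves the equation for (\<mu> - l) \<open>e i \<mu>\<close> plus lower terms. In the resonant
  case that leading term cancels, and \<open>e (Suc i) \<mu>\<close> is used, whose image leads with
  the nonzero multiple \<open>a (Suc i) i \<mu>\<close> of \<open>e i \<mu>\<close>.\<close>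

lemma solvable_e:
  assumes "P \<mu>" "e 0 \<mu> \<in> Q \<Lambda>"
  shows "solvable \<Lambda> l (e i \<mu>)"
proof (induction i rule: less_induct)
  case (less i)
  have lower: "solvable \<Lambda> l (\<lambda>s. \<Sum>j<i. b j * e j \<mu> s)" for b
    by (intro solvable_sum solvable_scale less) simp
  show ?case
  proof (cases "\<mu> = l")
    case True
    have "solvable \<Lambda> l (\<lambda>s. \<Sum>j<Suc i. a (Suc i) j \<mu> * e j \<mu> s)"
      by (rule solvableI[OF e_in_Q[OF assms(2)] step_e[OF assms(1), of "Suc i"]]) (simp add: True)
    from solvable_add[OF this solvable_scale[OF lower[of "\<lambda>j. a (Suc i) j \<mu>"], of "- 1"]]
    have "solvable \<Lambda> l (\<lambda>s. a (Suc i) i \<mu> * e i \<mu> s)" by simp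
    from solvable_scale[OF this, of "1 / a (Suc i) i \<mu>"] show ?thesis
      using a_nz[OF assms(1)] by simp
  next
    case False
    have "solvable \<Lambda> l (\<lambda>s. (\<mu> - l) * e i \<mu> s + (\<Sum>j<i. a i j \<mu> * e j \<mu> s))"
      by (rule solvableI[OF e_in_Q[OF assms(2)] step_e[OF assms(1)]]) (simp add: algebra_simps)
    from solvable_add[OF this solvable_scale[OF lower[of "\<lambda>j. a i j \<mu>"], of "- 1"]]
    have "solvable \<Lambda> l (\<lambda>s. (\<mu> - l) * e i \<mu> s)" by simp
    from solvable_scale[OF this, of "1 / (\<mu> - l)"] show ?thesis
      using False by simp
  qed
qed

text \<open>A particular solution \<open>d\<close> in \<open>Q\<close> exists, and c - d solves the
  homogeneous equation, hence is a multiple of \<open>e 0 l\<close>.\<close>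

lemma solution_in_Q:
  assumes \<Lambda>: "\<And>l. l \<in> \<Lambda> \<Longrightarrow> P l" and l: "l \<in> \<Lambda>"
    and c: "step c c'" "(\<lambda>s. c' s - l * c s) \<in> Q \<Lambda>"
  shows "c \<in> Q \<Lambda>"
proof -
  have "solvable \<Lambda> l f" if "f \<in> qspan \<Lambda>" for f
    using that by induction (auto intro: solvable_e solvable_scale solvable_add)
  from this[OF Q_subset_qspan[OF \<Lambda> c(2)]]
  obtain d d' where d: "d \<in> Q \<Lambda>" "step d d'" "\<And>s. d' s - l * d s = c' s - l * c s"
    by (auto simp: solvable_def)
  have "(\<lambda>s. c' s - d' s) = (\<lambda>s. l * (c s - d s))"
    using d(3) by (simp add: fun_eq_iff algebra_simps)
  then have "step (\<lambda>s. c s - d s) (\<lambda>s. l * (c s - d s))"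
    using step_diff[OF c(1) d(2)] by simp
  then obtain k where k: "\<And>s. c s - d s = k * e 0 l s"
    using step_eigen[OF \<Lambda>[OF l]] by blast
  have "e 0 l \<in> Q \<Lambda>" using l by (auto simp: Q_def intro: falg.base)
  then have "(\<lambda>s. k * e 0 l s + d s) \<in> Q \<Lambda>"
    by (intro Q.add_in Q.mult_in Q.const_in d)
  then show ?thesis by (simp flip: k)
qed

lemma orbit_coeffs_in_falg:
  fixes F :: "'n::finite mfps ^ 'n" and g :: "'s \<Rightarrow> 'n mfps ^ 'n"
  assumes "\<And>l. l \<in> set ls \<Longrightarrow> P l"
    and "\<And>w. fold (\<lambda>l w. linear_part F *v w - l *s w) ls w = 0"
    and "F \<in> max_tuples" and "\<And>s. g s \<in> max_tuples"
    and "\<And>i \<gamma>. step (\<lambda>s. mcoeff (g s $ i) \<gamma>) (\<lambda>s. mcoeff (pullback (g s) (F $ i)) \<gamma>)"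
  shows "\<exists>B. finite B \<and> (\<forall>i \<gamma>. (\<lambda>s. mcoeff (g s $ i) \<gamma>) \<in> falg B)"
proof (intro exI conjI allI)
  show "finite (insert (e 1 un) (e 0 ` set ls))" by simp
  fix i \<gamma>
  have "(\<lambda>s. mcoeff (g s $ i) \<gamma>) \<in> Q (set ls)"
    by (rule orbit_coeffs_in[OF Q.function_algebra_axioms _ assms(2-5)])
      (rule solution_in_Q[OF assms(1)])
  then show "(\<lambda>s. mcoeff (g s $ i) \<gamma>) \<in> falg (insert (e 1 un) (e 0 ` set ls))"
    by (simp add: Q_def)
qed

end

section \<open>The shift and differentiation as instances\<close>

lemma quasi_polynomials_shift:
  "quasi_polynomials (\<lambda>c c'. \<forall>n. c' n = c (Suc n)) (\<lambda>i \<mu> n. of_nat n ^ i * \<mu> ^ n) (*) 1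
     (\<lambda>\<mu>. \<mu> \<noteq> 0) (\<lambda>i j \<mu>. \<mu> * of_nat (i choose j))"
proof
  fix \<mu> l :: complex and i :: nat
  show "\<forall>n. \<mu> * (of_nat n ^ i * \<mu> ^ n) + (\<Sum>j<i. \<mu> * of_nat (i choose j) * (of_nat n ^ j * \<mu> ^ n)) =
      of_nat (Suc n) ^ i * \<mu> ^ Suc n"
  proof
    fix n
    have "of_nat (Suc n) ^ i = (\<Sum>j\<le>i. of_nat (i choose j) * of_nat n ^ j :: complex)"
      using binomial_ring[of "of_nat n" "1 :: complex" i] by (simp add: add.commute)
    also have "\<dots> = of_nat n ^ i + (\<Sum>j<i. of_nat (i choose j) * of_nat n ^ j)"
      by (simp add: lessThan_Suc_atMost[symmetric])
    finally show "\<mu> * (of_nat n ^ i * \<mu> ^ n) + (\<Sum>j<i. \<mu> * of_nat (i choose j) * (of_nat n ^ j * \<mu> ^ n)) =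
      of_nat (Suc n) ^ i * \<mu> ^ Suc n"
      by (simp add: algebra_simps sum_distrib_left sum_distrib_right del: of_nat_Suc)
  qed
  show "\<mu> * of_nat (Suc i choose i) \<noteq> 0" if "\<mu> \<noteq> 0"
    using that of_nat_neq_0[of i, where ?'a = complex] by simp
  show "\<exists>k. \<forall>n. c n = k * (of_nat n ^ 0 * l ^ n)" if "\<forall>n. l * c n = c (Suc n)" for c :: "nat \<Rightarrow> complex"
  proof (intro exI allI)
    show "c n = c 0 * (of_nat n ^ 0 * l ^ n)" for n
      by (induction n) (use that in \<open>auto simp flip: that[rule_format] simp: mult_ac\<close>)
  qed
qed (auto simp: power_add power_mult_distrib)

lemma quasi_polynomials_deriv:
  "quasi_polynomials (\<lambda>c c'. \<forall>t. (c has_field_derivative c' t) (at t)) (\<lambda>i \<mu> t. t ^ i * exp (\<mu> * t)) (+) 0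
     (\<lambda>_. True) (\<lambda>i j \<mu>. if Suc j = i then of_nat i else 0)"
proof
  fix \<mu> l :: complex and i :: nat
  show "\<forall>t. ((\<lambda>t. t ^ i * exp (\<mu> * t)) has_field_derivative \<mu> * (t ^ i * exp (\<mu> * t)) +
      (\<Sum>j<i. (if Suc j = i then of_nat i else 0) * (t ^ j * exp (\<mu> * t)))) (at t)"
  proof
    fix t
    have "(\<Sum>j<i. (if Suc j = i then of_nat i else 0) * (t ^ j * exp (\<mu> * t))) =
        of_nat i * t ^ (i - 1) * exp (\<mu> * t)"
      by (cases i) (simp_all add: if_distrib[of "\<lambda>x. x * _"] cong: if_cong)
    then show "((\<lambda>t. t ^ i * exp (\<mu> * t)) has_field_derivative \<mu> * (t ^ i * exp (\<mu> * t)) +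
      (\<Sum>j<i. (if Suc j = i then of_nat i else 0) * (t ^ j * exp (\<mu> * t)))) (at t)"
      by (auto intro!: derivative_eq_intros simp: algebra_simps)
  qed
  show "(if Suc i = Suc i then of_nat (Suc i) else 0) \<noteq> (0 :: complex)"
    using of_nat_neq_0[of i, where ?'a = complex] by simp
  show "\<exists>k. \<forall>t. c t = k * (t ^ 0 * exp (l * t))"
    if c: "\<forall>t. (c has_field_derivative l * c t) (at t)" for c :: "complex \<Rightarrow> complex"
  proof -
    have "((\<lambda>t. c t * exp (- l * t)) has_field_derivative 0) (at t)" for t
      using c[rule_format, of t] by (auto intro!: derivative_eq_intros)
    then obtain k where k: "\<And>t. c t * exp (- l * t) = k"
      using has_field_derivative_zero_constant[of UNIV "\<lambda>t. c t * exp (- l * t)"] by auto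
    have "c t = k * (t ^ 0 * exp (l * t))" for t
      by (simp add: exp_minus field_simps flip: k[of t])
    then show ?thesis by blast
  qed
qed (auto simp: power_add exp_add ring_distribs intro: DERIV_add DERIV_cmult)

lemma iterate_coeffs:
  assumes F: "F \<in> carrier (formal_Diff :: ('n::finite mfps ^ 'n) monoid)"
  shows "\<exists>B. finite B \<and> (\<forall>i \<gamma>. (\<lambda>n. mcoeff ((F [^]\<^bsub>formal_Diff\<^esub> (n :: nat)) $ i) \<gamma>) \<in> falg B)"
proof -
  interpret D: monoid "formal_Diff :: ('n mfps ^ 'n) monoid" by (rule monoid_formal_Diff)
  have "det (linear_part F) \<noteq> 0" using F by (simp add: formal_Diff_simps)
  then obtain ls where ls: "0 \<notin> set ls"
    "\<And>w. fold (\<lambda>l w. linear_part F *v w - l *s w) ls w = 0"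
    by (rule annihilating_roots_nonzero) blast
  have pow: "F [^]\<^bsub>formal_Diff\<^esub> n \<in> max_tuples" for n :: nat
    using D.nat_pow_closed[OF F, of n] by (simp add: formal_Diff_simps)
  show ?thesis
  proof (rule quasi_polynomials.orbit_coeffs_in_falg[OF quasi_polynomials_shift _ ls(2) _ pow])
    show "l \<noteq> 0" if "l \<in> set ls" for l using that ls(1) by auto
    show "F \<in> max_tuples" using F by (simp add: formal_Diff_simps)
    \<comment> \<open>The rule \<open>nat_pow_Suc2\<close> puts the new factor outside, so the next
      iterate consists of the components of \<open>F\<close> pulled back along the present
      one.\<close>
    show "\<forall>n. mcoeff (pullback (F [^]\<^bsub>formal_Diff\<^esub> n) (F $ i)) \<gamma> =
      mcoeff ((F [^]\<^bsub>formal_Diff\<^esub> Suc n) $ i) \<gamma>" for i \<gamma>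
      by (simp only: D.nat_pow_Suc2[OF F] formal_Diff_simps(2) mcomp_nth simp_thms)
  qed
qed

lemma (in formal_vector_field) flow_coeffs:
  "\<exists>B. finite B \<and> (\<forall>i \<gamma>. (\<lambda>t. mcoeff (flow t $ i) \<gamma>) \<in> falg B)"
proof -
  obtain ls where ls: "\<And>w. fold (\<lambda>l w. linear_part v *v w - l *s w) ls w = 0"
    by (rule annihilating_roots) blast
  show ?thesis
    by (rule quasi_polynomials.orbit_coeffs_in_falg[OF quasi_polynomials_deriv _ ls v flow_max_tuples])
      (simp_all only: flow_has_derivative simp_thms)
qed


section \<open>Ascending chains of ideals\<close>

locale subring_set =
  fixes A :: "'a::comm_ring_1 set"
  assumes one_mem: "1 \<in> A"
    and add_mem: "x \<in> A \<Longrightarrow> y \<in> A \<Longrightarrow> x + y \<in> A"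
    and uminus_mem: "x \<in> A \<Longrightarrow> - x \<in> A"
    and mult_mem: "x \<in> A \<Longrightarrow> y \<in> A \<Longrightarrow> x * y \<in> A"
begin

lemma zero_mem: "0 \<in> A"
  using add_mem[OF one_mem uminus_mem[OF one_mem]] by simp

definition is_ideal :: "'a set \<Rightarrow> bool"
  where "is_ideal J \<longleftrightarrow> J \<subseteq> A \<and> 0 \<in> J \<and> (\<forall>x\<in>J. \<forall>y\<in>J. x + y \<in> J) \<and> (\<forall>a\<in>A. \<forall>x\<in>J. a * x \<in> J)"

lemma is_ideal_diff: "is_ideal J \<Longrightarrow> x \<in> J \<Longrightarrow> y \<in> J \<Longrightarrow> x - y \<in> J"
  using uminus_mem[OF one_mem] unfolding is_ideal_def by (metis add_uminus_conv_diff mult_minus1)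

definition noetherian :: bool
  where "noetherian \<longleftrightarrow> (\<forall>J :: nat \<Rightarrow> 'a set. (\<forall>n. is_ideal (J n)) \<and> (\<forall>n. J n \<subseteq> J (Suc n)) \<longrightarrow>
    (\<exists>N. \<forall>n\<ge>N. J n = J N))"

lemma noetherianD:
  "noetherian \<Longrightarrow> (\<And>n. is_ideal (J n)) \<Longrightarrow> (\<And>n. J n \<subseteq> J (Suc n)) \<Longrightarrow> \<exists>N. \<forall>n\<ge>N. J n = J N"
  by (simp add: noetherian_def)

text \<open>Values at \<open>f\<close> of polynomials of degree less than \<open>k\<close> over
  \<open>A\<close>. As \<open>f\<close> may satisfy equations over \<open>A\<close>, elements of
  \<open>adjoin f\<close> have no well-defined degree, and a degree bound is carried along
  instead.\<close>

primrec pspan :: "'a \<Rightarrow> nat \<Rightarrow> 'a set"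
  where
    "pspan f 0 = {0}"
  | "pspan f (Suc k) = {y + a * f ^ k | y a. y \<in> pspan f k \<and> a \<in> A}"

definition adjoin :: "'a \<Rightarrow> 'a set"
  where "adjoin f = (\<Union>k. pspan f k)"

lemma zero_in_pspan: "0 \<in> pspan f k"
proof (induction k)
  case (Suc k)
  have "0 = 0 + 0 * f ^ k" by simp
  then show ?case using Suc zero_mem unfolding pspan.simps by blast
qed simp

lemma pspan_mono_Suc: "x \<in> pspan f k \<Longrightarrow> x \<in> pspan f (Suc k)"
  using zero_mem by (force intro: exI[of _ x] exI[of _ 0])

lemma pspan_mono: "k \<le> l \<Longrightarrow> x \<in> pspan f k \<Longrightarrow> x \<in> pspan f l"
  by (induction l rule: dec_induct) (auto simp del: pspan.simps intro: pspan_mono_Suc)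

lemma pspan_add: "x \<in> pspan f k \<Longrightarrow> y \<in> pspan f k \<Longrightarrow> x + y \<in> pspan f k"
proof (induction k arbitrary: x y)
  case (Suc k)
  obtain x' a y' b where *: "x = x' + a * f ^ k" "x' \<in> pspan f k" "a \<in> A"
    "y = y' + b * f ^ k" "y' \<in> pspan f k" "b \<in> A"
    using Suc.prems by auto
  have "x + y = (x' + y') + (a + b) * f ^ k" by (simp add: * algebra_simps)
  then show ?case using Suc.IH[OF *(2,5)] add_mem[OF *(3,6)] unfolding pspan.simps by blast
qed simp

lemma pspan_scale: "c \<in> A \<Longrightarrow> x \<in> pspan f k \<Longrightarrow> c * x \<in> pspan f k"
proof (induction k arbitrary: x)
  case (Suc k)
  obtain x' a where *: "x = x' + a * f ^ k" "x' \<in> pspan f k" "a \<in> A"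
    using Suc.prems by auto
  have "c * x = c * x' + (c * a) * f ^ k" by (simp add: * algebra_simps)
  then show ?case using Suc.IH[OF Suc.prems(1) *(2)] mult_mem[OF Suc.prems(1) *(3)]
    unfolding pspan.simps by blast
qed simp

lemma pspan_shift: "x \<in> pspan f k \<Longrightarrow> f * x \<in> pspan f (Suc k)"
proof (induction k arbitrary: x)
  case 0
  then show ?case using zero_in_pspan[of f "Suc 0"] by (simp del: pspan.simps(2))
next
  case (Suc k)
  obtain x' a where *: "x = x' + a * f ^ k" "x' \<in> pspan f k" "a \<in> A"
    using Suc.prems by auto
  have "f * x = f * x' + a * f ^ Suc k" by (simp add: * algebra_simps)
  then show ?case using Suc.IH[OF *(2)] *(3) unfolding pspan.simps(2)[of f "Suc k"] by blast
qed

lemma pspan_power: "x \<in> pspan f k \<Longrightarrow> f ^ m * x \<in> pspan f (m + k)"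
  by (induction m) (auto simp del: pspan.simps simp: mult.assoc intro: pspan_shift)

lemma adjoin_add: "x \<in> adjoin f \<Longrightarrow> y \<in> adjoin f \<Longrightarrow> x + y \<in> adjoin f"
proof -
  assume "x \<in> adjoin f" "y \<in> adjoin f"
  then obtain k l where "x \<in> pspan f k" "y \<in> pspan f l" by (auto simp: adjoin_def)
  then have "x + y \<in> pspan f (max k l)"
    by (intro pspan_add) (rule pspan_mono[rotated], assumption, simp)+
  then show ?thesis by (auto simp: adjoin_def)
qed

lemma adjoin_mult:
  assumes "x \<in> adjoin f" "y \<in> adjoin f" shows "x * y \<in> adjoin f"
proof -
  obtain l where y: "y \<in> pspan f l" using assms by (auto simp: adjoin_def)
  have "x * y \<in> adjoin f" if "x \<in> pspan f k" for k
    using that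
  proof (induction k arbitrary: x)
    case 0
    then have "x = 0" by simp
    then show ?case using zero_in_pspan[of f 0] by (auto simp: adjoin_def simp del: pspan.simps)
  next
    case (Suc k)
    obtain x' a where *: "x = x' + a * f ^ k" "x' \<in> pspan f k" "a \<in> A"
      using Suc.prems by auto
    have "a * (f ^ k * y) \<in> adjoin f"
      using pspan_scale[OF *(3) pspan_power[OF y]] by (auto simp: adjoin_def)
    from adjoin_add[OF Suc.IH[OF *(2)] this] show ?case by (simp add: * algebra_simps)
  qed
  then show ?thesis using assms(1) by (auto simp: adjoin_def)
qed

lemma A_subset_adjoin: "a \<in> A \<Longrightarrow> a \<in> adjoin f"
proof -
  assume "a \<in> A"
  then have "0 + a * f ^ 0 \<in> pspan f (Suc 0)" unfolding pspan.simps by blast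
  then show ?thesis by (auto simp: adjoin_def simp del: pspan.simps)
qed

lemma f_in_adjoin: "f \<in> adjoin f"
proof -
  have "0 + 1 * f ^ 0 \<in> pspan f (Suc 0)" using one_mem unfolding pspan.simps by blast
  from pspan_shift[OF this] show ?thesis by (auto simp: adjoin_def simp del: pspan.simps)
qed

lemma subring_set_adjoin: "subring_set (adjoin f)"
proof
  show "- x \<in> adjoin f" if "x \<in> adjoin f" for x
    using adjoin_mult[OF A_subset_adjoin[OF uminus_mem[OF one_mem]] that] by simp
qed (auto intro: adjoin_add adjoin_mult A_subset_adjoin one_mem)

definition lead_ideal :: "'a \<Rightarrow> nat \<Rightarrow> 'a set \<Rightarrow> 'a set"
  where "lead_ideal f k J = {a \<in> A. \<exists>y\<in>pspan f k. y + a * f ^ k \<in> J}"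

context
  fixes f :: 'a
begin

interpretation F: subring_set "adjoin f"
  by (rule subring_set_adjoin)

lemma is_ideal_lead_ideal:
  assumes "F.is_ideal J" shows "is_ideal (lead_ideal f k J)"
  unfolding is_ideal_def
proof (intro conjI ballI)
  show "lead_ideal f k J \<subseteq> A" by (auto simp: lead_ideal_def)
  show "0 \<in> lead_ideal f k J"
    using zero_in_pspan zero_mem assms by (auto simp: lead_ideal_def F.is_ideal_def intro!: bexI[of _ 0])
next
  fix a b assume a: "a \<in> lead_ideal f k J" and b: "b \<in> lead_ideal f k J"
  obtain x y where *: "a \<in> A" "x \<in> pspan f k" "x + a * f ^ k \<in> J"
    "b \<in> A" "y \<in> pspan f k" "y + b * f ^ k \<in> J"
    using a b by (auto simp: lead_ideal_def)
  have "(x + a * f ^ k) + (y + b * f ^ k) \<in> J" using assms * by (auto simp: F.is_ideal_def)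
  then have "(x + y) + (a + b) * f ^ k \<in> J" by (simp add: algebra_simps)
  then show "a + b \<in> lead_ideal f k J"
    using add_mem pspan_add * unfolding lead_ideal_def by blast
next
  fix c a assume c: "c \<in> A" and a: "a \<in> lead_ideal f k J"
  obtain x where *: "a \<in> A" "x \<in> pspan f k" "x + a * f ^ k \<in> J"
    using a by (auto simp: lead_ideal_def)
  have "c * (x + a * f ^ k) \<in> J"
    using assms * A_subset_adjoin[OF c] by (auto simp: F.is_ideal_def)
  then have "c * x + (c * a) * f ^ k \<in> J" by (simp add: algebra_simps)
  then show "c * a \<in> lead_ideal f k J"
    using mult_mem[OF c] pspan_scale[OF c] * unfolding lead_ideal_def by blast
qed

lemma lead_ideal_mono: "J \<subseteq> J' \<Longrightarrow> lead_ideal f k J \<subseteq> lead_ideal f k J'"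
  by (auto simp: lead_ideal_def)

lemma lead_ideal_Suc:
  assumes "F.is_ideal J" shows "lead_ideal f k J \<subseteq> lead_ideal f (Suc k) J"
proof
  fix a assume "a \<in> lead_ideal f k J"
  then obtain x where *: "a \<in> A" "x \<in> pspan f k" "x + a * f ^ k \<in> J"
    by (auto simp: lead_ideal_def)
  have "f * (x + a * f ^ k) \<in> J"
    using assms * f_in_adjoin by (auto simp: F.is_ideal_def)
  then have "f * x + a * f ^ Suc k \<in> J" by (simp add: algebra_simps)
  then show "a \<in> lead_ideal f (Suc k) J"
    using * pspan_shift unfolding lead_ideal_def by blast
qed

text \<open>Induction on the degree bound: from an element of \<open>J'\<close> subtract an element
  of \<open>J\<close> with the same leading coefficient. The remainder lies in \<open>J'\<close> and
  has a smaller bound.\<close>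

lemma ideal_eq_of_lead_ideals:
  assumes "F.is_ideal J" "F.is_ideal J'" "J \<subseteq> J'"
    and "\<And>k. lead_ideal f k J' \<subseteq> lead_ideal f k J"
  shows "J = J'"
proof
  have "x \<in> J" if "x \<in> pspan f k" "x \<in> J'" for x k
    using that
  proof (induction k arbitrary: x)
    case 0
    then show ?case using assms(1) by (auto simp: F.is_ideal_def)
  next
    case (Suc k)
    obtain x' a where *: "x = x' + a * f ^ k" "x' \<in> pspan f k" "a \<in> A"
      using Suc.prems by auto
    then have "a \<in> lead_ideal f k J'" using Suc.prems(2) by (auto simp: lead_ideal_def)
    then have "a \<in> lead_ideal f k J" using assms(4) by blast
    then obtain y where y: "y \<in> pspan f k" "y + a * f ^ k \<in> J" by (auto simp: lead_ideal_def)
    have eq: "x = (x' - y) + (y + a * f ^ k)" by (simp add: *)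
    have "x' - y \<in> pspan f k"
      using pspan_add[OF *(2) pspan_scale[OF uminus_mem[OF one_mem] y(1)]] by simp
    moreover have "x' - y \<in> J'"
      using F.is_ideal_diff[OF assms(2) Suc.prems(2), of "y + a * f ^ k"] y(2) assms(3)
      by (auto simp: *)
    ultimately have "x' - y \<in> J" by (rule Suc.IH)
    then show ?case using y(2) assms(1) unfolding eq F.is_ideal_def by blast
  qed
  moreover have "\<exists>k. x \<in> pspan f k" if "x \<in> J'" for x
    using assms(2) that unfolding F.is_ideal_def by (auto simp: adjoin_def)
  ultimately show "J' \<subseteq> J" by blast
qed (rule assms)

text \<open>Hilbert's basis theorem. Along the chain, the ideals of leading coefficients in large degree
  are controlled by the diagonal \<open>lead_ideal f n (J n)\<close>, the others by finitely many chains.\<close>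

lemma noetherian_adjoin:
  assumes "noetherian" shows "F.noetherian"
  unfolding F.noetherian_def
proof (intro allI impI, elim conjE)
  fix J assume J: "\<forall>n. F.is_ideal (J n)" and mono: "\<forall>n. J n \<subseteq> J (Suc n)"
  have J_mono: "J m \<subseteq> J n" if "m \<le> n" for m n
    using lift_Suc_mono_le[of J, OF _ that] mono by blast
  have L_mono: "lead_ideal f k (J m) \<subseteq> lead_ideal f l (J n)" if "k \<le> l" "m \<le> n" for k l m n
  proof -
    have "lead_ideal f k (J m) \<subseteq> lead_ideal f l (J m)"
      using lift_Suc_mono_le[of "\<lambda>k. lead_ideal f k (J m)", OF _ that(1)] lead_ideal_Suc J by blast
    also have "\<dots> \<subseteq> lead_ideal f l (J n)" by (intro lead_ideal_mono J_mono that)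
    finally show ?thesis .
  qed
  have ideals: "is_ideal (lead_ideal f k (J n))" for k n
    using J by (simp add: is_ideal_lead_ideal)
  have "\<exists>N. \<forall>n\<ge>N. lead_ideal f n (J n) = lead_ideal f N (J N)"
    by (rule noetherianD[OF assms, of "\<lambda>n. lead_ideal f n (J n)"]) (rule ideals L_mono; simp)+
  then obtain N where N: "\<And>n. n \<ge> N \<Longrightarrow> lead_ideal f n (J n) = lead_ideal f N (J N)"
    by blast
  have "\<exists>M. \<forall>n\<ge>M. lead_ideal f k (J n) = lead_ideal f k (J M)" for k
    by (rule noetherianD[OF assms, of "\<lambda>n. lead_ideal f k (J n)"]) (rule ideals L_mono; simp)+
  then have "\<forall>k. \<exists>M. \<forall>n\<ge>M. lead_ideal f k (J n) = lead_ideal f k (J M)" by blast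
  from choice[OF this] obtain M
    where M: "\<And>k n. n \<ge> M k \<Longrightarrow> lead_ideal f k (J n) = lead_ideal f k (J (M k))"
    by blast
  \<comment> \<open>From \<open>K\<close> on, the diagonal and the finitely many chains in degrees
    below \<open>N\<close> are all stationary.\<close>
  define K where "K = Max (insert N (M ` {..<N}))"
  have K: "N \<le> K" "k < N \<Longrightarrow> M k \<le> K" for k by (auto simp: K_def)
  have "J n = J K" if "n \<ge> K" for n
  proof (rule ideal_eq_of_lead_ideals[symmetric])
    fix k
    show "lead_ideal f k (J n) \<subseteq> lead_ideal f k (J K)"
    proof (cases "k < N")
      case True
      then show ?thesis using M[of k n] M[of k K] K(2)[of k] that by simp
    next
      case False
      \<comment> \<open>In degree \<open>k\<close> at least \<open>N\<close> the ideal is caught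
        between two members of the diagonal: the one at \<open>max k n\<close> and the one at
        \<open>N\<close>, which coincide.\<close>
      have "lead_ideal f k (J n) \<subseteq> lead_ideal f (max k n) (J (max k n))" by (intro L_mono) auto
      also have "\<dots> = lead_ideal f N (J N)" by (rule N) (use K(1) that in simp)
      also have "\<dots> \<subseteq> lead_ideal f k (J K)" using False K(1) by (intro L_mono) auto
      finally show ?thesis .
    qed
  qed (use J J_mono that in auto)
  then show "\<exists>N. \<forall>n\<ge>N. J n = J N" by blast
qed

end

end

text \<open>The constants form a field, so a chain can leave the zero ideal only once. They start
  the induction on the number of generators.\<close>

lemma constants_noetherian:
  "subring_set (range (\<lambda>c. \<lambda>_ :: 's. c :: complex))"
  "subring_set.noetherian (range (\<lambda>c. \<lambda>_ :: 's. c :: complex))"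
proof -
  let ?C = "range (\<lambda>c. \<lambda>_ :: 's. c :: complex)"
  show *: "subring_set ?C"
    by unfold_locales (auto simp: plus_fun_def times_fun_def one_fun_def fun_Compl_def)
  interpret C: subring_set ?C by (rule *)
  have J: "J = {0} \<or> J = ?C" if "C.is_ideal J" for J
  proof (cases "J = {0}")
    case False
    moreover have "0 \<in> J" "J \<subseteq> ?C" using that by (simp_all add: C.is_ideal_def)
    ultimately obtain x where x: "x \<in> J" "x \<noteq> 0" by blast
    with \<open>J \<subseteq> ?C\<close> obtain c where xc: "x = (\<lambda>_. c)" by blast
    have c: "(\<lambda>_. c) \<in> J" "c \<noteq> 0" using x by (auto simp: xc zero_fun_def)
    have "(\<lambda>_. d) \<in> J" for d
    proof -
      have "(\<lambda>_. d / c) * (\<lambda>_. c) \<in> J" using that c(1) unfolding C.is_ideal_def by blast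
      then show ?thesis using c(2) by (simp add: times_fun_def)
    qed
    then show ?thesis using that by (auto simp: C.is_ideal_def)
  qed simp
  show "C.noetherian"
    unfolding C.noetherian_def
  proof (intro allI impI, elim conjE)
    fix I :: "nat \<Rightarrow> ('s \<Rightarrow> complex) set"
    assume I: "\<forall>n. C.is_ideal (I n)" and mono: "\<forall>n. I n \<subseteq> I (Suc n)"
    show "\<exists>N. \<forall>n\<ge>N. I n = I N"
    proof (cases "\<exists>N. I N \<noteq> {0}")
      case True
      then obtain N where N: "I N = ?C" "I N \<noteq> {0}" using J I by blast
      have "I n = I N" if "n \<ge> N" for n
      proof -
        have "I N \<subseteq> I n" using lift_Suc_mono_le[of I, OF _ that] mono by blast
        moreover have "0 \<in> I N" using I unfolding C.is_ideal_def by blast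
        ultimately have "I n \<noteq> {0}" using N(2) by blast
        then have "I n = ?C" using J I by blast
        then show ?thesis by (simp only: N(1))
      qed
      then show ?thesis by blast
    qed auto
  qed
qed

text \<open>The functions of \<open>B\<close> are adjoined to the constants one at a time, with the
  basis theorem applied at each stage.\<close>

lemma noetherian_function_algebra:
  assumes "finite B"
  obtains A where "function_algebra A" "B \<subseteq> A" "subring_set A" "subring_set.noetherian A"
proof -
  have "\<exists>A. function_algebra A \<and> B \<subseteq> A \<and> subring_set A \<and> subring_set.noetherian A"
    using assms
  proof induction
    case empty
    show ?case
      by (intro exI[of _ "range (\<lambda>c _. c)"] conjI constants_noetherian)
        (unfold_locales, auto)
  next
    case (insert b B)
    then obtain A where A: "function_algebra A" "B \<subseteq> A" "subring_set A" "subring_set.noetherian A"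
      by blast
    interpret A: function_algebra A by (rule A)
    interpret S: subring_set A by (rule A)
    show ?case
    proof (intro exI[of _ "S.adjoin b"] conjI)
      interpret T: subring_set "S.adjoin b" by (rule S.subring_set_adjoin)
      show "function_algebra (S.adjoin b)"
      proof
        show "(\<lambda>_. c) \<in> S.adjoin b" for c by (intro S.A_subset_adjoin A.const_in)
        fix f g assume "f \<in> S.adjoin b" "g \<in> S.adjoin b"
        then show "(\<lambda>s. f s + g s) \<in> S.adjoin b" "(\<lambda>s. f s * g s) \<in> S.adjoin b"
          using T.add_mem[of f g] T.mult_mem[of f g] by (simp_all add: plus_fun_def times_fun_def)
      qed
      show "insert b B \<subseteq> S.adjoin b"
        using A(2) S.A_subset_adjoin S.f_in_adjoin by auto
      show "T.noetherian" by (rule S.noetherian_adjoin[OF A(4)])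
    qed (rule S.subring_set_adjoin)
  qed
  then show ?thesis using that by blast
qed

text \<open>By \<open>closed\<close>, each \<open>Z n\<close> is the zero set of its own vanishing
  ideal in \<open>A\<close>; these ideals ascend as the sets descend.\<close>

lemma zero_sets_stabilise:
  assumes "subring_set A" "subring_set.noetherian A"
    and mono: "\<And>n. Z (Suc n) \<subseteq> Z n"
    and closed: "\<And>n s. s \<notin> Z n \<Longrightarrow> \<exists>\<phi>\<in>A. \<phi> s \<noteq> (0 :: complex) \<and> (\<forall>z\<in>Z n. \<phi> z = 0)"
  shows "\<exists>N. \<forall>n\<ge>N. Z n = Z N"
proof -
  interpret subring_set A by fact
  define I where "I n = {\<phi> \<in> A. \<forall>z\<in>Z n. \<phi> z = 0}" for n
  have "is_ideal (I n)" for n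
    by (auto simp: is_ideal_def I_def zero_mem add_mem mult_mem)
  moreover have "I n \<subseteq> I (Suc n)" for n
    using mono[of n] by (auto simp: I_def)
  ultimately obtain N where N: "\<And>n. n \<ge> N \<Longrightarrow> I n = I N"
    using noetherianD[OF assms(2)] by metis
  have Z: "Z n = {s. \<forall>\<phi>\<in>I n. \<phi> s = 0}" for n
    using closed[of _ n] by (auto simp: I_def)
  have "Z n = Z N" if "n \<ge> N" for n
    unfolding Z[of n] Z[of N] N[OF that] by (rule refl)
  then show ?thesis by blast
qed


section \<open>Openness of surjectivity\<close>

text \<open>Elimination in place of a nonvanishing minor, for a module \<open>W\<close> of sections
  that need not be finitely generated. A section \<open>u\<close> with
  \<open>u s0 \<delta> = 1\<close> serves as pivot, the remaining coordinates are treated by the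
  sections vanishing at \<delta>, and \<phi> is the product of the pivots.\<close>

lemma surjective_open:
  fixes W :: "('s \<Rightarrow> 'g \<Rightarrow> complex) set"
  assumes "function_algebra A" and "finite \<Delta>"
    and "\<And>x y a b. x \<in> W \<Longrightarrow> y \<in> W \<Longrightarrow> a \<in> A \<Longrightarrow> b \<in> A \<Longrightarrow>
      (\<lambda>s \<gamma>. a s * x s \<gamma> + b s * y s \<gamma>) \<in> W"
    and "\<And>w \<gamma>. w \<in> W \<Longrightarrow> (\<lambda>s. w s \<gamma>) \<in> A"
    and "\<And>f. \<exists>w\<in>W. \<forall>\<gamma>\<in>\<Delta>. w s0 \<gamma> = f \<gamma>"
  shows "\<exists>\<phi>\<in>A. \<phi> s0 \<noteq> 0 \<and> (\<forall>s. \<phi> s \<noteq> 0 \<longrightarrow> (\<forall>f. \<exists>w\<in>W. \<forall>\<gamma>\<in>\<Delta>. w s \<gamma> = f \<gamma>))"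
  using assms(2-)
proof (induction \<Delta> arbitrary: W rule: finite_induct)
  case empty
  interpret function_algebra A by fact
  have "W \<noteq> {}" using empty(3) by blast
  then show ?case using const_in[of 1] by (intro bexI[of _ "\<lambda>_. 1"]) auto
next
  case (insert \<delta> \<Delta>)
  interpret function_algebra A by fact
  note comb = insert.prems(1) and coeff = insert.prems(2) and surj = insert.prems(3)
  obtain u where u: "u \<in> W" "u s0 \<delta> = 1" using surj[of "\<lambda>_. 1"] by auto
  define W' where "W' = {w \<in> W. \<forall>s. w s \<delta> = 0}"
  have "\<exists>\<phi>\<in>A. \<phi> s0 \<noteq> 0 \<and> (\<forall>s. \<phi> s \<noteq> 0 \<longrightarrow> (\<forall>f. \<exists>w\<in>W'. \<forall>\<gamma>\<in>\<Delta>. w s \<gamma> = f \<gamma>))"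
  proof (rule insert.IH)
    fix f
    obtain w where w: "w \<in> W" "\<forall>\<gamma>\<in>insert \<delta> \<Delta>. w s0 \<gamma> = (f(\<delta> := 0)) \<gamma>"
      using surj by blast
    \<comment> \<open>The coordinate \<delta> cancels at every parameter, while at \<open>s0\<close>
      the section agrees with \<open>w\<close>, because \<open>u s0 \<delta> = 1\<close> and
      \<open>w s0 \<delta> = 0\<close>.\<close>
    define w' where "w' = (\<lambda>s \<gamma>. u s \<delta> * w s \<gamma> + (- 1 * w s \<delta>) * u s \<gamma>)"
    have "w' \<in> W'"
      unfolding w'_def W'_def using comb[OF w(1) u(1) coeff[OF u(1), of \<delta>]
          mult_in[OF const_in[of "- 1"] coeff[OF w(1), of \<delta>]]] by simp
    moreover have "\<forall>\<gamma>\<in>\<Delta>. w' s0 \<gamma> = f \<gamma>"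
      using w(2) u(2) insert.hyps(2) by (auto simp: w'_def)
    ultimately show "\<exists>w\<in>W'. \<forall>\<gamma>\<in>\<Delta>. w s0 \<gamma> = f \<gamma>" by blast
  qed (auto simp: W'_def comb coeff)
  then obtain \<phi> where \<phi>: "\<phi> \<in> A" "\<phi> s0 \<noteq> 0"
    "\<And>s f. \<phi> s \<noteq> 0 \<Longrightarrow> \<exists>w\<in>W'. \<forall>\<gamma>\<in>\<Delta>. w s \<gamma> = f \<gamma>"
    by blast
  show ?case
  proof (intro bexI[of _ "\<lambda>s. \<phi> s * u s \<delta>"] conjI allI impI)
    show "(\<lambda>s. \<phi> s * u s \<delta>) \<in> A" by (intro mult_in \<phi>(1) coeff u(1))
    show "\<phi> s0 * u s0 \<delta> \<noteq> 0" using \<phi>(2) u(2) by simp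
    fix s f assume "\<phi> s * u s \<delta> \<noteq> 0"
    then have nz: "\<phi> s \<noteq> 0" "u s \<delta> \<noteq> 0" by auto
    \<comment> \<open>The multiple c u adjusts the coordinate \<delta>; a section from
      \<open>W'\<close> then corrects the others without disturbing it.\<close>
    define c where "c = f \<delta> / u s \<delta>"
    obtain w where w: "w \<in> W'" "\<forall>\<gamma>\<in>\<Delta>. w s \<gamma> = f \<gamma> - c * u s \<gamma>"
      using \<phi>(3)[OF nz(1), of "\<lambda>\<gamma>. f \<gamma> - c * u s \<gamma>"] by blast
    have *: "(\<lambda>s \<gamma>. 1 * w s \<gamma> + c * u s \<gamma>) \<in> W"
      using comb[of w u "\<lambda>_. 1" "\<lambda>_. c"] w(1) u(1) const_in by (simp add: W'_def)
    show "\<exists>w\<in>W. \<forall>\<gamma>\<in>insert \<delta> \<Delta>. w s \<gamma> = f \<gamma>"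
      by (rule bexI[OF _ *]) (use w nz(2) in \<open>auto simp: W'_def c_def\<close>)
  qed
qed


section \<open>Nakayama's lemma for formal power series\<close>

text \<open>The geometric series. As h^n has order at least n, the terms with n at most
  \<open>mdeg \<gamma>\<close> determine the coefficient at \<gamma>.\<close>

lemma one_minus_unit:
  assumes h: "h \<in> mfps_max"
  obtains k where "(1 - h) * k = 1"
proof
  define k where "k = Abs_mfps (\<lambda>\<gamma>. \<Sum>n\<le>mdeg \<gamma>. mcoeff (h ^ n) \<gamma>)"
  have hn: "h ^ n \<in> mfps_ge n" for n
    using mfps_ge_power[of h 1 n] h by (simp add: mfps_max_eq)
  show "(1 - h) * k = 1"
  proof (rule mfps_eqI_ge)
    fix N
    have "k - (\<Sum>n\<le>N. h ^ n) \<in> mfps_ge N"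
    proof -
      have "(\<Sum>n\<le>mdeg \<gamma>. mcoeff (h ^ n) \<gamma>) = (\<Sum>n\<le>N. mcoeff (h ^ n) \<gamma>)" if "mdeg \<gamma> < N" for \<gamma>
        using that by (intro sum.mono_neutral_left) (auto intro: mfps_geD[OF hn])
      then show ?thesis by (auto simp: mfps_ge_def k_def)
    qed
    then have "(1 - h) * (k - (\<Sum>n\<le>N. h ^ n)) \<in> mfps_ge N"
      by (rule mfps_ge_mult_left)
    moreover have "h ^ Suc N \<in> mfps_ge N"
      by (rule mfps_ge_antimono[OF _ hn]) simp
    ultimately have "(1 - h) * (k - (\<Sum>n\<le>N. h ^ n)) - h ^ Suc N \<in> mfps_ge N"
      by (rule mfps_ge_diff)
    moreover have "(1 - h) * (k - (\<Sum>n\<le>N. h ^ n)) - h ^ Suc N = (1 - h) * k - 1"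
      using sum_gp_basic[of h N] by (simp add: right_diff_distrib)
    ultimately show "(1 - h) * k - 1 \<in> mfps_ge N" by simp
  qed
qed

locale series_ideal =
  fixes I :: "'n::finite mfps set"
  assumes zero_I: "0 \<in> I"
    and add_I: "f \<in> I \<Longrightarrow> g \<in> I \<Longrightarrow> f + g \<in> I"
    and mult_I: "f \<in> I \<Longrightarrow> g * f \<in> I"
begin

lemma diff_I: "f \<in> I \<Longrightarrow> g \<in> I \<Longrightarrow> f - g \<in> I"
  using add_I[OF _ mult_I[of g "- 1"], of f] by simp

lemma sum_I: "(\<And>x. x \<in> S \<Longrightarrow> f x \<in> I) \<Longrightarrow> sum f S \<in> I"
  by (induction S rule: infinite_finite_induct) (auto intro: zero_I add_I)

text \<open>Induction on the generators: in the relation for \<open>b\<close> the coefficient 1 -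
  \<open>h b\<close> is a unit, so \<open>b\<close> can be solved for and substituted into the other
  relations, whose coefficients stay in the maximal ideal.\<close>

lemma nakayama:
  assumes "finite B"
    and "\<And>b. b \<in> B \<Longrightarrow> \<exists>i\<in>I. \<exists>h. (\<forall>x\<in>B. h x \<in> mfps_max) \<and> b = i + (\<Sum>x\<in>B. h x * x)"
  shows "B \<subseteq> I"
  using assms
proof (induction B rule: finite_induct)
  case (insert b B)
  note max = mfps_ge_mult_left[of _ 1, folded mfps_max_eq] mfps_ge_add[of _ 1, folded mfps_max_eq]
  obtain i h where b: "i \<in> I" "\<And>x. x \<in> insert b B \<Longrightarrow> h x \<in> mfps_max"
    "b = i + (\<Sum>x\<in>insert b B. h x * x)"
    using insert.prems[of b] by auto
  obtain k where k: "(1 - h b) * k = 1" using one_minus_unit b(2) by blast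
  have "b = i + (h b * b + (\<Sum>x\<in>B. h x * x))"
    using b(3) unfolding sum.insert[OF insert.hyps] .
  then have "(1 - h b) * b = i + (\<Sum>x\<in>B. h x * x)"
    unfolding left_diff_distrib mult_1 diff_eq_eq by (simp only: add_ac)
  then have "k * ((1 - h b) * b) = k * i + (\<Sum>x\<in>B. k * h x * x)"
    by (simp add: distrib_left sum_distrib_left mult.assoc)
  moreover have "k * ((1 - h b) * b) = b"
    using k by (metis mult.assoc mult.commute mult_1)
  ultimately have eq_b: "b = k * i + (\<Sum>x\<in>B. k * h x * x)" by simp
  have "B \<subseteq> I"
  proof (rule insert.IH)
    fix c assume "c \<in> B"
    then obtain i' h' where c: "i' \<in> I" "\<And>x. x \<in> insert b B \<Longrightarrow> h' x \<in> mfps_max"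
      "c = i' + (\<Sum>x\<in>insert b B. h' x * x)"
      using insert.prems[of c] by auto
    have "c = i' + h' b * b + (\<Sum>x\<in>B. h' x * x)"
      using c(3) insert.hyps by (simp add: add.assoc)
    also have "h' b * b = h' b * (k * i) + (\<Sum>x\<in>B. h' b * (k * h x * x))"
      by (subst eq_b) (simp add: distrib_left sum_distrib_left)
    finally have "c = (i' + h' b * (k * i)) + (\<Sum>x\<in>B. (h' x + h' b * k * h x) * x)"
      by (simp add: algebra_simps sum.distrib)
    moreover have "i' + h' b * (k * i) \<in> I" by (intro add_I mult_I b c)
    moreover have "\<forall>x\<in>B. h' x + h' b * k * h x \<in> mfps_max"
      using b(2) c(2) by (auto intro!: max)
    ultimately show "\<exists>i\<in>I. \<exists>h. (\<forall>x\<in>B. h x \<in> mfps_max) \<and> c = i + (\<Sum>x\<in>B. h x * x)"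
      by (intro bexI[of _ "i' + h' b * (k * i)"] exI[of _ "\<lambda>x. h' x + h' b * k * h x"] conjI)
  qed
  moreover from this have "b \<in> I"
    by (subst eq_b) (auto intro!: add_I mult_I sum_I b)
  ultimately show ?case by simp
qed simp

end

lemma mcoeff_mult_mpow_mvars: "mcoeff (g * mpow mvars \<alpha>) (\<delta> + \<alpha>) = mcoeff g \<delta>"
proof -
  have "(\<Sum>(\<beta>, \<epsilon>) | \<beta> + \<epsilon> = \<delta> + \<alpha>. mcoeff g \<beta> * mcoeff (mpow mvars \<alpha>) \<epsilon>) =
        (\<Sum>(\<beta>, \<epsilon>) \<in> {(\<delta>, \<alpha>)}. mcoeff g \<beta> * mcoeff (mpow mvars \<alpha>) \<epsilon>)"
    by (rule sum.mono_neutral_right) (auto simp: mcoeff_mpow_mvars split: if_splits)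
  then show ?thesis by (simp add: mcoeff_mult mcoeff_mpow_mvars)
qed

lemma mcoeff_mult_mpow_mvars_0:
  "(\<And>\<delta>. \<gamma> \<noteq> \<delta> + \<alpha>) \<Longrightarrow> mcoeff (g * mpow mvars \<alpha>) \<gamma> = 0"
  unfolding mcoeff_mult by (rule sum.neutral) (auto simp: mcoeff_mpow_mvars)

lemma multiindex_below:
  assumes "j \<le> mdeg \<gamma>" obtains \<alpha> \<delta> where "\<gamma> = \<delta> + \<alpha>" "mdeg \<alpha> = j"
proof -
  have "\<exists>\<alpha> \<delta>. \<gamma> = \<delta> + \<alpha> \<and> mdeg \<alpha> = j"
    using assms
  proof (induction "mdeg \<gamma> - j" arbitrary: \<gamma>)
    case 0
    then show ?case by (intro exI[of _ \<gamma>] exI[of _ 0]) simp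
  next
    case (Suc n)
    then have "\<gamma> \<noteq> 0" by auto
    then obtain i \<beta> where \<gamma>: "\<gamma> = \<beta> + axis i 1" by (rule mdeg_axis_split)
    have "n = mdeg \<beta> - j" "j \<le> mdeg \<beta>" using Suc(2,3) by (auto simp: \<gamma>)
    from Suc(1)[OF this] obtain \<alpha> \<delta> where "\<beta> = \<delta> + \<alpha>" "mdeg \<alpha> = j" by blast
    then show ?case by (intro exI[of _ \<alpha>] exI[of _ "\<delta> + axis i 1"]) (simp add: \<gamma> add_ac)
  qed
  then show ?thesis using that by blast
qed

text \<open>Every monomial of degree at least \<open>j\<close> is assigned to one chosen divisor
  \<open>a \<gamma>\<close> of degree \<open>j\<close>, and \<open>g \<alpha>\<close> collects the
  quotients of those assigned to \<alpha>. Its free term is 0 or the coefficient of \<open>f\<close>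
  at \<alpha>, which vanishes if \<open>f\<close> has order above \<open>j\<close>.\<close>

lemma mfps_ge_generated:
  assumes f: "f \<in> mfps_ge j"
  obtains g where "f = (\<Sum>\<alpha> | mdeg \<alpha> = j. g \<alpha> * mpow mvars \<alpha>)"
    "\<And>\<alpha>. f \<in> mfps_ge (Suc j) \<Longrightarrow> mdeg \<alpha> = j \<Longrightarrow> g \<alpha> \<in> mfps_max"
proof -
  have "\<exists>\<alpha>. j \<le> mdeg \<gamma> \<longrightarrow> mdeg \<alpha> = j \<and> (\<exists>\<delta>. \<gamma> = \<delta> + \<alpha>)" for \<gamma> :: "nat ^ 'a"
  proof (cases "j \<le> mdeg \<gamma>")
    case True
    then obtain \<alpha> \<delta> where "\<gamma> = \<delta> + \<alpha>" "mdeg \<alpha> = j" by (rule multiindex_below)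
    then show ?thesis by blast
  qed simp
  then have "\<forall>\<gamma> :: nat ^ 'a. \<exists>\<alpha>. j \<le> mdeg \<gamma> \<longrightarrow> mdeg \<alpha> = j \<and> (\<exists>\<delta>. \<gamma> = \<delta> + \<alpha>)" by blast
  from choice[OF this] obtain a :: "nat ^ 'a \<Rightarrow> nat ^ 'a"
    where a: "\<And>\<gamma>. j \<le> mdeg \<gamma> \<Longrightarrow> mdeg (a \<gamma>) = j \<and> (\<exists>\<delta>. \<gamma> = \<delta> + a \<gamma>)"
    by blast
  define g where "g \<alpha> = Abs_mfps (\<lambda>\<delta>. if a (\<delta> + \<alpha>) = \<alpha> then mcoeff f (\<delta> + \<alpha>) else 0)" for \<alpha>
  have coeff: "mcoeff (g \<alpha> * mpow mvars \<alpha>) \<gamma> = (if \<alpha> = a \<gamma> then mcoeff f \<gamma> else 0)"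
    if "mdeg \<alpha> = j" for \<alpha> \<gamma>
  proof (cases "\<exists>\<delta>. \<gamma> = \<delta> + \<alpha>")
    case True
    then obtain \<delta> where \<delta>: "\<gamma> = \<delta> + \<alpha>" by blast
    show ?thesis unfolding \<delta> mcoeff_mult_mpow_mvars by (auto simp: g_def)
  next
    case False
    then have "mcoeff (g \<alpha> * mpow mvars \<alpha>) \<gamma> = 0" by (intro mcoeff_mult_mpow_mvars_0) blast
    moreover have "mcoeff f \<gamma> = 0" if "\<alpha> = a \<gamma>"
    proof -
      have "\<not> j \<le> mdeg \<gamma>" using a[of \<gamma>] False that by auto
      then show ?thesis by (intro mfps_geD[OF f]) simp
    qed
    ultimately show ?thesis by simp
  qed
  show ?thesis
  proof (rule that)
    show "f = (\<Sum>\<alpha> | mdeg \<alpha> = j. g \<alpha> * mpow mvars \<alpha>)"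
    proof (rule mfps_eqI)
      fix \<gamma>
      have "(\<Sum>\<alpha> | mdeg \<alpha> = j. mcoeff (g \<alpha> * mpow mvars \<alpha>) \<gamma>) =
          (\<Sum>\<alpha> | mdeg \<alpha> = j. if \<alpha> = a \<gamma> then mcoeff f \<gamma> else 0)"
        by (rule sum.cong) (simp_all add: coeff)
      also have "\<dots> = mcoeff f \<gamma>"
        using le_less_linear[of j "mdeg \<gamma>"] a[of \<gamma>] mfps_geD[OF f, of \<gamma>] by (auto simp: sum.delta)
      finally show "mcoeff f \<gamma> = mcoeff (\<Sum>\<alpha> | mdeg \<alpha> = j. g \<alpha> * mpow mvars \<alpha>) \<gamma>" by simp
    qed
    show "g \<alpha> \<in> mfps_max" if "f \<in> mfps_ge (Suc j)" "mdeg \<alpha> = j" for \<alpha>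
      using mfps_geD[OF that(1), of \<alpha>] that(2) by (simp add: mfps_max_def g_def)
  qed
qed

text \<open>Nakayama's lemma for the monomials of degree \<open>j\<close>, which generate
  \<open>mfps_ge j\<close>: modulo \<open>I\<close> each of them lies in
  \<open>mfps_ge (Suc j)\<close>.\<close>

lemma (in series_ideal) mfps_ge_subset_I:
  assumes "\<And>f. f \<in> mfps_ge j \<Longrightarrow> \<exists>i\<in>I. f - i \<in> mfps_ge (Suc j)"
  shows "mfps_ge j \<subseteq> I"
proof
  let ?N = "{\<alpha> :: nat ^ 'n. mdeg \<alpha> = j}"
  have inj: "inj_on (mpow mvars) ?N"
  proof (rule inj_onI)
    fix \<alpha> \<beta> :: "nat ^ 'n" assume "mpow mvars \<alpha> = mpow mvars \<beta>"
    then have "mcoeff (mpow mvars \<alpha>) \<alpha> = mcoeff (mpow mvars \<beta>) \<alpha>" by simp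
    then show "\<alpha> = \<beta>" by (simp add: mcoeff_mpow_mvars split: if_splits)
  qed
  have gens: "mpow mvars ` ?N \<subseteq> I"
  proof (rule nakayama)
    fix b assume "b \<in> mpow mvars ` ?N"
    then have "b \<in> mfps_ge j" using mpow_in_ge[of mvars] by auto
    from assms[OF this] obtain i where i: "i \<in> I" "b - i \<in> mfps_ge (Suc j)" by blast
    then have "b - i \<in> mfps_ge j" using mfps_ge_antimono by (metis le_SucI order_refl)
    then obtain g where g: "b - i = (\<Sum>\<alpha>\<in>?N. g \<alpha> * mpow mvars \<alpha>)" "\<And>\<alpha>. \<alpha> \<in> ?N \<Longrightarrow> g \<alpha> \<in> mfps_max"
      by (rule mfps_ge_generated) (use i(2) in blast)
    \<comment> \<open>In \<open>nakayama\<close> the coefficients are indexed by the generators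
      themselves, so \<open>g\<close> is transported along the injection from indices to
      monomials.\<close>
    define h where "h x = g (inv_into ?N (mpow mvars) x)" for x
    have h: "h (mpow mvars \<alpha>) = g \<alpha>" if "\<alpha> \<in> ?N" for \<alpha>
      using inv_into_f_f[OF inj that] by (simp add: h_def)
    have "b = i + (\<Sum>x\<in>mpow mvars ` ?N. h x * x)"
      using g(1) by (subst sum.reindex[OF inj]) (simp add: h algebra_simps)
    moreover have "\<forall>x\<in>mpow mvars ` ?N. h x \<in> mfps_max" using g(2) h by auto
    ultimately show "\<exists>i\<in>I. \<exists>h. (\<forall>x\<in>mpow mvars ` ?N. h x \<in> mfps_max) \<and>
        b = i + (\<Sum>x\<in>mpow mvars ` ?N. h x * x)"
      using i(1) by blast
  qed simp
  fix f :: "'n mfps" assume "f \<in> mfps_ge j"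
  then obtain g where "f = (\<Sum>\<alpha>\<in>?N. g \<alpha> * mpow mvars \<alpha>)" by (rule mfps_ge_generated) blast
  then show "f \<in> I" using gens by (auto intro!: sum_I mult_I)
qed


section \<open>Ideals of bounded codimension\<close>

text \<open>\<open>codim_at_most I k\<close> says \<open>dim (\<complex>[[x]] / (I + \<mm>\<^sup>k\<^sup>+\<^sup>1)) \<le> k\<close>; the truncation at order
  \<open>k + 1\<close> is harmless because the dimensions modulo \<open>\<mm>\<^sup>j\<close> increase strictly in \<open>j\<close> until they
  become stationary.\<close>

definition codim_at_most :: "'n::finite mfps set \<Rightarrow> nat \<Rightarrow> bool"
  where "codim_at_most I k \<longleftrightarrow> (\<exists>b :: nat \<Rightarrow> 'n mfps. \<forall>f. \<exists>w\<in>I. \<exists>c.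
    f - w - (\<Sum>i<k. mfps_const (c i) * b i) \<in> mfps_ge (Suc k))"

context series_ideal
begin

text \<open>If for every \<open>j\<close> up to \<open>k\<close> some \<open>f j\<close> of order at
  least \<open>j\<close> escaped I + m^(j+1), these k + 1 series would be independent modulo I +
  m^(k+1), a quotient spanned by \<open>k\<close> elements. So m^j is contained in I + m^(j+1) for
  some such \<open>j\<close>, hence in \<open>I\<close>.\<close>

lemma codim_at_most_mfps_ge:
  assumes "codim_at_most I k" shows "mfps_ge (Suc k) \<subseteq> I"
proof -
  obtain b :: "nat \<Rightarrow> 'n mfps" where b: "\<And>f. \<exists>w\<in>I. \<exists>c.
    f - w - (\<Sum>i<k. mfps_const (c i) * b i) \<in> mfps_ge (Suc k)"
    using assms unfolding codim_at_most_def by blast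
  have "\<exists>j\<le>k. \<forall>f\<in>mfps_ge j. \<exists>i\<in>I. f - i \<in> mfps_ge (Suc j)"
  proof (rule ccontr)
    assume "\<not> (\<exists>j\<le>k. \<forall>f\<in>mfps_ge j. \<exists>i\<in>I. f - i \<in> mfps_ge (Suc j))"
    then have "\<forall>j. \<exists>f. j \<le> k \<longrightarrow> f \<in> mfps_ge j \<and> (\<forall>i\<in>I. f - i \<notin> mfps_ge (Suc j))" by blast
    from choice[OF this] obtain f where f: "\<And>j. j \<le> k \<Longrightarrow> f j \<in> mfps_ge j"
      "\<And>j i. j \<le> k \<Longrightarrow> i \<in> I \<Longrightarrow> f j - i \<notin> mfps_ge (Suc j)"
      by blast
    have "\<forall>j. \<exists>w c. w \<in> I \<and> f j - w - (\<Sum>i<k. mfps_const (c i) * b i) \<in> mfps_ge (Suc k)"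
      using b by blast
    then obtain w c where wc: "\<And>j. w j \<in> I"
      "\<And>j. f j - w j - (\<Sum>i<k. mfps_const (c j i) * b i) \<in> mfps_ge (Suc k)"
      by metis
    \<comment> \<open>There are \<open>k + 1\<close> unknowns \<open>d j\<close> and only
      \<open>k\<close> equations, one for each \<open>b i\<close>.\<close>
    obtain d where d: "\<exists>j\<in>{..k}. d j \<noteq> 0" "\<forall>i\<in>{..<k}. (\<Sum>j\<le>k. d j * c j i) = 0"
      using underdetermined_system[of "{..<k}" "{..k}" c] by auto
    \<comment> \<open>At the least index with nonzero coefficient, the earlier terms are absent and
      the later ones have order above \<open>m\<close>; the relation thus puts \<open>f m\<close>
      into I + m^(m+1), where the base of the power is the maximal ideal.\<close>
    define m where "m = (LEAST j. j \<le> k \<and> d j \<noteq> 0)"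
    have m: "m \<le> k" "d m \<noteq> 0" using LeastI_ex[of "\<lambda>j. j \<le> k \<and> d j \<noteq> 0"] d(1) by (auto simp: m_def)
    have m_least: "d j = 0" if "j < m" for j
      using not_less_Least[of j "\<lambda>j. j \<le> k \<and> d j \<noteq> 0"] that m(1) by (auto simp: m_def)
    have const_sum: "mfps_const (sum q S) = (\<Sum>x\<in>S. mfps_const (q x))" for q and S :: "nat set"
      by (induction S rule: infinite_finite_induct) (auto simp: mfps_const_add)
    have "(\<Sum>j\<le>k. mfps_const (d j) * (\<Sum>i<k. mfps_const (c j i) * b i)) =
        (\<Sum>i<k. mfps_const (\<Sum>j\<le>k. d j * c j i) * b i)"
      by (simp add: sum_distrib_left sum_distrib_right const_sum mfps_const_mult mult.assoc
          sum.swap[of _ "{..k}"])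
    also have "\<dots> = 0" using d(2) by simp
    finally have vanish: "(\<Sum>j\<le>k. mfps_const (d j) * (\<Sum>i<k. mfps_const (c j i) * b i)) = 0" .
    define W where "W = (\<Sum>j\<le>k. mfps_const (d j) * w j)"
    have W: "W \<in> I" unfolding W_def by (intro sum_I mult_I wc)
    have "(\<Sum>j\<le>k. mfps_const (d j) * (f j - w j - (\<Sum>i<k. mfps_const (c j i) * b i))) \<in> mfps_ge (Suc k)"
      by (intro mfps_ge_sum mfps_ge_mult_left wc)
    then have "(\<Sum>j\<le>k. mfps_const (d j) * f j) - W \<in> mfps_ge (Suc k)"
      using vanish by (simp add: right_diff_distrib sum_subtractf W_def)
    then have 1: "(\<Sum>j\<le>k. mfps_const (d j) * f j) - W \<in> mfps_ge (Suc m)"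
      by (rule mfps_ge_antimono[rotated]) (use m(1) in simp)
    have "(\<Sum>j\<le>k. mfps_const (d j) * f j) = mfps_const (d m) * f m +
        (\<Sum>j\<in>{..k} - {m}. mfps_const (d j) * f j)"
      using m(1) by (intro sum.remove) auto
    moreover have 2: "(\<Sum>j\<in>{..k} - {m}. mfps_const (d j) * f j) \<in> mfps_ge (Suc m)"
    proof (rule mfps_ge_sum)
      fix j assume j: "j \<in> {..k} - {m}"
      show "mfps_const (d j) * f j \<in> mfps_ge (Suc m)"
      proof (cases "j < m")
        case False
        then have "Suc m \<le> j" using j by auto
        then show ?thesis using f(1)[of j] j
          by (intro mfps_ge_mult_left) (auto intro: mfps_ge_antimono)
      qed (simp add: m_least)
    qed
    ultimately have "mfps_const (d m) * f m - W \<in> mfps_ge (Suc m)"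
      using mfps_ge_diff[OF 1 2] by (simp add: algebra_simps)
    then have "mfps_const (1 / d m) * (mfps_const (d m) * f m - W) \<in> mfps_ge (Suc m)"
      by (rule mfps_ge_mult_left)
    moreover have "mfps_const (1 / d m) * (mfps_const (d m) * f m) = f m"
      using m(2) by (simp flip: mfps_const_mult mult.assoc)
    ultimately have "f m - mfps_const (1 / d m) * W \<in> mfps_ge (Suc m)"
      by (simp add: right_diff_distrib)
    then show False using f(2)[OF m(1) mult_I[OF W]] by blast
  qed
  then obtain j where j: "j \<le> k" "\<And>f. f \<in> mfps_ge j \<Longrightarrow> \<exists>i\<in>I. f - i \<in> mfps_ge (Suc j)" by blast
  have "mfps_ge j \<subseteq> I" by (rule mfps_ge_subset_I) (rule j)
  then show ?thesis using mfps_ge_antimono[of j "Suc k"] j(1) by auto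
qed

end


section \<open>The dimension of the quotient ring\<close>

lemma series_ideal_of_ideal:
  assumes "ideal I mfps_ring" shows "series_ideal I"
proof
  interpret ideal I mfps_ring by fact
  show "0 \<in> I" using zero_closed by (simp add: cring_class_ops_def)
  show "f + g \<in> I" if "f \<in> I" "g \<in> I" for f g
    using a_closed[OF that] by (simp add: cring_class_ops_def)
  show "g * f \<in> I" if "f \<in> I" for f g
    using I_l_closed[OF that, of g] by (simp add: cring_class_ops_def)
qed

lemma (in series_ideal) ideal_I: "ideal I mfps_ring"
proof (rule idealI)
  show "ring (mfps_ring :: 'n mfps ring)"
    by (rule cring.axioms(1)[OF cring_class])
  show "subgroup I (add_monoid mfps_ring)"
  proof
    fix x assume x: "x \<in> I"
    have "inv\<^bsub>add_monoid mfps_ring\<^esub> x = - x"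
      using uminus_class[of x] by (simp add: a_inv_def)
    then show "inv\<^bsub>add_monoid mfps_ring\<^esub> x \<in> I"
      using diff_I[OF zero_I x] by simp
  qed (auto simp: cring_class_ops_def zero_I add_I)
  show "x \<otimes>\<^bsub>mfps_ring\<^esub> a \<in> I" "a \<otimes>\<^bsub>mfps_ring\<^esub> x \<in> I" if "a \<in> I" for a x
    using mult_I[OF that, of x] by (simp_all add: times_class mult.commute)
qed

locale series_quotient = series_ideal I for I :: "'n::finite mfps set"
begin

abbreviation icoset :: "'n mfps \<Rightarrow> 'n mfps set"
  where "icoset f \<equiv> I +>\<^bsub>mfps_ring\<^esub> f"

abbreviation Q :: "'n mfps set ring"
  where "Q \<equiv> mfps_ring Quot I"

abbreviation K :: "'n mfps set set"
  where "K \<equiv> range (\<lambda>c. icoset (mfps_const c))"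

lemma icoset_def: "icoset f = {h + f | h. h \<in> I}"
  by (auto simp: a_r_coset_def' cring_class_ops_def)

lemma icoset_eq_iff: "icoset f = icoset g \<longleftrightarrow> f - g \<in> I"
proof
  assume "icoset f = icoset g"
  moreover have "f \<in> icoset f" using zero_I by (force simp: icoset_def)
  ultimately obtain h where "h \<in> I" "f = h + g" by (auto simp: icoset_def)
  then show "f - g \<in> I" by simp
next
  assume fg: "f - g \<in> I"
  have "h + f \<in> icoset g" if "h \<in> I" for h
    using add_I[OF that fg] unfolding icoset_def by (intro CollectI exI[of _ "h + (f - g)"]) simp
  moreover have "h + g \<in> icoset f" if "h \<in> I" for h
    using diff_I[OF that fg] unfolding icoset_def by (intro CollectI exI[of _ "h - (f - g)"]) simp
  ultimately show "icoset f = icoset g" by (auto simp: icoset_def[of f] icoset_def[of g])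
qed

lemma ring_Q: "ring Q"
  by (rule ideal.quotient_is_ring[OF ideal_I])

sublocale Q: ring Q
  by (rule ring_Q)

lemma hom: "(+>\<^bsub>mfps_ring\<^esub>) I \<in> ring_hom mfps_ring Q"
  by (rule ideal.rcos_ring_hom[OF ideal_I])

lemma icoset_add: "icoset f \<oplus>\<^bsub>Q\<^esub> icoset g = icoset (f + g)"
  using ring_hom_add[OF hom, of f g] by (simp add: cring_class_ops_def)

lemma icoset_mult: "icoset f \<otimes>\<^bsub>Q\<^esub> icoset g = icoset (f * g)"
  using ring_hom_mult[OF hom, of f g] by (simp add: cring_class_ops_def)

lemma icoset_one: "\<one>\<^bsub>Q\<^esub> = icoset 1"
  using ring_hom_one[OF hom] by (simp add: cring_class_ops_def)

lemma icoset_zero: "\<zero>\<^bsub>Q\<^esub> = icoset 0"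
  by (simp add: FactRing_def icoset_def)

lemma carrier_Q: "carrier Q = range icoset"
  by (auto simp: FactRing_def A_RCOSETS_def' cring_class_ops_def)

definition coset_span :: "nat \<Rightarrow> (nat \<Rightarrow> 'n mfps) \<Rightarrow> 'n mfps set set"
  where "coset_span n b = range (\<lambda>c. icoset (\<Sum>i<n. mfps_const (c i) * b i))"

lemma coset_span_0: "coset_span 0 b = {\<zero>\<^bsub>Q\<^esub>}"
  by (simp add: coset_span_def icoset_zero)

lemma coset_span_cong: "(\<And>i. i < n \<Longrightarrow> b i = b' i) \<Longrightarrow> coset_span n b = coset_span n b'"
  by (simp add: coset_span_def)

lemma coset_span_Suc: "coset_span (Suc n) b = Q.line_extension K (icoset (b n)) (coset_span n b)"
proof -
  have "Q.line_extension K (icoset (b n)) (coset_span n b) =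
      {icoset (mfps_const a * b n + (\<Sum>i<n. mfps_const (c i) * b i)) | a c. True}"
    by (auto simp: Q.line_extension_def set_add_def' r_coset_def coset_span_def icoset_mult icoset_add)
  also have "\<dots> = coset_span (Suc n) b"
  proof (intro equalityI subsetI)
    fix x assume "x \<in> {icoset (mfps_const a * b n + (\<Sum>i<n. mfps_const (c i) * b i)) | a c. True}"
    then obtain a c where x: "x = icoset (mfps_const a * b n + (\<Sum>i<n. mfps_const (c i) * b i))"
      by blast
    have "x = icoset (\<Sum>i<Suc n. mfps_const ((c(n := a)) i) * b i)"
      by (simp add: x add.commute)
    then show "x \<in> coset_span (Suc n) b" unfolding coset_span_def by blast
  next
    fix x assume "x \<in> coset_span (Suc n) b"
    then obtain c where "x = icoset (\<Sum>i<Suc n. mfps_const (c i) * b i)" by (auto simp: coset_span_def)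
    then have "x = icoset (mfps_const (c n) * b n + (\<Sum>i<n. mfps_const (c i) * b i))"
      by (simp add: add.commute)
    then show "x \<in> {icoset (mfps_const a * b n + (\<Sum>i<n. mfps_const (c i) * b i)) | a c. True}"
      by blast
  qed
  finally show ?thesis by simp
qed

lemma dimension_imp_coset_span: "Q.dimension n K E \<Longrightarrow> \<exists>b. E = coset_span n b"
proof (induction n K\<equiv>K E rule: Q.dimension.induct)
  case zero_dim
  then show ?case by (simp add: coset_span_0)
next
  case (Suc_dim v E n)
  then obtain b where b: "E = coset_span n b" by auto
  obtain f where f: "v = icoset f" using Suc_dim(1) by (auto simp: carrier_Q)
  have "Q.line_extension K v E = coset_span (Suc n) (b(n := f))"
    using coset_span_cong[of n "b(n := f)" b] by (simp add: coset_span_Suc b f)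
  then show ?case by blast
qed

text \<open>Each further spanning element either extends the span by a line or already lies in it
  and is dropped, which gives \<open>m \<le> n\<close>.\<close>

lemma coset_span_dimension: "\<exists>m\<le>n. Q.dimension m K (coset_span n b)"
proof (induction n)
  case 0
  then show ?case using Q.zero_dim by (auto simp: coset_span_0)
next
  case (Suc n)
  then obtain m where m: "m \<le> n" "Q.dimension m K (coset_span n b)" by blast
  show ?case
  proof (cases "icoset (b n) \<in> coset_span n b")
    case True
    then obtain c where c: "icoset (b n) = icoset (\<Sum>i<n. mfps_const (c i) * b i)"
      by (auto simp: coset_span_def)
    have "coset_span (Suc n) b = coset_span n b"
    proof (intro equalityI subsetI)
      fix x assume "x \<in> coset_span (Suc n) b"
      then obtain d where d: "x = icoset (\<Sum>i<Suc n. mfps_const (d i) * b i)"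
        by (auto simp: coset_span_def)
      have "mfps_const (d n) * (b n - (\<Sum>i<n. mfps_const (c i) * b i)) \<in> I"
        using c by (intro mult_I) (simp add: icoset_eq_iff)
      then have "x = icoset (\<Sum>i<n. mfps_const (d i + d n * c i) * b i)"
        unfolding d icoset_eq_iff
        by (simp add: mfps_const_add mfps_const_mult algebra_simps sum.distrib sum_distrib_left)
      then show "x \<in> coset_span n b" by (auto simp: coset_span_def)
    next
      fix x assume "x \<in> coset_span n b"
      then obtain d where d: "x = icoset (\<Sum>i<n. mfps_const (d i) * b i)"
        by (auto simp: coset_span_def)
      have "x = icoset (\<Sum>i<Suc n. mfps_const ((d(n := 0)) i) * b i)" by (simp add: d)
      then show "x \<in> coset_span (Suc n) b" unfolding coset_span_def by blast
    qed
    then show ?thesis using m by (intro exI[of _ m]) simp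
  next
    case False
    have "Q.dimension (Suc m) K (coset_span (Suc n) b)"
      unfolding coset_span_Suc by (rule Q.Suc_dim[OF _ False m(2)]) (simp add: carrier_Q)
    then show ?thesis using m(1) by (intro exI[of _ "Suc m"]) simp
  qed
qed

text \<open>Justifies the definite description in \<open>codim\<close>. Invariance of dimension
  applies when \<open>K\<close> is a field, which fails for the unit ideal; there the quotient is
  zero and no line extension is possible, as every coset already lies in each span.\<close>

lemma dimension_carrier_unique:
  assumes "Q.dimension n K (carrier Q)" "Q.dimension m K (carrier Q)"
  shows "n = m"
proof (cases "1 \<in> I")
  case True
  have UNIV: "f \<in> I" for f using mult_I[OF True, of f] by simp
  have all_eq: "icoset f = icoset g" for f g by (simp add: icoset_eq_iff UNIV)
  have "k = 0" if "Q.dimension k K E" for k E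
    using that
  proof (cases rule: Q.dimension.cases)
    case (Suc_dim v E' l)
    obtain b where b: "E' = coset_span l b" using dimension_imp_coset_span[OF Suc_dim(5)] by blast
    obtain f where f: "v = icoset f" using Suc_dim(3) by (auto simp: carrier_Q)
    have "v = icoset (\<Sum>i<l. mfps_const ((\<lambda>_. 0) i) * b i)" unfolding f by (rule all_eq)
    then have "v \<in> E'" unfolding b coset_span_def by (intro image_eqI[of _ _ "\<lambda>_. 0"]) simp_all
    then show ?thesis using Suc_dim by simp
  qed
  then show ?thesis using assms by metis
next
  case False
  let ?h = "\<lambda>c. icoset (mfps_const c)"
  have "?h \<in> ring_hom (cring_class_ops :: complex ring) Q"
    by (rule ring_hom_memI)
      (simp_all only: plus_class times_class one_class carrier_Q icoset_mult icoset_add icoset_one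
        mfps_const_mult mfps_const_add mfps_const_1 rangeI)
  then interpret h: ring_hom_ring "cring_class_ops :: complex ring" Q ?h
    by (intro ring_hom_ringI2 Q.ring_axioms cring.axioms(1)[OF cring_class])
  have "subfield (UNIV :: complex set) cring_class_ops"
    using field.carrier_is_subfield[OF field_class[where ?'a = complex]]
    by (simp add: cring_class_ops_def)
  moreover have "\<one>\<^bsub>Q\<^esub> \<noteq> \<zero>\<^bsub>Q\<^esub>"
    using False by (simp add: icoset_one icoset_zero icoset_eq_iff)
  ultimately have "subfield K Q" by (rule h.img_is_subfield(2))
  then show ?thesis using assms by (rule Q.dimension_is_inj)
qed

lemma codim_eq_quot_dim:
  assumes n: "quot_dim I n" shows "codim I = enat n"
proof -
  have "(THE n. quot_dim I n) = n"
    using n dimension_carrier_unique by (intro the_equality) (auto simp: quot_dim_def)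
  moreover have "codim I = enat (THE n. quot_dim I n)"
    using n by (auto simp: codim_def)
  ultimately show ?thesis by simp
qed

lemma codim_le_iff: "codim I \<le> enat k \<longleftrightarrow> codim_at_most I k"
proof
  assume le: "codim I \<le> enat k"
  have "\<exists>n. quot_dim I n"
  proof (rule ccontr)
    assume "\<nexists>n. quot_dim I n"
    then have "codim I = \<infinity>" by (simp add: codim_def)
    with le show False by simp
  qed
  then obtain n where n: "quot_dim I n" by blast
  then have "n \<le> k" using le by (simp add: codim_eq_quot_dim)
  obtain b where b: "carrier Q = coset_span n b"
    using dimension_imp_coset_span n unfolding quot_dim_def by blast
  have "\<exists>w\<in>I. \<exists>c. f - w - (\<Sum>i<k. mfps_const (c i) * b i) \<in> mfps_ge (Suc k)" for f
  proof -
    have "icoset f \<in> coset_span n b" by (simp add: carrier_Q flip: b)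
    then obtain c where "icoset f = icoset (\<Sum>i<n. mfps_const (c i) * b i)" by (auto simp: coset_span_def)
    then have w: "f - (\<Sum>i<n. mfps_const (c i) * b i) \<in> I" (is "?w \<in> I") by (simp add: icoset_eq_iff)
    \<comment> \<open>The \<open>n\<close> spanning elements are padded to \<open>k\<close> terms by
      zero coefficients.\<close>
    have "(\<Sum>i<k. mfps_const (if i < n then c i else 0) * b i) = (\<Sum>i<n. mfps_const (c i) * b i)"
      using \<open>n \<le> k\<close> by (intro sum.mono_neutral_cong_right) auto
    then have "f - ?w - (\<Sum>i<k. mfps_const (if i < n then c i else 0) * b i) \<in> mfps_ge (Suc k)"
      by simp
    then show ?thesis by (intro bexI[OF _ w] exI[of _ "\<lambda>i. if i < n then c i else 0"])
  qed
  then show "codim_at_most I k" unfolding codim_at_most_def by blast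
next
  assume cod: "codim_at_most I k"
  then obtain b where b: "\<And>f. \<exists>w\<in>I. \<exists>c. f - w - (\<Sum>i<k. mfps_const (c i) * b i) \<in> mfps_ge (Suc k)"
    unfolding codim_at_most_def by blast
  have "icoset f \<in> coset_span k b" for f
  proof -
    obtain w c where w: "w \<in> I" "f - w - (\<Sum>i<k. mfps_const (c i) * b i) \<in> mfps_ge (Suc k)"
      using b by blast
    \<comment> \<open>The truncation error is absorbed by the ideal, so the span is exact and not
      only modulo order \<open>Suc k\<close>.\<close>
    then have "f - w - (\<Sum>i<k. mfps_const (c i) * b i) \<in> I"
      using codim_at_most_mfps_ge[OF cod] by blast
    from add_I[OF this w(1)] have "icoset f = icoset (\<Sum>i<k. mfps_const (c i) * b i)"
      by (simp add: icoset_eq_iff algebra_simps)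
    then show ?thesis by (auto simp: coset_span_def)
  qed
  then have "carrier Q = coset_span k b" by (auto simp: carrier_Q coset_span_def)
  then obtain m where m: "m \<le> k" "quot_dim I m"
    using coset_span_dimension[of k b] by (auto simp: quot_dim_def)
  then show "codim I \<le> enat k" by (simp add: codim_eq_quot_dim)
qed

end

lemma codim_le_iff_codim_at_most:
  "ideal I mfps_ring \<Longrightarrow> codim I \<le> enat k \<longleftrightarrow> codim_at_most I k"
  by (rule series_quotient.codim_le_iff) (simp add: series_quotient_def series_ideal_of_ideal)


section \<open>Families of ideals\<close>

lemma series_ring_genideal:
  fixes S :: "'n::finite mfps set"
  shows "ideal (Idl\<^bsub>mfps_ring\<^esub> S) mfps_ring" and "S \<subseteq> Idl\<^bsub>mfps_ring\<^esub> S"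
    and "series_ideal J \<Longrightarrow> S \<subseteq> J \<Longrightarrow> Idl\<^bsub>mfps_ring\<^esub> S \<subseteq> J"
proof -
  have R: "ring (mfps_ring :: 'n mfps ring)"
    by (rule cring.axioms(1)[OF cring_class])
  have S: "S \<subseteq> carrier mfps_ring" by (simp add: cring_class_ops_def)
  show "ideal (Idl\<^bsub>mfps_ring\<^esub> S) mfps_ring" by (rule ring.genideal_ideal[OF R S])
  show "S \<subseteq> Idl\<^bsub>mfps_ring\<^esub> S" by (rule ring.genideal_self[OF R S])
  show "Idl\<^bsub>mfps_ring\<^esub> S \<subseteq> J" if "series_ideal J" "S \<subseteq> J"
    by (rule ring.genideal_minimal[OF R series_ideal.ideal_I[OF that(1)] that(2)])
qed

definition joint_ideal :: "'n::finite mfps ^ 'n \<Rightarrow> 'n mfps set \<Rightarrow> 'n mfps set \<Rightarrow> 'n mfps set"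
  where "joint_ideal F X Y = Idl\<^bsub>mfps_ring\<^esub> (preimage F X \<union> Y)"

lemma intersection_mult_preimage: "intersection_mult (preimage F X) Y = codim (joint_ideal F X Y)"
  by (simp add: intersection_mult_def joint_ideal_def)

lemma series_ideal_joint_ideal: "series_ideal (joint_ideal F X Y)"
  unfolding joint_ideal_def by (intro series_ideal_of_ideal series_ring_genideal)

lemma codim_joint_ideal_le_iff: "codim (joint_ideal F X Y) \<le> enat k \<longleftrightarrow> codim_at_most (joint_ideal F X Y) k"
  unfolding joint_ideal_def by (intro codim_le_iff_codim_at_most series_ring_genideal)

context function_algebra
begin

text \<open>The values at \<open>s0\<close> of sections form an ideal. It contains the generators,
  since \<open>pullback (g s) h\<close> varies within the algebra and elements of \<open>Y\<close>
  extend as constants; by minimality it contains the whole joint ideal.\<close>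

lemma joint_ideal_section:
  fixes g :: "'s \<Rightarrow> 'n::finite mfps ^ 'n"
  assumes g: "\<And>i. series_in (\<lambda>s. g s $ i)"
    and f: "f \<in> joint_ideal (g s0) X Y"
  obtains w where "series_in w" "\<And>s. w s \<in> joint_ideal (g s) X Y" "w s0 = f"
proof -
  interpret J: series_ideal "joint_ideal (g s) X Y" for s by (rule series_ideal_joint_ideal)
  define U where "U = {w. series_in w \<and> (\<forall>s. w s \<in> joint_ideal (g s) X Y)}"
  let ?E = "(\<lambda>w. w s0) ` U"
  have gens: "pullback (g s) ` X \<union> Y \<subseteq> joint_ideal (g s) X Y" for s
    unfolding joint_ideal_def preimage_def by (rule series_ring_genideal)
  have "series_ideal ?E"
  proof
    have "(\<lambda>_. 0) \<in> U" by (simp add: U_def series_in_const J.zero_I)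
    then show "0 \<in> ?E" by (intro image_eqI[of _ _ "\<lambda>_. 0"]) simp_all
    show "x + y \<in> ?E" if "x \<in> ?E" "y \<in> ?E" for x y
    proof -
      from that obtain v w where "v \<in> U" "w \<in> U" "x = v s0" "y = w s0" by blast
      then show ?thesis
        by (intro image_eqI[of _ _ "\<lambda>s. v s + w s"]) (simp_all add: U_def series_in_add J.add_I)
    qed
    show "y * x \<in> ?E" if "x \<in> ?E" for x y
    proof -
      from that obtain w where "w \<in> U" "x = w s0" by blast
      then show ?thesis
        by (intro image_eqI[of _ _ "\<lambda>s. y * w s"])
          (simp_all add: U_def series_in_mult series_in_const J.mult_I)
    qed
  qed
  moreover have "preimage (g s0) X \<union> Y \<subseteq> ?E"
  proof
    fix x assume "x \<in> preimage (g s0) X \<union> Y"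
    then consider h where "h \<in> X" "x = pullback (g s0) h" | "x \<in> Y" by (auto simp: preimage_def)
    then show "x \<in> ?E"
    proof cases
      case 1
      have "(\<lambda>s. pullback (g s) h) \<in> U"
        using 1(1) gens by (auto simp: U_def intro!: series_in_pullback g series_in_const)
      with 1 show ?thesis by (intro image_eqI[of _ _ "\<lambda>s. pullback (g s) h"]) simp_all
    next
      case 2
      then have "(\<lambda>_. x) \<in> U" using gens by (auto simp: U_def series_in_const)
      then show ?thesis by (intro image_eqI[of _ _ "\<lambda>_. x"]) simp_all
    qed
  qed
  ultimately have "joint_ideal (g s0) X Y \<subseteq> ?E"
    unfolding joint_ideal_def by (rule series_ring_genideal)
  with f obtain w where "w \<in> U" "w s0 = f" by blast
  then show ?thesis by (intro that[of w]) (auto simp: U_def)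
qed

text \<open>The elements \<open>b\<close> that work at \<open>s0\<close> are kept. The claim becomes
  openness of surjectivity for the map that sends a section and coefficients c_i to the finitely
  many coefficients of w + sum c_i b_i below degree \<open>Suc k\<close>.\<close>

lemma codim_at_most_open:
  fixes g :: "'s \<Rightarrow> 'n::finite mfps ^ 'n"
  assumes g: "\<And>i. series_in (\<lambda>s. g s $ i)"
    and cod: "codim_at_most (joint_ideal (g s0) X Y) k"
  shows "\<exists>\<phi>\<in>A. \<phi> s0 \<noteq> 0 \<and> (\<forall>s. \<phi> s \<noteq> 0 \<longrightarrow> codim_at_most (joint_ideal (g s) X Y) k)"
proof -
  interpret J: series_ideal "joint_ideal (g s) X Y" for s by (rule series_ideal_joint_ideal)
  obtain b where b: "\<And>f. \<exists>w\<in>joint_ideal (g s0) X Y. \<exists>c.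
      f - w - (\<Sum>i<k. mfps_const (c i) * b i) \<in> mfps_ge (Suc k)"
    using cod unfolding codim_at_most_def by blast
  define U where "U = {w. series_in w \<and> (\<forall>s. w s \<in> joint_ideal (g s) X Y)}"
  define z where "z w c s \<gamma> = mcoeff (w s) \<gamma> + (\<Sum>i<k. c i s * mcoeff (b i) \<gamma>)"
    for w :: "'s \<Rightarrow> 'n mfps" and c s \<gamma>
  define W where "W = {z w c | w c. w \<in> U \<and> (\<forall>i. c i \<in> A)}"
  let ?\<Delta> = "{\<gamma> :: nat ^ 'n. mdeg \<gamma> < Suc k}"
  have "\<exists>\<phi>\<in>A. \<phi> s0 \<noteq> 0 \<and> (\<forall>s. \<phi> s \<noteq> 0 \<longrightarrow> (\<forall>f. \<exists>w\<in>W. \<forall>\<gamma>\<in>?\<Delta>. w s \<gamma> = f \<gamma>))"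
  proof (rule surjective_open[OF function_algebra_axioms finite_mdeg_less])
    fix x y p q assume x: "x \<in> W" and y: "y \<in> W" and pq: "p \<in> A" "q \<in> A"
    obtain v c w d where *: "x = z v c" "v \<in> U" "\<forall>i. c i \<in> A" "y = z w d" "w \<in> U" "\<forall>i. d i \<in> A"
      using x y by (auto simp: W_def)
    let ?u = "\<lambda>s. mfps_const (p s) * v s + mfps_const (q s) * w s"
    let ?e = "\<lambda>i s. p s * c i s + q s * d i s"
    have "(\<lambda>s \<gamma>. p s * x s \<gamma> + q s * y s \<gamma>) = z ?u ?e"
      by (simp add: * z_def fun_eq_iff distrib_left distrib_right sum.distrib sum_distrib_left mult.assoc add_ac)
    moreover have "?u \<in> U"
      using * pq by (simp add: U_def series_in_add series_in_scale J.add_I J.mult_I)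
    moreover have "\<forall>i. ?e i \<in> A" using * pq by (simp add: add_in mult_in)
    ultimately show "(\<lambda>s \<gamma>. p s * x s \<gamma> + q s * y s \<gamma>) \<in> W" unfolding W_def by blast
  next
    fix w \<gamma> assume "w \<in> W"
    then obtain v c where "w = z v c" "v \<in> U" "\<forall>i. c i \<in> A" by (auto simp: W_def)
    then show "(\<lambda>s. w s \<gamma>) \<in> A"
      by (auto simp: z_def U_def intro!: add_in sum_in mult_in const_in series_inD)
  next
    fix f
    obtain h c where h: "h \<in> joint_ideal (g s0) X Y"
      "Abs_mfps f - h - (\<Sum>i<k. mfps_const (c i) * b i) \<in> mfps_ge (Suc k)"
      using b by blast
    obtain w where w: "series_in w" "\<And>s. w s \<in> joint_ideal (g s) X Y" "w s0 = h"
      using joint_ideal_section[OF g h(1)] by blast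
    have "w \<in> U" "\<forall>i. (\<lambda>_. c i) \<in> A" using w by (simp_all add: U_def const_in)
    then have "z w (\<lambda>i _. c i) \<in> W" unfolding W_def by blast
    moreover have "\<forall>\<gamma>\<in>?\<Delta>. z w (\<lambda>i _. c i) s0 \<gamma> = f \<gamma>"
    proof
      fix \<gamma> assume "\<gamma> \<in> ?\<Delta>"
      then show "z w (\<lambda>i _. c i) s0 \<gamma> = f \<gamma>"
        using mfps_geD[OF h(2), of \<gamma>] by (simp add: z_def w(3) diff_eq_eq add.commute)
    qed
    ultimately show "\<exists>w\<in>W. \<forall>\<gamma>\<in>?\<Delta>. w s0 \<gamma> = f \<gamma>" by blast
  qed
  then obtain \<phi> where \<phi>: "\<phi> \<in> A" "\<phi> s0 \<noteq> 0"
    "\<And>s f. \<phi> s \<noteq> 0 \<Longrightarrow> \<exists>w\<in>W. \<forall>\<gamma>\<in>?\<Delta>. w s \<gamma> = f \<gamma>"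
    by blast
  have "codim_at_most (joint_ideal (g s) X Y) k" if s: "\<phi> s \<noteq> 0" for s
    unfolding codim_at_most_def
  proof (intro exI[of _ b] allI)
    fix f
    obtain x where "x \<in> W" and x: "\<forall>\<gamma>\<in>?\<Delta>. x s \<gamma> = mcoeff f \<gamma>" using \<phi>(3)[OF s] by blast
    then obtain w c where w: "w \<in> U" "x = z w c" by (auto simp: W_def)
    have "f - w s - (\<Sum>i<k. mfps_const (c i s) * b i) \<in> mfps_ge (Suc k)"
      using x by (auto simp: mfps_ge_def w(2) z_def diff_diff_add)
    moreover have "w s \<in> joint_ideal (g s) X Y" using w(1) by (simp add: U_def)
    ultimately show "\<exists>w\<in>joint_ideal (g s) X Y. \<exists>c. f - w - (\<Sum>i<k. mfps_const (c i) * b i) \<in> mfps_ge (Suc k)"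
      by (intro bexI[of _ "w s"] exI[of _ "\<lambda>i. c i s"])
  qed
  with \<phi>(1,2) show ?thesis by blast
qed

end

lemma multiplicity_bounded_of_falg:
  fixes g :: "'s \<Rightarrow> 'n::finite mfps ^ 'n"
  assumes "finite B" and coeffs: "\<And>i \<gamma>. (\<lambda>s. mcoeff (g s $ i) \<gamma>) \<in> falg B"
  shows "\<exists>m. \<forall>s. codim (joint_ideal (g s) X Y) < \<infinity> \<longrightarrow> codim (joint_ideal (g s) X Y) \<le> enat m"
proof -
  obtain A where A: "function_algebra A" "B \<subseteq> A" "subring_set A" "subring_set.noetherian A"
    using noetherian_function_algebra[OF assms(1)] by blast
  interpret function_algebra A by (rule A)
  have g: "series_in (\<lambda>s. g s $ i)" for i
    unfolding series_in_def using falg_reparam[OF coeffs, of "\<lambda>s. s"] A(2) by blast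
  let ?I = "\<lambda>s. joint_ideal (g s) X Y"
  define Z where "Z k = {s. \<not> codim (?I s) \<le> enat k}" for k
  have "\<exists>N. \<forall>n\<ge>N. Z n = Z N"
  proof (rule zero_sets_stabilise[OF A(3,4)])
    show "Z (Suc n) \<subseteq> Z n" for n
    proof
      fix s assume s: "s \<in> Z (Suc n)"
      have "enat n \<le> enat (Suc n)" by simp
      with s show "s \<in> Z n" unfolding Z_def using order_trans by blast
    qed
    fix n s assume "s \<notin> Z n"
    then have "codim_at_most (?I s) n" by (simp add: Z_def codim_joint_ideal_le_iff)
    from codim_at_most_open[OF g this]
    show "\<exists>\<phi>\<in>A. \<phi> s \<noteq> 0 \<and> (\<forall>z\<in>Z n. \<phi> z = 0)"
      unfolding Z_def codim_joint_ideal_le_iff by blast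
  qed
  then obtain N where N: "\<And>n. n \<ge> N \<Longrightarrow> Z n = Z N" by blast
  have "codim (?I s) \<le> enat N" if fin: "codim (?I s) < \<infinity>" for s
  proof -
    obtain j where j: "codim (?I s) = enat j" using fin by (rule less_infinityE)
    \<comment> \<open>Passing to \<open>max j N\<close> covers both j < N and j > N; an infinite
      multiplicity would keep \<open>s\<close> in every \<open>Z k\<close>.\<close>
    have "s \<notin> Z (max j N)" by (simp add: Z_def j)
    moreover have "Z (max j N) = Z N" by (rule N) simp
    ultimately have "s \<notin> Z N" by simp
    then show ?thesis by (simp add: Z_def)
  qed
  then show ?thesis by blast
qed


section \<open>Parametrising the group\<close>

text \<open>Stated for a commutative monoid \<open>M\<close> with the composition of
  \<open>formal_Diff\<close>, since \<open>finprod\<close> requires commutativity; it is applied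
  with carrier \<open>G\<close>.\<close>

lemma (in function_algebra) series_in_finprod:
  fixes M :: "('n::finite mfps ^ 'n) monoid"
  assumes M: "comm_monoid M" "\<one>\<^bsub>M\<^esub> = mvars" "\<And>F G. F \<otimes>\<^bsub>M\<^esub> G = mcomp F G"
    and "finite S" and f: "\<And>s x. x \<in> S \<Longrightarrow> f s x \<in> carrier M"
    and "\<And>x i. x \<in> S \<Longrightarrow> series_in (\<lambda>s. f s x $ i)"
  shows "series_in (\<lambda>s. finprod M (f s) S $ i)"
  using assms(4-)
proof (induction S arbitrary: i rule: finite_induct)
  case empty
  interpret comm_monoid M by fact
  show ?case by (simp add: M(2) series_in_const)
next
  case (insert x S)
  interpret comm_monoid M by fact
  have "finprod M (f s) (insert x S) = mcomp (f s x) (finprod M (f s) S)" for s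
    using insert by (simp add: M(3) Pi_def)
  then show ?case using insert by (simp add: series_in_pullback)
qed

lemma (in formal_vector_field) inv_flow: "inv\<^bsub>formal_Diff\<^esub> (flow t) = flow (- t)"
  by (rule monoid.inv_char[OF monoid_formal_Diff])
    (simp_all only: flow_carrier formal_Diff_simps(2,3) flow_add right_minus left_minus flow_0)

theorem theorem1:
  fixes G :: "('n::finite mfps ^ 'n) set" and X Y :: "'n mfps set"
  assumes "subgroup G formal_Diff"
    and "finitely_generated G"
    and "\<forall>g\<in>G. \<forall>h\<in>G. g \<otimes>\<^bsub>formal_Diff\<^esub> h = h \<otimes>\<^bsub>formal_Diff\<^esub> g"
    and "formal_subvariety X" and "formal_subvariety Y"
  shows "\<exists>m::nat. \<forall>g\<in>G. intersection_mult (preimage g X) Y < \<infinity> \<longrightarrow>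
           intersection_mult (preimage g X) Y \<le> enat m"
proof -
  let ?D = "formal_Diff :: ('n mfps ^ 'n) monoid"
  let ?flow = "formal_vector_field.flow :: 'n mfps ^ 'n \<Rightarrow> complex \<Rightarrow> 'n mfps ^ 'n"
  interpret D: monoid ?D by (rule monoid_formal_Diff)
  interpret G: subgroup G ?D by fact
  obtain Fs vs where fin: "finite Fs" "finite vs" and Fs: "Fs \<subseteq> carrier ?D" and vs: "vs \<subseteq> max_tuples"
    and G_eq: "G = generate ?D (Fs \<union> {F. \<exists>v\<in>vs. \<exists>t. is_flow_map v t F})"
    using assms(2) unfolding finitely_generated_def by blast
  have vf: "formal_vector_field v" if "v \<in> vs" for v
    using that vs by (auto simp: formal_vector_field_def)
  have flows: "{F. \<exists>v\<in>vs. \<exists>t. is_flow_map v t F} = {?flow v t | v t. v \<in> vs}"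
    using formal_vector_field.is_flow_map_iff[OF vf] by auto
  \<comment> \<open>Inverses enter as generators of their own, so that natural exponents
    suffice.\<close>
  define Fs' where "Fs' = Fs \<union> m_inv ?D ` Fs"
  have fin': "finite Fs'" using fin by (simp add: Fs'_def)
  have Fs'_G: "Fs' \<subseteq> G"
    unfolding Fs'_def G_eq by (auto intro: generate.incl generate.inv)
  have flow_G: "?flow v t \<in> G" if "v \<in> vs" for v t
    unfolding G_eq flows using that by (intro generate.incl) blast
  define M where "M = ?D\<lparr>carrier := G\<rparr>"
  have M_simps: "carrier M = G" "\<one>\<^bsub>M\<^esub> = mvars" "F \<otimes>\<^bsub>M\<^esub> H = mcomp F H" for F H
    by (simp_all add: M_def formal_Diff_simps)
  interpret M: comm_monoid M
  proof
    show "x \<otimes>\<^bsub>M\<^esub> y \<in> carrier M" if "x \<in> carrier M" "y \<in> carrier M" for x y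
      using that G.m_closed by (simp add: M_def)
    show "\<one>\<^bsub>M\<^esub> \<in> carrier M" using G.one_closed by (simp add: M_def)
    show "x \<otimes>\<^bsub>M\<^esub> y \<otimes>\<^bsub>M\<^esub> z = x \<otimes>\<^bsub>M\<^esub> (y \<otimes>\<^bsub>M\<^esub> z)"
      if "x \<in> carrier M" "y \<in> carrier M" "z \<in> carrier M" for x y z
      using that G.subset D.m_assoc by (auto simp: M_def)
    show "x \<otimes>\<^bsub>M\<^esub> y = y \<otimes>\<^bsub>M\<^esub> x" if "x \<in> carrier M" "y \<in> carrier M" for x y
      using that assms(3) by (simp add: M_def)
    show "\<one>\<^bsub>M\<^esub> \<otimes>\<^bsub>M\<^esub> x = x" "x \<otimes>\<^bsub>M\<^esub> \<one>\<^bsub>M\<^esub> = x" if "x \<in> carrier M" for x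
      using that G.subset by (auto simp: M_def)
  qed
  have pow: "F [^]\<^bsub>M\<^esub> k = F [^]\<^bsub>?D\<^esub> k" for F and k :: nat
    by (simp add: M_def nat_pow_def)
  have pow_M: "F [^]\<^bsub>M\<^esub> (k :: nat) \<in> carrier M" if "F \<in> Fs'" for F k
    using that Fs'_G by (intro M.nat_pow_closed) (auto simp: M_simps)
  have Fs'_M: "F \<in> carrier M" if "F \<in> Fs'" for F
    using that Fs'_G by (auto simp: M_simps)
  have flow_M: "?flow v t \<in> carrier M" if "v \<in> vs" for v t
    using flow_G[OF that] by (simp add: M_simps)
  \<comment> \<open>A parameter is a pair: exponents \<nu> for the discrete generators and times
    \<tau> for the vector fields. Only the values on \<open>Fs'\<close> and \<open>vs\<close>
    influence \<open>g\<close>.\<close>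
  define p where "p \<nu> = finprod M (\<lambda>F. F [^]\<^bsub>M\<^esub> (\<nu> F :: nat)) Fs'" for \<nu>
  define q where "q \<tau> = finprod M (\<lambda>v. ?flow v (\<tau> v)) vs" for \<tau>
  define g where "g s = p (fst s) \<otimes>\<^bsub>M\<^esub> q (snd s)" for s
  have p_M: "p \<nu> \<in> carrier M" for \<nu> unfolding p_def by (intro M.finprod_closed) (auto intro: pow_M)
  have q_M: "q \<tau> \<in> carrier M" for \<tau> unfolding q_def by (intro M.finprod_closed) (auto intro: flow_M)
  have p_add: "p \<nu> \<otimes>\<^bsub>M\<^esub> p \<nu>' = p (\<lambda>F. \<nu> F + \<nu>' F)" for \<nu> \<nu>'
  proof -
    have "p (\<lambda>F. \<nu> F + \<nu>' F) = finprod M (\<lambda>F. F [^]\<^bsub>M\<^esub> \<nu> F \<otimes>\<^bsub>M\<^esub> F [^]\<^bsub>M\<^esub> \<nu>' F) Fs'"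
      unfolding p_def
      by (rule M.finprod_cong') (use Fs'_G pow_M in \<open>auto simp: M.nat_pow_mult M_simps(1)\<close>)
    then show ?thesis
      unfolding p_def by (simp add: M.finprod_multf pow_M)
  qed
  have q_add: "q \<tau> \<otimes>\<^bsub>M\<^esub> q \<tau>' = q (\<lambda>v. \<tau> v + \<tau>' v)" for \<tau> \<tau>'
  proof -
    have "q (\<lambda>v. \<tau> v + \<tau>' v) = finprod M (\<lambda>v. ?flow v (\<tau> v) \<otimes>\<^bsub>M\<^esub> ?flow v (\<tau>' v)) vs"
      unfolding q_def
      by (rule M.finprod_cong')
        (use flow_M in \<open>auto simp: M_simps(3) formal_vector_field.flow_add[OF vf]\<close>)
    then show ?thesis
      unfolding q_def by (simp add: M.finprod_multf flow_M)
  qed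
  have p_0: "p (\<lambda>_. 0) = \<one>\<^bsub>M\<^esub>" unfolding p_def by simp
  have q_0: "q (\<lambda>_. 0) = \<one>\<^bsub>M\<^esub>"
    unfolding q_def by (rule M.finprod_one_eqI) (simp add: formal_vector_field.flow_0[OF vf] M_simps)
  have p_single: "F = p (\<lambda>H. if F = H then 1 else 0)" if F: "F \<in> Fs'" for F
  proof -
    have "p (\<lambda>H. if F = H then 1 else 0) = finprod M (\<lambda>H. if F = H then H else \<one>\<^bsub>M\<^esub>) Fs'"
      unfolding p_def by (rule M.finprod_cong') (use Fs'_M in auto)
    also have "\<dots> = F"
      by (rule M.finprod_singleton[of _ _ "\<lambda>H. H"]) (use F fin' Fs'_M in auto)
    finally show ?thesis by simp
  qed
  have q_single: "?flow v t = q (\<lambda>w. if v = w then t else 0)" if v: "v \<in> vs" for v t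
  proof -
    have "q (\<lambda>w. if v = w then t else 0) = finprod M (\<lambda>w. if v = w then ?flow w t else \<one>\<^bsub>M\<^esub>) vs"
      unfolding q_def
      by (rule M.finprod_cong')
        (use flow_M in \<open>auto simp: formal_vector_field.flow_0[OF vf] simp flip: M_simps(2)\<close>)
    also have "\<dots> = ?flow v t"
      by (rule M.finprod_singleton[of _ _ "\<lambda>w. ?flow w t"]) (use v fin flow_M in auto)
    finally show ?thesis by simp
  qed
  \<comment> \<open>Commutativity regroups a product of two parametrised elements generator by
    generator, so exponents and times add.\<close>
  have g_mult: "g s \<otimes>\<^bsub>M\<^esub> g s' \<in> range g" for s s'
  proof -
    have "g s \<otimes>\<^bsub>M\<^esub> g s' = (p (fst s) \<otimes>\<^bsub>M\<^esub> p (fst s')) \<otimes>\<^bsub>M\<^esub> (q (snd s) \<otimes>\<^bsub>M\<^esub> q (snd s'))"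
      unfolding g_def using p_M q_M by (simp add: M.m_ac)
    also have "\<dots> = g (\<lambda>F. fst s F + fst s' F, \<lambda>v. snd s v + snd s' v)"
      by (simp add: g_def p_add q_add)
    finally show ?thesis by simp
  qed
  have Fs'_range: "F \<in> range g" if "F \<in> Fs'" for F
  proof -
    have "F = g (\<lambda>H. if F = H then 1 else 0, \<lambda>_. 0)"
      using p_single[OF that] Fs'_M[OF that] by (simp add: g_def q_0)
    then show ?thesis by blast
  qed
  have flow_range: "?flow v t \<in> range g" if "v \<in> vs" for v t
  proof -
    have "?flow v t = g (\<lambda>_. 0, \<lambda>w. if v = w then t else 0)"
      using q_single[OF that, of t] flow_M[OF that, of t] by (simp add: g_def p_0)
    then show ?thesis by blast
  qed
  have G_range: "h \<in> range g" if "h \<in> G" for h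
    using that unfolding G_eq flows
  proof (induction rule: generate.induct)
    case one
    have "\<one>\<^bsub>?D\<^esub> = g (\<lambda>_. 0, \<lambda>_. 0)" by (simp add: g_def p_0 q_0 M_def)
    then show ?case by blast
  next
    case (incl h)
    then show ?case using Fs'_range flow_range by (auto simp: Fs'_def)
  next
    case (inv h)
    then show ?case
      using Fs'_range flow_range formal_vector_field.inv_flow[OF vf] by (auto simp: Fs'_def)
  next
    case (eng h1 h2)
    then show ?case using g_mult by (auto simp: M_def)
  qed

  have "\<exists>B. finite B \<and> (\<forall>i \<gamma>. (\<lambda>n. mcoeff ((F [^]\<^bsub>M\<^esub> (n :: nat)) $ i) \<gamma>) \<in> falg B)" if "F \<in> Fs'" for F
    unfolding pow by (rule iterate_coeffs) (use that Fs'_G G.subset in auto)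
  then obtain BF where BF: "\<And>F. F \<in> Fs' \<Longrightarrow> finite (BF F)"
    "\<And>F i \<gamma>. F \<in> Fs' \<Longrightarrow> (\<lambda>n. mcoeff ((F [^]\<^bsub>M\<^esub> (n :: nat)) $ i) \<gamma>) \<in> falg (BF F)"
    by metis
  have "\<exists>B. finite B \<and> (\<forall>i \<gamma>. (\<lambda>t. mcoeff (?flow v t $ i) \<gamma>) \<in> falg B)" if "v \<in> vs" for v
    by (rule formal_vector_field.flow_coeffs[OF vf[OF that]])
  then obtain Bv where Bv: "\<And>v. v \<in> vs \<Longrightarrow> finite (Bv v)"
    "\<And>v i \<gamma>. v \<in> vs \<Longrightarrow> (\<lambda>t. mcoeff (?flow v t $ i) \<gamma>) \<in> falg (Bv v)"
    by metis
  \<comment> \<open>Each function of a single exponent or time is read as a function of the whole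
    parameter; the union stays finite because there are finitely many generators.\<close>
  define B where "B = (\<Union>F\<in>Fs'. (\<lambda>b s. b (fst s F)) ` BF F) \<union> (\<Union>v\<in>vs. (\<lambda>b s. b (snd s v)) ` Bv v)"
  interpret B: function_algebra "falg B" by (rule function_algebra_falg)
  have p_in: "B.series_in (\<lambda>s. p (fst s) $ i)" for i
    unfolding p_def
  proof (rule B.series_in_finprod[OF M.comm_monoid_axioms M_simps(2,3) fin' pow_M])
    fix F i assume F: "F \<in> Fs'"
    show "B.series_in (\<lambda>s. (F [^]\<^bsub>M\<^esub> fst s F) $ i)"
      unfolding B.series_in_def
    proof
      fix \<gamma>
      show "(\<lambda>s. mcoeff ((F [^]\<^bsub>M\<^esub> fst s F) $ i) \<gamma>) \<in> falg B"
        by (rule B.falg_reparam[OF BF(2)[OF F]]) (rule falg.base, use F in \<open>auto simp: B_def\<close>)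
    qed
  qed
  have q_in: "B.series_in (\<lambda>s. q (snd s) $ i)" for i
    unfolding q_def
  proof (rule B.series_in_finprod[OF M.comm_monoid_axioms M_simps(2,3) fin(2) flow_M])
    fix v i assume v: "v \<in> vs"
    show "B.series_in (\<lambda>s. ?flow v (snd s v) $ i)"
      unfolding B.series_in_def
    proof
      fix \<gamma>
      show "(\<lambda>s. mcoeff (?flow v (snd s v) $ i) \<gamma>) \<in> falg B"
        by (rule B.falg_reparam[OF Bv(2)[OF v]]) (rule falg.base, use v in \<open>auto simp: B_def\<close>)
    qed
  qed
  have g_in: "B.series_in (\<lambda>s. g s $ i)" for i
    unfolding g_def M_simps mcomp_nth by (intro B.series_in_pullback p_in q_in)
  have "finite B" unfolding B_def using fin fin' BF(1) Bv(1) by auto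
  from multiplicity_bounded_of_falg[OF this B.series_inD[OF g_in], of X Y]
  obtain m where m: "\<And>s. codim (joint_ideal (g s) X Y) < \<infinity> \<Longrightarrow> codim (joint_ideal (g s) X Y) \<le> enat m"
    by blast
  show ?thesis
  proof (intro exI ballI impI)
    fix h assume "h \<in> G" and fin: "intersection_mult (preimage h X) Y < \<infinity>"
    then obtain s where "h = g s" using G_range by blast
    with m[of s] fin show "intersection_mult (preimage h X) Y \<le> enat m"
      by (simp add: intersection_mult_preimage)
  qed
qed

end
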